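(* $\mathbf P$-a.s. the limit $\lim_{t\uparrow\tau,\ t<\tau}Y_t$ exists (in $[0,+\infty]$) and $$\lim_{t\uparrow\tau,\ t<\tau}Y_t\ \ge\ \xi .$$
   Context: $(\Omega,\mathcal F,\mathbf P)$ is a probability space carrying a $d$-dimensional Brownian motion $B$ with its standard (augmented) filtration $(\mathcal F_t)_{t\ge 0}$. $q>0$ is fixed. $D\subset\mathbb R^d$ is a bounded open set with boundary of class $C^2$. The functions $b:\mathbb R^d\to\mathbb R^d$ and $\sigma:\mathbb R^d\to\mathbb R^{d\times d}$ are measurable and, for some $K\ge 0$ and $\alpha>0$: $\|\sigma(x)-\sigma(y)\|\le K|x-y|$ for all $x,y$; $|b(x)|+\|\sigma(x)\|\le K$ for all $x$; $\sigma\sigma^*(x)\ge\alpha\,\mathrm{Id}$ for all $x$. $X^x$ is the unique strong solution of $X^x_t=x+\int_0^t b(X^x_r)dr+\int_0^t\sigma(X^x_r)dB_r$, and $\tau_x=\inf\{t\ge 0: X^x_t\notin\overline D\}$. It is known that $\tau_x<\infty$ a.s. for $x\in\overline D$, that $\tau_x=0$ a.s. for $x\in\partial D$, and that $\sup_{x\in\overline D}\mathbb E e^{\beta\tau_x}<\infty$ for some $\beta>0$. Fix $x\in D$ and write $X=X^x$, $\tau=\tau_x$. Let $\xi$ be an $\mathcal F_\tau$-measurable random variable with values in $[0,+\infty]$ and $\mathbf P(\xi=+\infty)>0$. For $n\in\mathbb N^*$ let $(Y^n,Z^n)$ be the unique pair of progressively measurable processes with values in $\mathbb R\times\mathbb R^d$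 such that a.s. $Y^n_t=\xi\wedge n$, $Z^n_t=0$ on $\{t\ge\tau\}$, $Y^n_{t\wedge\tau}=Y^n_{T\wedge\tau}-\int_{t\wedge\tau}^{T\wedge\tau}Y^n_r|Y^n_r|^qdr-\int_{t\wedge\tau}^{T\wedge\tau}Z^n_rdB_r$ for all $0\le t\le T$, and $\mathbb E\big(\sup_{0\le t\le\tau}e^{\beta t}|Y^n_t|^2+\int_0^\tau e^{\beta t}(|Y^n_t|^2+\|Z^n_t\|^2)dt\big)<\infty$ (existence and uniqueness are known). Then $0\le Y^n_t\le Y^m_t$ for $n\le m$, and $Y_t:=\lim_{n\to\infty}Y^n_t\in[0,+\infty]$. *)

theory Defs
  imports "HOL-Probability.Probability"
begin

text \<open>
  Conventions. Processes are functions of a time \<open>t :: real\<close>, of which only \<open>t \<ge> 0\<close> matters, and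
  of \<open>\<omega>\<close>. Random times take values in \<open>[0, \<infinity>]\<close> and are \<^typ>\<open>ereal\<close>-valued; filtrations are
  therefore indexed by \<^typ>\<open>ereal\<close>, so that \<open>filtration.pre_sigma\<close> applies to them.
\<close>

subsection \<open>Brownian motion and its augmented filtration\<close>

definition past_events ::
    "'w measure \<Rightarrow> (real \<Rightarrow> 'w \<Rightarrow> 'b::topological_space) \<Rightarrow> ereal \<Rightarrow> 'w set set" where
  "past_events M B t = {B s -` A \<inter> space M | s A. 0 \<le> s \<and> ereal s \<le> t \<and> A \<in> sets borel}"

definition brownian_motion :: "'w measure \<Rightarrow> (real \<Rightarrow> 'w \<Rightarrow> real ^ 'd) \<Rightarrow> bool" where
  "brownian_motion M B \<longleftrightarrow>
     (\<forall>t\<ge>0. B t \<in> borel_measurable M) \<and>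
     (AE \<omega> in M. B 0 \<omega> = 0) \<and>
     (AE \<omega> in M. continuous_on {0..} (\<lambda>t. B t \<omega>)) \<and>
     (\<forall>s t. 0 \<le> s \<and> s < t \<longrightarrow>
        distributed M lborel (\<lambda>\<omega>. B t \<omega> - B s \<omega>)
          (\<lambda>x. ennreal (\<Prod>i\<in>UNIV. normal_density 0 (sqrt (t - s)) (x $ i)))) \<and>
     (\<forall>s t. 0 \<le> s \<and> s < t \<longrightarrow>
        prob_space.indep_set M (sigma_sets (space M) (past_events M B (ereal s)))
          {(\<lambda>\<omega>. B t \<omega> - B s \<omega>) -` A \<inter> space M | A. A \<in> sets borel})"

definition augmented_filtration ::
    "'w measure \<Rightarrow> (real \<Rightarrow> 'w \<Rightarrow> 'b::topological_space) \<Rightarrow> ereal \<Rightarrow> 'w measure" where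
  "augmented_filtration M B t = sigma (space M) (past_events M B t \<union> null_sets M)"

lemma filtration_augmented_filtration: "filtration (space M) (augmented_filtration M B)"
proof
  have sub: "past_events M B t \<union> null_sets M \<subseteq> Pow (space M)" for t
    using sets.sets_into_space[of _ M] by (auto simp: past_events_def null_sets_def)
  show "space (augmented_filtration M B t) = space M" for t
    by (simp add: augmented_filtration_def space_measure_of[OF sub])
  fix s t :: ereal
  assume "s \<le> t"
  then have "past_events M B s \<subseteq> past_events M B t"
    unfolding past_events_def by (blast intro: order_trans)
  then show "sets (augmented_filtration M B s) \<subseteq> sets (augmented_filtration M B t)"
    by (auto simp: augmented_filtration_def sets_measure_of[OF sub] intro!: sigma_sets_mono')
qed

definition progressively_measurable ::
    "(ereal \<Rightarrow> 'w measure) \<Rightarrow> (real \<Rightarrow> 'w \<Rightarrow> 'b::topological_space) \<Rightarrow> bool" where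
  "progressively_measurable F X \<longleftrightarrow>
     (\<forall>T\<ge>0. (\<lambda>(t, \<omega>). X t \<omega>) \<in> borel_measurable (restrict_space borel {0..T} \<Otimes>\<^sub>M F (ereal T)))"

subsection \<open>The It\^o integral of square integrable integrands\<close>

text \<open>
  A simple integrand \<open>\<Sum>i<k. \<eta>\<^sub>i 1\<^bsub>(s\<^sub>i, s\<^sub>i\<^sub>+\<^sub>1]\<^esub>\<close> is given by its number \<open>k\<close> of steps, its
  subdivision \<open>s\<close> and its values \<open>\<eta>\<close>.
\<close>

definition simple_integrand ::
    "(ereal \<Rightarrow> 'w measure) \<Rightarrow> nat \<Rightarrow> (nat \<Rightarrow> real) \<Rightarrow> (nat \<Rightarrow> 'w \<Rightarrow> real ^ 'd) \<Rightarrow> bool" where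
  "simple_integrand F k s \<eta> \<longleftrightarrow>
     0 \<le> s 0 \<and> (\<forall>i<k. s i \<le> s (Suc i)) \<and>
     (\<forall>i<k. \<eta> i \<in> borel_measurable (F (ereal (s i))) \<and> bounded (\<eta> i ` space (F (ereal (s i)))))"

definition simple_process ::
    "nat \<Rightarrow> (nat \<Rightarrow> real) \<Rightarrow> (nat \<Rightarrow> 'w \<Rightarrow> real ^ 'd) \<Rightarrow> real \<Rightarrow> 'w \<Rightarrow> real ^ 'd" where
  "simple_process k s \<eta> t \<omega> = (\<Sum>i<k. indicat_real {s i<..s (Suc i)} t *\<^sub>R \<eta> i \<omega>)"

definition simple_integral ::
    "(real \<Rightarrow> 'w \<Rightarrow> real ^ 'd) \<Rightarrow> nat \<Rightarrow> (nat \<Rightarrow> real) \<Rightarrow> (nat \<Rightarrow> 'w \<Rightarrow> real ^ 'd) \<Rightarrow>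
      real \<Rightarrow> 'w \<Rightarrow> real" where
  "simple_integral B k s \<eta> t \<omega> =
     (\<Sum>i<k. \<eta> i \<omega> \<bullet> (B (min (s (Suc i)) t) \<omega> - B (min (s i) t) \<omega>))"

text \<open>
  \<open>ito_integral M B H I\<close>: the process \<open>I\<close> is an almost surely continuous version of
  \<open>(\<integral>\<^sub>0\<^sup>t H\<^sub>r dB\<^sub>r)\<^sub>t\<^sub>\<ge>\<^sub>0\<close>, the limit in \<open>L\<^sup>2\<close> of the integrals of simple integrands that converge to
  \<open>H\<close> in \<open>L\<^sup>2([0,T] \<times> \<Omega>)\<close>. This determines \<open>I\<close> up to indistinguishability.
\<close>

definition ito_integral ::
    "'w measure \<Rightarrow> (real \<Rightarrow> 'w \<Rightarrow> real ^ 'd) \<Rightarrow> (real \<Rightarrow> 'w \<Rightarrow> real ^ 'd) \<Rightarrow>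
      (real \<Rightarrow> 'w \<Rightarrow> real) \<Rightarrow> bool" where
  "ito_integral M B H I \<longleftrightarrow>
     progressively_measurable (augmented_filtration M B) H \<and>
     (\<forall>T\<ge>0. (\<integral>\<^sup>+\<omega>. (\<integral>\<^sup>+t\<in>{0..T}. ennreal ((norm (H t \<omega>))\<^sup>2) \<partial>lborel) \<partial>M) < \<infinity>) \<and>
     (\<forall>t\<ge>0. I t \<in> borel_measurable (augmented_filtration M B (ereal t))) \<and>
     (AE \<omega> in M. continuous_on {0..} (\<lambda>t. I t \<omega>)) \<and>
     (\<forall>T\<ge>0. \<exists>k s \<eta>.
        (\<forall>n. simple_integrand (augmented_filtration M B) (k n) (s n) (\<eta> n)) \<and>
        (\<lambda>n. \<integral>\<^sup>+\<omega>. (\<integral>\<^sup>+t\<in>{0..T}.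
            ennreal ((norm (simple_process (k n) (s n) (\<eta> n) t \<omega> - H t \<omega>))\<^sup>2) \<partial>lborel) \<partial>M)
          \<longlonglongrightarrow> 0 \<and>
        (\<forall>t\<in>{0..T}. (\<lambda>n. \<integral>\<^sup>+\<omega>.
            ennreal ((simple_integral B (k n) (s n) (\<eta> n) t \<omega> - I t \<omega>)\<^sup>2) \<partial>M) \<longlonglongrightarrow> 0))"

subsection \<open>The forward equation and the exit time\<close>

definition strong_solution ::
    "'w measure \<Rightarrow> (real \<Rightarrow> 'w \<Rightarrow> real ^ 'd) \<Rightarrow> (real ^ 'd \<Rightarrow> real ^ 'd) \<Rightarrow>
      (real ^ 'd \<Rightarrow> real ^ 'd ^ 'd) \<Rightarrow> real ^ 'd \<Rightarrow> (real \<Rightarrow> 'w \<Rightarrow> real ^ 'd) \<Rightarrow> bool" where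
  "strong_solution M B b \<sigma> x X \<longleftrightarrow>
     progressively_measurable (augmented_filtration M B) X \<and>
     (AE \<omega> in M. continuous_on {0..} (\<lambda>t. X t \<omega>)) \<and>
     (\<exists>I. (\<forall>i. ito_integral M B (\<lambda>t \<omega>. row i (\<sigma> (X t \<omega>))) (I i)) \<and>
          (AE \<omega> in M. \<forall>t\<ge>0.
             X t \<omega> = x + (LINT r:{0..t}|lborel. b (X r \<omega>)) + (\<chi> i. I i t \<omega>)))"

definition exit_time :: "'b set \<Rightarrow> (real \<Rightarrow> 'w \<Rightarrow> 'b) \<Rightarrow> 'w \<Rightarrow> ereal" where
  "exit_time A X \<omega> = Inf {ereal t | t. 0 \<le> t \<and> X t \<omega> \<notin> A}"

definition exp_moment :: "'w measure \<Rightarrow> real \<Rightarrow> ('w \<Rightarrow> ereal) \<Rightarrow> ennreal" where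
  "exp_moment M \<beta> \<tau> =
     (\<integral>\<^sup>+\<omega>. (if \<tau> \<omega> = \<infinity> then \<infinity> else ennreal (exp (\<beta> * real_of_ereal (\<tau> \<omega>)))) \<partial>M)"

subsection \<open>Domains with boundary of class $C^2$\<close>

definition C2_on :: "(real ^ 'd) set \<Rightarrow> (real ^ 'd \<Rightarrow> real) \<Rightarrow> (real ^ 'd \<Rightarrow> real ^ 'd) \<Rightarrow> bool" where
  "C2_on U \<rho> g \<longleftrightarrow>
     (\<exists>H :: real ^ 'd \<Rightarrow> real ^ 'd ^ 'd.
        (\<forall>x\<in>U. (\<rho> has_derivative (\<lambda>v. g x \<bullet> v)) (at x)) \<and>
        (\<forall>x\<in>U. (g has_derivative (\<lambda>v. H x *v v)) (at x)) \<and>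
        continuous_on U H)"

definition C2_boundary :: "(real ^ 'd) set \<Rightarrow> bool" where
  "C2_boundary D \<longleftrightarrow>
     (\<forall>p\<in>frontier D. \<exists>U \<rho> g.
        open U \<and> p \<in> U \<and> C2_on U \<rho> g \<and> (\<forall>x\<in>U. g x \<noteq> 0) \<and>
        D \<inter> U = {x\<in>U. \<rho> x < 0} \<and> frontier D \<inter> U = {x\<in>U. \<rho> x = 0})"

subsection \<open>The backward equation with random terminal time\<close>

text \<open>
  \<open>bsde_solution M B q \<beta> \<tau> \<zeta> Y Z\<close>: the pair \<open>(Y, Z)\<close> solves the backward equation with driver
  \<open>-y |y|\<^sup>q\<close> and terminal value \<open>\<zeta>\<close> at the random time \<open>\<tau>\<close>, in the space with weight
  \<open>exp (\<beta> t)\<close>. The stochastic integral between random times is a difference of values of the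
  process \<open>(\<integral>\<^sub>0\<^sup>t Z\<^sub>r dB\<^sub>r)\<^sub>t\<^sub>\<ge>\<^sub>0\<close>.
\<close>

definition stopped :: "real \<Rightarrow> ereal \<Rightarrow> real" where
  "stopped t \<tau> = real_of_ereal (min (ereal t) \<tau>)"

definition bsde_solution ::
    "'w measure \<Rightarrow> (real \<Rightarrow> 'w \<Rightarrow> real ^ 'd) \<Rightarrow> real \<Rightarrow> real \<Rightarrow> ('w \<Rightarrow> ereal) \<Rightarrow> ('w \<Rightarrow> real) \<Rightarrow>
      (real \<Rightarrow> 'w \<Rightarrow> real) \<Rightarrow> (real \<Rightarrow> 'w \<Rightarrow> real ^ 'd) \<Rightarrow> bool" where
  "bsde_solution M B q \<beta> \<tau> \<zeta> Y Z \<longleftrightarrow>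
     progressively_measurable (augmented_filtration M B) Y \<and>
     progressively_measurable (augmented_filtration M B) Z \<and>
     (AE \<omega> in M. \<forall>t\<ge>0. \<tau> \<omega> \<le> ereal t \<longrightarrow> Y t \<omega> = \<zeta> \<omega> \<and> Z t \<omega> = 0) \<and>
     (\<exists>I. ito_integral M B Z I \<and>
        (AE \<omega> in M. \<forall>t T. 0 \<le> t \<and> t \<le> T \<longrightarrow>
           Y (stopped t (\<tau> \<omega>)) \<omega> = Y (stopped T (\<tau> \<omega>)) \<omega>
             - (LINT r:{stopped t (\<tau> \<omega>)..stopped T (\<tau> \<omega>)}|lborel. Y r \<omega> * \<bar>Y r \<omega>\<bar> powr q)
             - (I (stopped T (\<tau> \<omega>)) \<omega> - I (stopped t (\<tau> \<omega>)) \<omega>))) \<and>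
     (\<integral>\<^sup>+\<omega>. ((SUP t\<in>{t. 0 \<le> t \<and> ereal t \<le> \<tau> \<omega>}. ennreal (exp (\<beta> * t) * \<bar>Y t \<omega>\<bar>\<^sup>2))
          + (\<integral>\<^sup>+t\<in>{t. 0 \<le> t \<and> ereal t \<le> \<tau> \<omega>}.
               ennreal (exp (\<beta> * t) * (\<bar>Y t \<omega>\<bar>\<^sup>2 + (norm (Z t \<omega>))\<^sup>2)) \<partial>lborel)) \<partial>M) < \<infinity>"

end

theory Submission
  imports Defs
begin

text \<open>
  The truncated solutions \<open>Y\<^sup>n\<close> increase to \<open>Y\<close>, are continuous and satisfy
  \<open>Y\<^sup>n = min \<xi> n\<close> at \<open>\<tau>\<close>. Hence any left limit of \<open>Y\<close> at \<open>\<tau>\<close> is at least \<open>min \<xi> n\<close> for every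
  \<open>n\<close>, so at least \<open>\<xi>\<close>; the substance of the theorem is that the left limit exists. An increasing
  limit of continuous processes may well oscillate, so a bound that is uniform in \<open>n\<close> is needed.

  The bound comes from the change of scale \<open>f(y) = -(1 + y)\<^sup>-\<^sup>q\<close>, which is increasing, bounded and
  concave on \<open>[0, \<infinity>)\<close> and satisfies \<open>f'(y) y\<^sup>1\<^sup>+\<^sup>q \<le> q\<close>. As \<open>Y\<^sup>n\<close> has drift \<open>(Y\<^sup>n)\<^sup>1\<^sup>+\<^sup>q\<close>, the process
  \<open>f(Y\<^sup>n\<^sub>t) - q t\<close> is a supermartingale with bounds that do not depend on \<open>n\<close>, and Doob's argument bounds
  the expected number of upcrossings of \<open>[a, b]\<close> by \<open>Y\<^sup>n\<close> on \<open>[0, T]\<close> uniformly in \<open>n\<close>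
  (\<open>expected_upcrossings\<close>). Finitely many oscillations of \<open>Y\<close> across \<open>[a, b]\<close> at arbitrary real
  times are oscillations of \<open>Y\<^sup>n\<close> for all large \<open>n\<close>, and then of \<open>Y\<^sup>n\<close> along all fine enough grids
  (\<open>no_limit_upcrossings\<close>). Two applications of Fatou's lemma therefore show that \<open>Y\<close> almost surely
  does not oscillate infinitely often (\<open>left_limit_exists\<close>).

  The role of It\^o's formula is played by concavity: \<open>f(z) - f(y) \<le> f'(y) (z - y)\<close>, so the gain of the
  upcrossing strategy on a grid is at most a martingale transform plus a Riemann-type sum of
  \<open>f'(Y\<^sup>n) (Y\<^sup>n)\<^sup>1\<^sup>+\<^sup>q\<close>, which is controlled by uniform continuity of the path as the mesh tends to zero.

  The order properties \<open>0 \<le> Y\<^sup>n \<le> Y\<^sup>n\<^sup>+\<^sup>1\<close> and \<open>Y\<^sup>n \<le> n\<close> follow from one comparison principle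
  (\<open>comparison\<close>): a continuous process whose increments dominate those of an \<open>L\<^sup>2\<close> martingale as
  long as it stays nonnegative, and whose positive part has an expectation tending to zero, is
  nonpositive. It is proved by stopping at the first negative time, along grids.

  What is used of stochastic integrals is that they are continuous \<open>L\<^sup>2\<close> martingales that do not move
  where the integrand vanishes (\<open>ito_integral_L2_martingale\<close>, \<open>ito_integral_local\<close>). Both pass to the
  limit from simple integrands, where they follow from the independence of Brownian increments.
\<close>

section \<open>Square integrable variables with vanishing conditional mean\<close>

lemma integrable_mult_square:
  fixes f g :: "'a \<Rightarrow> real"
  assumes [measurable]: "f \<in> borel_measurable M" "g \<in> borel_measurable M"
    and "integrable M (\<lambda>x. (f x)\<^sup>2)" "integrable M (\<lambda>x. (g x)\<^sup>2)"
  shows "integrable M (\<lambda>x. f x * g x)"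
proof (rule Bochner_Integration.integrable_bound)
  show "integrable M (\<lambda>x. (f x)\<^sup>2 + (g x)\<^sup>2)" using assms by simp
  have "\<bar>a * b\<bar> \<le> a\<^sup>2 + b\<^sup>2" for a b :: real
  proof -
    have "0 \<le> \<bar>a\<bar> * \<bar>b\<bar>" by simp
    moreover have "2 * (\<bar>a\<bar> * \<bar>b\<bar>) \<le> a\<^sup>2 + b\<^sup>2"
      using sum_squares_bound[of "\<bar>a\<bar>" "\<bar>b\<bar>"] by (simp add: mult.assoc)
    ultimately show ?thesis unfolding abs_mult by linarith
  qed
  then show "AE x in M. norm (f x * g x) \<le> norm ((f x)\<^sup>2 + (g x)\<^sup>2)"
    by (simp add: abs_mult)
qed simp

lemma integrable_square_add:
  fixes f g :: "'a \<Rightarrow> real"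
  assumes [measurable]: "f \<in> borel_measurable M" "g \<in> borel_measurable M"
    and "integrable M (\<lambda>x. (f x)\<^sup>2)" "integrable M (\<lambda>x. (g x)\<^sup>2)"
  shows "integrable M (\<lambda>x. (f x + g x)\<^sup>2)"
  using assms integrable_mult_square[OF assms] by (simp add: power2_sum mult.assoc)

lemma integrable_square_diff:
  fixes f g :: "'a \<Rightarrow> real"
  assumes [measurable]: "f \<in> borel_measurable M" "g \<in> borel_measurable M"
    and "integrable M (\<lambda>x. (f x)\<^sup>2)" "integrable M (\<lambda>x. (g x)\<^sup>2)"
  shows "integrable M (\<lambda>x. (f x - g x)\<^sup>2)"
  using assms integrable_mult_square[OF assms] by (simp add: power2_diff mult.assoc)

lemma (in finite_measure) integrable_of_square:
  fixes f :: "'a \<Rightarrow> real"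
  assumes "f \<in> borel_measurable M" "integrable M (\<lambda>x. (f x)\<^sup>2)"
  shows "integrable M f"
  using integrable_mult_square[of f M "\<lambda>_. 1"] assms by simp

lemma integrable_square_bounded_mult:
  fixes f h :: "'a \<Rightarrow> real"
  assumes [measurable]: "f \<in> borel_measurable M" "h \<in> borel_measurable M"
    and int: "integrable M (\<lambda>x. (f x)\<^sup>2)" and bound: "\<And>x. x \<in> space M \<Longrightarrow> \<bar>h x\<bar> \<le> c"
  shows "integrable M (\<lambda>x. (h x * f x)\<^sup>2)"
proof (rule Bochner_Integration.integrable_bound)
  show "integrable M (\<lambda>x. c\<^sup>2 * (f x)\<^sup>2)" using int by simp
  have "(h x)\<^sup>2 \<le> c\<^sup>2" if "x \<in> space M" for x
    using bound[OF that] abs_le_square_iff[of "h x" c] by auto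
  then show "AE x in M. norm ((h x * f x)\<^sup>2) \<le> norm (c\<^sup>2 * (f x)\<^sup>2)"
    by (auto simp: power_mult_distrib intro!: mult_right_mono)
qed simp

lemma (in finite_measure) integrable_square_indicator:
  fixes A :: "'a set"
  assumes "A \<in> sets M"
  shows "integrable M (\<lambda>x. (indicator A x :: real)\<^sup>2)"
  using assms by (intro integrable_const_bound[where B=1]) (auto simp: indicator_def)

text \<open>
  Orthogonality to all bounded functions measurable in \<open>G\<close>, that is, the conditional expectation of
  \<open>\<theta>\<close> given \<open>G\<close> vanishes. The formulation through sets is the one that survives limits in \<open>L\<^sup>2\<close>.
\<close>

definition null_mean_on :: "'a measure \<Rightarrow> 'a measure \<Rightarrow> ('a \<Rightarrow> real) \<Rightarrow> bool" where
  "null_mean_on M G \<theta> \<longleftrightarrow> \<theta> \<in> borel_measurable M \<and> integrable M (\<lambda>x. (\<theta> x)\<^sup>2) \<and>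
     (\<forall>A\<in>sets G. (\<integral>x. indicator A x * \<theta> x \<partial>M) = 0)"

text \<open>
  The passage from indicators to square integrable factors \<open>h\<close> is the pull-out property of
  conditional expectations.
\<close>

lemma (in prob_space) null_mean_on_mult:
  assumes G: "subalgebra M G" and \<theta>: "null_mean_on M G \<theta>"
    and h: "h \<in> borel_measurable G" "integrable M (\<lambda>x. (h x)\<^sup>2)"
  shows "(\<integral>x. h x * \<theta> x \<partial>M) = 0"
proof -
  interpret finite_measure_subalgebra M G
    using G by unfold_locales
  have \<theta>': "\<theta> \<in> borel_measurable M" "integrable M (\<lambda>x. (\<theta> x)\<^sup>2)"
      "\<And>A. A \<in> sets G \<Longrightarrow> (\<integral>x. indicator A x * \<theta> x \<partial>M) = 0"
    using \<theta> unfolding null_mean_on_def by blast+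
  have hM: "h \<in> borel_measurable M"
    by (rule measurable_from_subalg[OF G h(1)])
  have int: "integrable M (\<lambda>x. h x * \<theta> x)"
    by (rule integrable_mult_square[OF hM \<theta>'(1) h(2) \<theta>'(2)])
  have int\<theta>: "integrable M \<theta>"
    by (rule integrable_of_square[OF \<theta>'(1,2)])
  have "AE x in M. real_cond_exp M G \<theta> x = 0"
  proof (rule real_cond_exp_charact)
    fix A assume "A \<in> sets G"
    then show "(LINT x:A|M. \<theta> x) = (LINT x:A|M. 0)"
      using \<theta>'(3) by (simp add: set_lebesgue_integral_def)
  qed (simp_all add: int\<theta>)
  then have "(\<integral>x. h x * real_cond_exp M G \<theta> x \<partial>M) = 0"
    by (intro integral_eq_zero_AE) auto
  with real_cond_exp_intg(2)[OF int h(1)] \<theta>'(1) show ?thesis by simp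
qed

lemma (in prob_space) null_mean_on_mult_bounded:
  assumes G: "subalgebra M G" and \<theta>: "null_mean_on M G \<theta>"
    and h: "h \<in> borel_measurable G" and bound: "\<And>x. x \<in> space M \<Longrightarrow> \<bar>h x\<bar> \<le> c"
  shows "null_mean_on M G (\<lambda>x. h x * \<theta> x)"
proof -
  have \<theta>': "\<theta> \<in> borel_measurable M" "integrable M (\<lambda>x. (\<theta> x)\<^sup>2)"
      "\<And>A. A \<in> sets G \<Longrightarrow> (\<integral>x. indicator A x * \<theta> x \<partial>M) = 0"
    using \<theta> unfolding null_mean_on_def by blast+
  have hM[measurable]: "h \<in> borel_measurable M"
    by (rule measurable_from_subalg[OF G h(1)])
  have [measurable]: "\<theta> \<in> borel_measurable M" by (rule \<theta>'(1))
  have "(\<integral>x. indicator A x * (h x * \<theta> x) \<partial>M) = 0" if A: "A \<in> sets G" for A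
  proof -
    have "(\<integral>x. (indicator A x * h x) * \<theta> x \<partial>M) = 0"
    proof (rule null_mean_on_mult[OF G \<theta>])
      show "(\<lambda>x. indicator A x * h x) \<in> borel_measurable G" using A h by simp
      have "A \<in> sets M" using A G by (auto simp: subalgebra_def)
      then have "integrable M (\<lambda>x. (h x * indicator A x)\<^sup>2)"
        by (intro integrable_square_bounded_mult[where c=c] integrable_square_indicator bound) auto
      then show "integrable M (\<lambda>x. (indicator A x * h x)\<^sup>2)" by (simp add: mult.commute)
    qed
    then show ?thesis by (simp add: mult.assoc)
  qed
  moreover have "integrable M (\<lambda>x. (h x * \<theta> x)\<^sup>2)"
    by (rule integrable_square_bounded_mult[OF \<theta>'(1) hM \<theta>'(2) bound])
  ultimately show ?thesis unfolding null_mean_on_def by simp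
qed

text \<open>
  Martingale differences are orthogonal in \<open>L\<^sup>2\<close>: each cross term pairs \<open>\<theta> k\<close> with a sum that is
  already known to \<open>G k\<close>. This one identity serves the It\^o isometry and the stopping argument.
\<close>

lemma (in prob_space) square_of_null_mean_sum:
  fixes \<theta> :: "nat \<Rightarrow> 'a \<Rightarrow> real"
  assumes G: "\<And>i. i < k \<Longrightarrow> subalgebra M (G i)"
    and \<theta>: "\<And>i. i < k \<Longrightarrow> null_mean_on M (G i) (\<theta> i)"
    and adapted: "\<And>i j. j < i \<Longrightarrow> i < k \<Longrightarrow> \<theta> j \<in> borel_measurable (G i)"
  shows "integrable M (\<lambda>x. (\<Sum>i<k. \<theta> i x)\<^sup>2) \<and>
    (\<integral>x. (\<Sum>i<k. \<theta> i x)\<^sup>2 \<partial>M) = (\<Sum>i<k. \<integral>x. (\<theta> i x)\<^sup>2 \<partial>M)"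
  using assms
proof (induction k)
  case (Suc k)
  let ?S = "\<lambda>x. \<Sum>i<k. \<theta> i x"
  have IH: "integrable M (\<lambda>x. (?S x)\<^sup>2)" "(\<integral>x. (?S x)\<^sup>2 \<partial>M) = (\<Sum>i<k. \<integral>x. (\<theta> i x)\<^sup>2 \<partial>M)"
    using Suc by auto
  have SG: "?S \<in> borel_measurable (G k)"
    using Suc.prems(3) by (intro borel_measurable_sum) auto
  have SM: "?S \<in> borel_measurable M"
    by (rule measurable_from_subalg[OF Suc.prems(1)[of k] SG]) simp
  have \<theta>k: "\<theta> k \<in> borel_measurable M" "integrable M (\<lambda>x. (\<theta> k x)\<^sup>2)"
    using Suc.prems(2)[of k] by (auto simp: null_mean_on_def)
  have "(\<integral>x. ?S x * \<theta> k x \<partial>M) = 0"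
    using null_mean_on_mult[OF Suc.prems(1)[of k] Suc.prems(2)[of k] SG IH(1)] by simp
  moreover have prod: "integrable M (\<lambda>x. ?S x * \<theta> k x)"
    by (rule integrable_mult_square[OF SM \<theta>k(1) IH(1) \<theta>k(2)])
  moreover have "(\<integral>x. (?S x + \<theta> k x)\<^sup>2 \<partial>M) = (\<integral>x. (?S x)\<^sup>2 + (\<theta> k x)\<^sup>2 + 2 * (?S x * \<theta> k x) \<partial>M)"
    by (simp only: power2_sum mult.assoc)
  moreover have "\<dots> = (\<integral>x. (?S x)\<^sup>2 \<partial>M) + (\<integral>x. (\<theta> k x)\<^sup>2 \<partial>M) + 2 * (\<integral>x. ?S x * \<theta> k x \<partial>M)"
    using IH(1) \<theta>k(2) prod by simp
  moreover have "integrable M (\<lambda>x. (?S x + \<theta> k x)\<^sup>2)"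
    by (rule integrable_square_add[OF SM \<theta>k(1) IH(1) \<theta>k(2)])
  ultimately show ?case
    using IH(2) by (simp only: sum.lessThan_Suc) simp
qed simp

text \<open>
  Positivity of the variance.
\<close>

lemma (in prob_space) square_integral_le:
  fixes f :: "'a \<Rightarrow> real"
  assumes "f \<in> borel_measurable M" "integrable M (\<lambda>x. (f x)\<^sup>2)"
  shows "(\<integral>x. f x \<partial>M)\<^sup>2 \<le> (\<integral>x. (f x)\<^sup>2 \<partial>M)"
  using variance_eq[OF integrable_of_square[OF assms] assms(2)] variance_positive[of f] by simp

lemma null_mean_on_zero: "null_mean_on M G (\<lambda>_. 0)"
  by (simp add: null_mean_on_def)

lemma (in prob_space) null_mean_on_add:
  assumes "subalgebra M G" "null_mean_on M G f" "null_mean_on M G g"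
  shows "null_mean_on M G (\<lambda>x. f x + g x)"
proof -
  have f: "f \<in> borel_measurable M" "integrable M (\<lambda>x. (f x)\<^sup>2)"
      "\<And>A. A \<in> sets G \<Longrightarrow> (\<integral>x. indicator A x * f x \<partial>M) = 0"
    using assms(2) unfolding null_mean_on_def by blast+
  have g: "g \<in> borel_measurable M" "integrable M (\<lambda>x. (g x)\<^sup>2)"
      "\<And>A. A \<in> sets G \<Longrightarrow> (\<integral>x. indicator A x * g x \<partial>M) = 0"
    using assms(3) unfolding null_mean_on_def by blast+
  have "(\<integral>x. indicator A x * (f x + g x) \<partial>M) = 0" if A: "A \<in> sets G" for A
  proof -
    have AM: "A \<in> sets M" using A assms(1) by (auto simp: subalgebra_def)
    have "integrable M (\<lambda>x. indicator A x * f x)" "integrable M (\<lambda>x. indicator A x * g x)"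
      using integrable_mult_indicator[OF AM integrable_of_square[OF f(1,2)]]
        integrable_mult_indicator[OF AM integrable_of_square[OF g(1,2)]] by simp_all
    then show ?thesis using f(3)[OF A] g(3)[OF A] by (simp add: distrib_left)
  qed
  then show ?thesis
    using f(1) g(1) integrable_square_add[OF f(1) g(1) f(2) g(2)] unfolding null_mean_on_def by simp
qed

lemma (in prob_space) null_mean_on_sum:
  assumes "subalgebra M G" "finite J" "\<And>j. j \<in> J \<Longrightarrow> null_mean_on M G (f j)"
  shows "null_mean_on M G (\<lambda>x. \<Sum>j\<in>J. f j x)"
  using assms(2,3)
proof (induction J rule: finite_induct)
  case (insert j J)
  then show ?case using null_mean_on_add[OF assms(1), of "f j" "\<lambda>x. \<Sum>j\<in>J. f j x"] by simp
qed (simp add: null_mean_on_zero)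

section \<open>Brownian increments and the augmented filtration\<close>

locale brownian_space = prob_space M for M :: "'w measure" +
  fixes B :: "real \<Rightarrow> 'w \<Rightarrow> real ^ 'd"
  assumes BM: "brownian_motion M B"
begin

abbreviation F :: "ereal \<Rightarrow> 'w measure" where
  "F \<equiv> augmented_filtration M B"

lemma B_measurable: "0 \<le> t \<Longrightarrow> B t \<in> borel_measurable M"
  using BM by (simp add: brownian_motion_def)

lemma generator_subset: "past_events M B t \<union> null_sets M \<subseteq> Pow (space M)"
  using sets.sets_into_space[of _ M] by (auto simp: past_events_def null_sets_def)

lemma past_events_subset: "past_events M B t \<subseteq> sets M"
  unfolding past_events_def using B_measurable by (auto intro: measurable_sets)

lemma space_F [simp]: "space (F t) = space M"
  by (simp add: augmented_filtration_def space_measure_of[OF generator_subset])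

lemma sets_F: "sets (F t) = sigma_sets (space M) (past_events M B t \<union> null_sets M)"
  by (simp add: augmented_filtration_def sets_measure_of[OF generator_subset])

lemma subalgebra_F: "subalgebra M (F t)"
proof -
  have "sigma_sets (space M) (past_events M B t \<union> null_sets M) \<subseteq> sets M"
    using past_events_subset by (intro sets.sigma_sets_subset) (auto simp: null_sets_def)
  then show ?thesis by (simp add: subalgebra_def sets_F)
qed

lemma sets_F_mono: "s \<le> t \<Longrightarrow> sets (F s) \<subseteq> sets (F t)"
  using filtration.sets_F_mono[OF filtration_augmented_filtration] .

lemma sets_F_M: "A \<in> sets (F t) \<Longrightarrow> A \<in> sets M"
  using subalgebra_F[of t] by (auto simp: subalgebra_def)

lemma measurable_F_mono: "f \<in> borel_measurable (F s) \<Longrightarrow> s \<le> t \<Longrightarrow> f \<in> borel_measurable (F t)"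
  by (rule measurable_from_subalg[of "F t" "F s"]) (auto simp: subalgebra_def dest: sets_F_mono)

lemma measurable_F_M: "f \<in> borel_measurable (F s) \<Longrightarrow> f \<in> borel_measurable M"
  by (rule measurable_from_subalg[OF subalgebra_F])

lemma B_adapted:
  assumes "0 \<le> s" "ereal s \<le> t"
  shows "B s \<in> borel_measurable (F t)"
proof (rule measurableI)
  fix A :: "(real ^ 'd) set" assume "A \<in> sets borel"
  then have "B s -` A \<inter> space M \<in> past_events M B t"
    using assms by (auto simp: past_events_def)
  then show "B s -` A \<inter> space (F t) \<in> sets (F t)"
    by (simp add: sets_F sigma_sets.Basic)
qed simp

text \<open>
  Adding null sets to the generator changes no event by more than a null set, so independence of
  the past carries over to the augmented filtration.
\<close>

lemma augmented_event_AE_past: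
  assumes "A \<in> sets (F t)"
  shows "\<exists>A'\<in>sigma_sets (space M) (past_events M B t). AE w in M. w \<in> A \<longleftrightarrow> w \<in> A'"
  using assms unfolding sets_F
proof (induction rule: sigma_sets.induct)
  case (Basic a)
  then show ?case
  proof
    assume "a \<in> null_sets M"
    then have "AE w in M. w \<in> a \<longleftrightarrow> w \<in> {}" using AE_not_in by auto
    then show ?thesis using sigma_sets.Empty by blast
  qed (use sigma_sets.Basic in blast)
next
  case Empty
  show ?case using sigma_sets.Empty by fastforce
next
  case (Compl a)
  then obtain a' where a': "a' \<in> sigma_sets (space M) (past_events M B t)"
    "AE w in M. w \<in> a \<longleftrightarrow> w \<in> a'" by blast
  from a'(2) have "AE w in M. w \<in> space M - a \<longleftrightarrow> w \<in> space M - a'" by eventually_elim auto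
  then show ?case using sigma_sets.Compl[OF a'(1)] by blast
next
  case (Union a)
  then obtain a' where a': "\<And>i. a' i \<in> sigma_sets (space M) (past_events M B t)"
    "\<And>i. AE w in M. w \<in> a i \<longleftrightarrow> w \<in> a' i" by metis
  from a'(2) have "AE w in M. \<forall>i. w \<in> a i \<longleftrightarrow> w \<in> a' i" by (simp add: AE_all_countable)
  then have "AE w in M. w \<in> \<Union>(range a) \<longleftrightarrow> w \<in> \<Union>(range a')" by eventually_elim auto
  then show ?case using sigma_sets.Union[of a'] a'(1) by blast
qed

lemma increment_indep:
  assumes "0 \<le> s" "s < t" "A \<in> sets (F s)" "S \<in> sets borel"
  shows "prob (A \<inter> ((\<lambda>w. B t w - B s w) -` S \<inter> space M)) =
    prob A * prob ((\<lambda>w. B t w - B s w) -` S \<inter> space M)"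
proof -
  let ?C = "(\<lambda>w. B t w - B s w) -` S \<inter> space M"
  obtain A' where A': "A' \<in> sigma_sets (space M) (past_events M B s)"
    and eq: "AE w in M. w \<in> A \<longleftrightarrow> w \<in> A'"
    using augmented_event_AE_past[OF assms(3)] by blast
  have ind: "indep_set (sigma_sets (space M) (past_events M B (ereal s)))
          {(\<lambda>w. B t w - B s w) -` A \<inter> space M | A. A \<in> sets borel}"
    using BM assms by (simp add: brownian_motion_def)
  have C: "?C \<in> {(\<lambda>w. B t w - B s w) -` A \<inter> space M | A. A \<in> sets borel}"
    using assms by blast
  have CM: "?C \<in> sets M" using indep_setD_ev2[OF ind] C by blast
  have AM: "A \<in> sets M" "A' \<in> sets M"
    using sets_F_M[OF assms(3)] indep_setD_ev1[OF ind] A' by blast+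
  have "prob (A \<inter> ?C) = prob (A' \<inter> ?C)"
    using eq AM CM by (intro finite_measure_eq_AE) auto
  also have "\<dots> = prob A' * prob ?C" by (rule indep_setD[OF ind A' C])
  also have "prob A' = prob A"
    using eq AM by (intro finite_measure_eq_AE) auto
  finally show ?thesis .
qed

lemma increment_indep_var:
  fixes h :: "'w \<Rightarrow> real" and g :: "real ^ 'd \<Rightarrow> real"
  assumes st: "0 \<le> s" "s < t" and h: "h \<in> borel_measurable (F s)" and g: "g \<in> borel_measurable borel"
  shows "indep_var borel h borel (\<lambda>w. g (B t w - B s w))"
proof -
  let ?D = "\<lambda>w. B t w - B s w"
  have D: "?D \<in> borel_measurable M" using B_measurable st by simp
  have hM: "h \<in> borel_measurable M" by (rule measurable_F_M[OF h])
  have gM: "(\<lambda>w. g (?D w)) \<in> borel_measurable M" using g D by simp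
  have 1: "sigma_sets (space M) {h -` A \<inter> space M | A. A \<in> sets borel} \<subseteq> sets (F s)"
    using sets.sigma_sets_subset[of "{h -` A \<inter> space M | A. A \<in> sets borel}" "F s"] measurable_sets[OF h] by auto
  have V: "sigma_sets (space M) S \<subseteq> sets (vimage_algebra (space M) ?D borel)"
    if "S \<subseteq> sets (vimage_algebra (space M) ?D borel)" for S
    using sets.sigma_sets_subset[OF that] by simp
  have 2: "sigma_sets (space M) {(\<lambda>w. g (?D w)) -` A \<inter> space M | A. A \<in> sets borel}
     \<subseteq> sets (vimage_algebra (space M) ?D borel)"
  proof -
    have "(\<lambda>w. g (?D w)) -` A \<inter> space M \<in> sets (vimage_algebra (space M) ?D borel)"
      if "A \<in> sets borel" for A
    proof -
      have "g -` A \<in> sets borel" using measurable_sets[OF g that] by simp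
      moreover have "(\<lambda>w. g (?D w)) -` A \<inter> space M = ?D -` (g -` A) \<inter> space M"
        unfolding vimage_def by simp
      ultimately show ?thesis by (simp only: in_vimage_algebra)
    qed
    then show ?thesis by (intro V) blast
  qed
  have "indep_set (sigma_sets (space M) {h -` A \<inter> space M | A. A \<in> sets borel})
    (sigma_sets (space M) {(\<lambda>w. g (?D w)) -` A \<inter> space M | A. A \<in> sets borel})"
    unfolding indep_sets2_eq
  proof (intro conjI ballI)
    show "sigma_sets (space M) {h -` A \<inter> space M | A. A \<in> sets borel} \<subseteq> events"
      using 1 sets_F_M by blast
    have "?D -` A \<inter> space M \<in> events" if "A \<in> sets borel" for A
      using measurable_sets[OF D that] .
    then show "sigma_sets (space M) {(\<lambda>w. g (?D w)) -` A \<inter> space M | A. A \<in> sets borel} \<subseteq> events"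
      using 2 by (auto simp: sets_vimage_algebra2)
    fix a c
    assume a: "a \<in> sigma_sets (space M) {h -` A \<inter> space M | A. A \<in> sets borel}"
      and c: "c \<in> sigma_sets (space M) {(\<lambda>w. g (?D w)) -` A \<inter> space M | A. A \<in> sets borel}"
    from c 2 have "c \<in> sets (vimage_algebra (space M) ?D borel)" by blast
    then obtain S where "S \<in> sets borel" "c = ?D -` S \<inter> space M"
      by (auto simp: sets_vimage_algebra2)
    then show "prob (a \<inter> c) = prob a * prob c"
      using increment_indep[OF st _ \<open>S \<in> sets borel\<close>, of a] a 1 by blast
  qed
  then show ?thesis unfolding indep_var_eq using hM gM by simp
qed

text \<open>
  The joint density is a product over coordinates, and all factors but one integrate to one.
\<close>

lemma increment_coordinate_distributed:
  assumes st: "0 \<le> s" "s < t"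
  shows "distributed M lborel (\<lambda>w. B t w $ i - B s w $ i) (normal_density 0 (sqrt (t - s)))"
proof -
  let ?D = "\<lambda>w. B t w - B s w" and ?\<sigma> = "sqrt (t - s)"
  let ?p = "\<lambda>x::real ^ 'd. ennreal (\<Prod>i\<in>UNIV. normal_density 0 ?\<sigma> (x $ i))"
  have D: "?D \<in> borel_measurable M" using B_measurable st by simp
  have comp[measurable]: "(\<lambda>x::real ^ 'd. x $ i) \<in> borel_measurable borel" for i
    by (intro borel_measurable_continuous_onI continuous_intros)
  have X[measurable]: "(\<lambda>w. B t w $ i - B s w $ i) \<in> borel_measurable M"
    using measurable_compose[OF D comp[of i]] by simp
  have dist: "distributed M lborel ?D ?p"
    using BM st by (simp add: brownian_motion_def)
  have pos: "0 < ?\<sigma>" using st by simp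
  interpret N: prob_space "density lborel (normal_density 0 ?\<sigma>)"
    by (rule prob_space_normal_density[OF pos])
  have one: "(\<integral>\<^sup>+y. ennreal (normal_density 0 ?\<sigma> y) \<partial>lborel) = 1"
    using N.emeasure_space_1 by (simp add: emeasure_density)
  have Basis: "(Basis :: (real ^ 'd) set) = range (\<lambda>j::'d. axis j (1::real))"
    by (auto simp: Basis_vec_def)
  have inj: "inj (\<lambda>j::'d. axis j (1::real))"
    by (auto simp: inj_def axis_eq_axis)
  have "emeasure (distr M lborel (\<lambda>w. B t w $ i - B s w $ i)) A
      = emeasure (density lborel (normal_density 0 ?\<sigma>)) A" if A: "A \<in> sets borel" for A
  proof -
    have [measurable]: "A \<in> sets borel" by fact
    let ?f = "\<lambda>(b :: real ^ 'd) y. ennreal (normal_density 0 ?\<sigma> y) * (if b = axis i 1 then indicator A y else 1)"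
    have "emeasure (distr M lborel (\<lambda>w. B t w $ i - B s w $ i)) A
      = (\<integral>\<^sup>+w. indicator A (B t w $ i - B s w $ i) \<partial>M)"
      using A by (simp add: emeasure_distr nn_integral_distr flip: nn_integral_indicator)
    also have "\<dots> = (\<integral>\<^sup>+w. indicator A (?D w $ i) \<partial>M)" by simp
    also have "\<dots> = (\<integral>\<^sup>+x. ?p x * indicator A (x $ i) \<partial>lborel)"
      by (rule distributed_nn_integral[OF dist, symmetric]) simp
    also have "\<dots> = (\<integral>\<^sup>+x. (\<Prod>b\<in>Basis. ?f b (x \<bullet> b)) \<partial>lborel)"
    proof (rule nn_integral_cong)
      fix x :: "real ^ 'd"
      have "(\<Prod>b\<in>Basis. ?f b (x \<bullet> b)) = (\<Prod>j\<in>UNIV. ?f (axis j 1) (x $ j))"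
        unfolding Basis by (subst prod.reindex[OF inj]) (simp add: inner_axis o_def axis_eq_axis cong: if_cong)
      also have "\<dots> = (\<Prod>j\<in>UNIV. ennreal (normal_density 0 ?\<sigma> (x $ j))) *
          (\<Prod>j\<in>UNIV. if j = i then indicator A (x $ i) else 1)"
        by (subst prod.distrib[symmetric], rule prod.cong) (auto simp: axis_eq_axis)
      also have "\<dots> = ?p x * indicator A (x $ i)"
        by (simp add: prod_ennreal)
      finally show "?p x * indicator A (x $ i) = (\<Prod>b\<in>Basis. ?f b (x \<bullet> b))" ..
    qed
    also have "\<dots> = (\<Prod>b\<in>Basis. \<integral>\<^sup>+y. ?f b y \<partial>lborel)"
      by (rule nn_integral_lborel_prod) auto
    also have "\<dots> = (\<Prod>j\<in>UNIV. \<integral>\<^sup>+y. ?f (axis j 1) y \<partial>lborel)"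
      unfolding Basis by (subst prod.reindex[OF inj]) (simp add: o_def)
    also have "\<dots> = (\<Prod>j\<in>UNIV. if j = i then emeasure (density lborel (normal_density 0 ?\<sigma>)) A else 1)"
      by (rule prod.cong) (auto simp: axis_eq_axis one emeasure_density)
    also have "\<dots> = emeasure (density lborel (normal_density 0 ?\<sigma>)) A"
      by simp
    finally show ?thesis .
  qed
  then have "distr M lborel (\<lambda>w. B t w $ i - B s w $ i) = density lborel (normal_density 0 ?\<sigma>)"
    by (intro measure_eqI) auto
  then show ?thesis unfolding distributed_def by simp
qed

lemma
  assumes st: "0 \<le> s" "s \<le> t"
  shows increment_coordinate_measurable: "(\<lambda>w. B t w $ i - B s w $ i) \<in> borel_measurable M"
    and increment_coordinate_square: "integrable M (\<lambda>w. (B t w $ i - B s w $ i)\<^sup>2)"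
      "(\<integral>w. (B t w $ i - B s w $ i)\<^sup>2 \<partial>M) = t - s"
    and increment_null_mean: "null_mean_on M (F s) (\<lambda>w. B t w $ i - B s w $ i)"
proof -
  let ?X = "\<lambda>w. B t w $ i - B s w $ i"
  have comp: "(\<lambda>x::real ^ 'd. x $ i) \<in> borel_measurable borel"
    by (intro borel_measurable_continuous_onI continuous_intros)
  show X: "?X \<in> borel_measurable M"
    using measurable_compose[OF B_measurable comp] st by simp
  have *: "integrable M (\<lambda>w. (?X w)\<^sup>2) \<and> (\<integral>w. (?X w)\<^sup>2 \<partial>M) = t - s \<and> null_mean_on M (F s) ?X"
  proof (cases "s = t")
    case True
    then show ?thesis by (simp add: null_mean_on_def)
  next
    case False
    then have s_t: "s < t" using st by simp
    then have pos: "0 < sqrt (t - s)" by simp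
    note D = increment_coordinate_distributed[OF st(1) s_t, of i]
    have mean: "expectation ?X = 0" by (rule normal_distributed_expectation[OF pos D])
    have "integrable lborel (\<lambda>x. normal_density 0 (sqrt (t - s)) x * (x - 0) ^ 2)"
      by (rule integrable_normal_moment[OF pos])
    then have int: "integrable M (\<lambda>w. (?X w)\<^sup>2)"
      using distributed_integrable[OF D, of "\<lambda>x. x\<^sup>2"] by simp
    have sq: "(\<integral>w. (?X w)\<^sup>2 \<partial>M) = t - s"
      using normal_distributed_variance[OF pos D] mean s_t by simp
    have "(\<integral>w. indicator A w * ?X w \<partial>M) = 0" if A: "A \<in> sets (F s)" for A
    proof -
      have "indep_var borel (indicator A) borel (\<lambda>w. (\<lambda>x. x $ i) (B t w - B s w))"
        using A by (intro increment_indep_var[OF st(1) s_t] comp) simp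
      then have ind: "indep_var borel (indicator A :: _ \<Rightarrow> real) borel ?X" by simp
      have "integrable M (indicator A :: _ \<Rightarrow> real)"
        using sets_F_M[OF A] by (intro integrable_const_bound[where B=1]) (auto simp: indicator_def)
      from indep_var_lebesgue_integral[OF ind this integrable_of_square[OF X int]] mean
      show ?thesis by simp
    qed
    then show ?thesis using X int sq by (simp add: null_mean_on_def)
  qed
  show "integrable M (\<lambda>w. (?X w)\<^sup>2)" "(\<integral>w. (?X w)\<^sup>2 \<partial>M) = t - s" "null_mean_on M (F s) ?X"
    using * by blast+
qed

text \<open>
  A weighted second moment suffices in place of the exact isometry of each step: the
  Cauchy-Schwarz inequality costs a factor \<open>CARD('d)\<close>, which is irrelevant for the vanishing
  statement \<open>ito_integral_local\<close>.
\<close>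

lemma increment_weighted_square:
  fixes s t :: real
  assumes st: "0 \<le> s" "s \<le> t" and h: "h \<in> borel_measurable (F s)"
    and bound: "\<And>w. w \<in> space M \<Longrightarrow> \<bar>h w\<bar> \<le> c"
  shows "integrable M (\<lambda>w. h w * (norm (B t w - B s w))\<^sup>2)"
    and "(\<integral>w. h w * (norm (B t w - B s w))\<^sup>2 \<partial>M) = (\<integral>w. h w \<partial>M) * (real CARD('d) * (t - s))"
proof -
  have hM: "h \<in> borel_measurable M" by (rule measurable_F_M[OF h])
  have inth: "integrable M h"
    using hM bound by (intro integrable_const_bound[where B=c]) auto
  have norm: "(norm (B t w - B s w))\<^sup>2 = (\<Sum>i\<in>UNIV. (B t w $ i - B s w $ i)\<^sup>2)" for w
    by (simp only: power2_norm_eq_inner inner_vec_def) (simp add: power2_eq_square)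
  have intN: "integrable M (\<lambda>w. (norm (B t w - B s w))\<^sup>2)"
    unfolding norm using increment_coordinate_square(1)[OF st] by simp
  have eN: "(\<integral>w. (norm (B t w - B s w))\<^sup>2 \<partial>M) = real CARD('d) * (t - s)"
    unfolding norm using increment_coordinate_square[OF st] by simp
  have *: "integrable M (\<lambda>w. h w * (norm (B t w - B s w))\<^sup>2) \<and>
    (\<integral>w. h w * (norm (B t w - B s w))\<^sup>2 \<partial>M) = (\<integral>w. h w \<partial>M) * (real CARD('d) * (t - s))"
  proof (cases "s = t")
    case False
    then have s_t: "s < t" using st by simp
    have "indep_var borel h borel (\<lambda>w. (\<lambda>x. (norm x)\<^sup>2) (B t w - B s w))"
      by (rule increment_indep_var[OF st(1) s_t h]) simp
    then have ind: "indep_var borel h borel (\<lambda>w. (norm (B t w - B s w))\<^sup>2)" by simp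
    show ?thesis
      using indep_var_integrable[OF ind inth intN] indep_var_lebesgue_integral[OF ind inth intN] eN
      by simp
  qed simp
  show "integrable M (\<lambda>w. h w * (norm (B t w - B s w))\<^sup>2)"
    "(\<integral>w. h w * (norm (B t w - B s w))\<^sup>2 \<partial>M) = (\<integral>w. h w \<partial>M) * (real CARD('d) * (t - s))"
    using * by blast+
qed

end

section \<open>Integrals of simple integrands\<close>

abbreviation (in prob_space) mean_square :: "('a \<Rightarrow> real) \<Rightarrow> ennreal" where
  "mean_square f \<equiv> \<integral>\<^sup>+x. ennreal ((f x)\<^sup>2) \<partial>M"

lemma mono_up_to:
  fixes s :: "nat \<Rightarrow> real"
  assumes "\<And>i. i < k \<Longrightarrow> s i \<le> s (Suc i)" "a \<le> b" "b \<le> k"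
  shows "s a \<le> s b"
  using assms(2,3)
proof (induction b)
  case (Suc b)
  then show ?case using assms(1)[of b] by (cases "a = Suc b") auto
qed simp

text \<open>
  The steps of a simple process are disjoint, so at most one summand is nonzero.
\<close>

lemma simple_process_norm_square:
  fixes v :: "nat \<Rightarrow> real ^ 'd" and s :: "nat \<Rightarrow> real"
  assumes mono: "\<And>i. i < k \<Longrightarrow> s i \<le> s (Suc i)"
  shows "(norm (\<Sum>i<k. indicat_real {s i<..s (Suc i)} r *\<^sub>R v i))\<^sup>2 =
    (\<Sum>i<k. indicat_real {s i<..s (Suc i)} r * (norm (v i))\<^sup>2)"
proof (cases "\<exists>i<k. r \<in> {s i<..s (Suc i)}")
  case True
  then obtain i where i: "i < k" "s i < r" "r \<le> s (Suc i)" by auto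
  have s_mono: "a \<le> b \<Longrightarrow> b \<le> k \<Longrightarrow> s a \<le> s b" for a b
    by (rule mono_up_to[of k s]) (use mono in auto)
  have other: "r \<notin> {s j<..s (Suc j)}" if "j < k" "j \<noteq> i" for j
  proof (cases "j < i")
    case True
    then show ?thesis using s_mono[of "Suc j" i] i by auto
  next
    case False
    then show ?thesis using s_mono[of "Suc i" j] i that by auto
  qed
  have "(\<Sum>j<k. indicat_real {s j<..s (Suc j)} r *\<^sub>R v j) = (\<Sum>j<k. if j = i then v i else 0)"
    using i other by (intro sum.cong) auto
  moreover have "(\<Sum>j<k. indicat_real {s j<..s (Suc j)} r * (norm (v j))\<^sup>2)
      = (\<Sum>j<k. if j = i then (norm (v i))\<^sup>2 else 0)"
    using i other by (intro sum.cong) auto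
  ultimately show ?thesis using i by simp
next
  case False
  then have "(\<Sum>j<k. indicat_real {s j<..s (Suc j)} r *\<^sub>R v j) = 0"
    "(\<Sum>j<k. indicat_real {s j<..s (Suc j)} r * (norm (v j))\<^sup>2) = 0"
    by (auto intro!: sum.neutral)
  then show ?thesis by simp
qed

lemma nn_integral_simple_process:
  fixes v :: "nat \<Rightarrow> real ^ 'd"
  assumes mono: "\<And>i. i < k \<Longrightarrow> s i \<le> s (Suc i)" and t: "t0 \<le> t"
  shows "(\<integral>\<^sup>+r\<in>{t0<..t}. ennreal ((norm (\<Sum>i<k. indicat_real {s i<..s (Suc i)} r *\<^sub>R v i))\<^sup>2) \<partial>lborel)
    = ennreal (\<Sum>i<k. (norm (v i))\<^sup>2 * (max t0 (min (s (Suc i)) t) - max t0 (min (s i) t)))"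
proof -
  let ?p = "\<lambda>u. max t0 (min u t)"
  have pm: "?p (s i) \<le> ?p (s (Suc i))" if "i < k" for i
    using mono[OF that] t by (auto simp: max_def min_def)
  have "(\<integral>\<^sup>+r\<in>{t0<..t}. ennreal ((norm (\<Sum>i<k. indicat_real {s i<..s (Suc i)} r *\<^sub>R v i))\<^sup>2) \<partial>lborel)
    = (\<integral>\<^sup>+r. (\<Sum>i<k. ennreal ((norm (v i))\<^sup>2) * indicator {?p (s i)<..?p (s (Suc i))} r) \<partial>lborel)"
  proof (rule nn_integral_cong)
    fix r
    have eq: "indicat_real {s i<..s (Suc i)} r * indicat_real {t0<..t} r
        = indicat_real {?p (s i)<..?p (s (Suc i))} r" if "i < k" for i
      using mono[OF that] t by (auto simp: indicator_def)
    have "ennreal ((norm (\<Sum>i<k. indicat_real {s i<..s (Suc i)} r *\<^sub>R v i))\<^sup>2) * indicator {t0<..t} r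
      = ennreal ((\<Sum>i<k. indicat_real {s i<..s (Suc i)} r * (norm (v i))\<^sup>2) * indicat_real {t0<..t} r)"
      by (subst simple_process_norm_square[of k s, OF mono]) (auto simp: indicator_def)
    also have "(\<Sum>i<k. indicat_real {s i<..s (Suc i)} r * (norm (v i))\<^sup>2) * indicat_real {t0<..t} r
      = (\<Sum>i<k. (norm (v i))\<^sup>2 * indicat_real {?p (s i)<..?p (s (Suc i))} r)"
      unfolding sum_distrib_right by (intro sum.cong refl) (simp add: eq[symmetric])
    also have "ennreal \<dots> = (\<Sum>i<k. ennreal ((norm (v i))\<^sup>2) * indicator {?p (s i)<..?p (s (Suc i))} r)"
      by (subst sum_ennreal[symmetric]) (auto simp: ennreal_mult ennreal_indicator intro!: sum.cong)
    finally show "ennreal ((norm (\<Sum>i<k. indicat_real {s i<..s (Suc i)} r *\<^sub>R v i))\<^sup>2) * indicator {t0<..t} r = \<dots>" .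
  qed
  also have "\<dots> = (\<Sum>i<k. ennreal ((norm (v i))\<^sup>2) * emeasure lborel {?p (s i)<..?p (s (Suc i))})"
    by (subst nn_integral_sum) (auto simp: nn_integral_cmult_indicator)
  also have "\<dots> = (\<Sum>i<k. ennreal ((norm (v i))\<^sup>2 * (?p (s (Suc i)) - ?p (s i))))"
    using pm by (intro sum.cong refl) (simp add: ennreal_mult)
  also have "\<dots> = ennreal (\<Sum>i<k. (norm (v i))\<^sup>2 * (?p (s (Suc i)) - ?p (s i)))"
    using pm by (intro sum_ennreal) simp
  finally show ?thesis .
qed

context brownian_space
begin

text \<open>
  The contribution of step \<open>i\<close> of a simple integral to its increment over \<open>[t0, t]\<close>. Clipping the
  endpoints of the step to \<open>[t0, t]\<close> makes every Brownian increment start after \<open>t0\<close>.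
\<close>

definition clipped_step :: "real \<Rightarrow> real \<Rightarrow> (nat \<Rightarrow> real) \<Rightarrow> (nat \<Rightarrow> 'w \<Rightarrow> real ^ 'd) \<Rightarrow> nat \<Rightarrow> 'w \<Rightarrow> real" where
  "clipped_step t0 t s \<eta> i w =
    \<eta> i w \<bullet> (B (max t0 (min (s (Suc i)) t)) w - B (max t0 (min (s i) t)) w)"

lemma simple_integral_increment:
  assumes "t0 \<le> t"
  shows "simple_integral B k s \<eta> t w - simple_integral B k s \<eta> t0 w = (\<Sum>i<k. clipped_step t0 t s \<eta> i w)"
proof -
  have *: "B (min u t) w - B (min u t0) w = B (max t0 (min u t)) w - B t0 w" for u
    using assms by (auto simp: max_def min_def)
  have "\<eta> i w \<bullet> (B (min (s (Suc i)) t) w - B (min (s i) t) w)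
      - \<eta> i w \<bullet> (B (min (s (Suc i)) t0) w - B (min (s i) t0) w) = clipped_step t0 t s \<eta> i w" for i
  proof -
    have "\<eta> i w \<bullet> (B (min (s (Suc i)) t) w - B (min (s i) t) w)
      - \<eta> i w \<bullet> (B (min (s (Suc i)) t0) w - B (min (s i) t0) w)
      = \<eta> i w \<bullet> ((B (min (s (Suc i)) t) w - B (min (s (Suc i)) t0) w)
        - (B (min (s i) t) w - B (min (s i) t0) w))"
      by (simp add: inner_diff_right)
    then show ?thesis unfolding * clipped_step_def by simp
  qed
  then show ?thesis
    unfolding simple_integral_def sum_subtractf[symmetric] by simp
qed

text \<open>
  Unless the clipped step is empty, it starts after both \<open>t0\<close> and \<open>s i\<close>, so that \<open>A\<close> and \<open>\<eta> i\<close> are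
  known when the Brownian increment begins.
\<close>

lemma clipped_step_facts:
  fixes A :: "'w set"
  assumes SI: "simple_integrand F k s \<eta>" and t: "0 \<le> t0" "t0 \<le> t" and i: "i < k" and A: "A \<in> sets (F t0)"
  defines "p \<equiv> \<lambda>u. max t0 (min u t)"
  defines "\<theta> \<equiv> \<lambda>w. indicator A w * clipped_step t0 t s \<eta> i w"
  shows "null_mean_on M (F (p (s i))) \<theta> \<and> \<theta> \<in> borel_measurable (F (p (s (Suc i)))) \<and>
    (\<lambda>w. indicator A w * (norm (\<eta> i w))\<^sup>2 * (p (s (Suc i)) - p (s i))) \<in> borel_measurable M \<and>
    mean_square \<theta> \<le>
      CARD('d) * (\<integral>\<^sup>+w. ennreal (indicator A w * (norm (\<eta> i w))\<^sup>2 * (p (s (Suc i)) - p (s i))) \<partial>M)"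
proof -
  have s_i: "s i \<le> s (Suc i)" and \<eta>0: "\<eta> i \<in> borel_measurable (F (s i))"
    and b0: "bounded (\<eta> i ` space M)"
    using SI i by (auto simp: simple_integrand_def)
  have p0: "0 \<le> p u" "t0 \<le> p u" for u using t by (auto simp: p_def)
  have pm: "p (s i) \<le> p (s (Suc i))" using s_i t by (auto simp: p_def max_def min_def)
  obtain c where c: "\<And>w. w \<in> space M \<Longrightarrow> norm (\<eta> i w) \<le> c" "0 \<le> c"
    using b0 unfolding bounded_pos by (metis imageI less_imp_le)
  have comp[measurable]: "(\<lambda>x::real ^ 'd. x $ j) \<in> borel_measurable borel" for j
    by (intro borel_measurable_continuous_onI continuous_intros)
  show ?thesis
  proof (cases "p (s i) = p (s (Suc i))")
    case True
    then have "\<theta> = (\<lambda>_. 0)" by (auto simp: \<theta>_def clipped_step_def p_def)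
    then show ?thesis using True by (simp add: null_mean_on_def)
  next
    case False
    then have "s i \<le> p (s i)" using s_i t by (auto simp: p_def max_def min_def split: if_splits)
    then have \<eta>: "\<eta> i \<in> borel_measurable (F (p (s i)))"
      using measurable_from_subalg[of "F (p (s i))" "F (s i)"] \<eta>0 sets_F_mono[of "s i" "p (s i)"]
      by (auto simp: subalgebra_def)
    have AG: "A \<in> sets (F (p (s i)))" using A sets_F_mono[of t0 "p (s i)"] p0 by auto
    let ?u = "p (s i)" and ?v = "p (s (Suc i))"
    have \<eta>j: "(\<lambda>w. indicator A w * \<eta> i w $ j) \<in> borel_measurable (F ?u)" for j
      using AG measurable_compose[OF \<eta> comp[of j]] by measurable
    have bj: "\<bar>indicator A w * \<eta> i w $ j\<bar> \<le> c" if "w \<in> space M" for w j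
      using c(1)[OF that] c(2) component_le_norm_cart[of "\<eta> i w" j] by (auto simp: indicator_def)
    have nj: "null_mean_on M (F ?u) (\<lambda>w. (indicator A w * \<eta> i w $ j) * (B ?v w $ j - B ?u w $ j))" for j
      by (rule null_mean_on_mult_bounded[OF subalgebra_F increment_null_mean[OF p0(1) pm] \<eta>j bj])
    have \<theta>_eq: "\<theta> w = (\<Sum>j\<in>UNIV. (indicator A w * \<eta> i w $ j) * (B ?v w $ j - B ?u w $ j))" for w
      by (simp add: \<theta>_def clipped_step_def inner_vec_def p_def sum_distrib_left mult.assoc)
    have 1: "null_mean_on M (F ?u) \<theta>"
      unfolding \<theta>_eq by (intro null_mean_on_sum subalgebra_F nj) simp
    have "\<theta> \<in> borel_measurable (F ?v)"
    proof -
      have "(\<lambda>w. indicator A w * \<eta> i w $ j) \<in> borel_measurable (F ?v)" for j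
        by (rule measurable_F_mono[OF \<eta>j]) (use pm in simp)
      moreover have "(\<lambda>w. B ?v w $ j - B ?u w $ j) \<in> borel_measurable (F ?v)" for j
        using measurable_compose[OF B_adapted comp[of j], of ?v ?v]
          measurable_compose[OF B_adapted comp[of j], of ?u ?v] p0 pm by simp
      ultimately show ?thesis unfolding \<theta>_eq
        by (intro borel_measurable_sum) (rule borel_measurable_times, blast+)
    qed
    let ?h = "\<lambda>w. indicator A w * (norm (\<eta> i w))\<^sup>2"
    have h: "?h \<in> borel_measurable (F ?u)" using AG \<eta> by measurable
    have hb: "\<bar>?h w\<bar> \<le> c\<^sup>2" if "w \<in> space M" for w
      using c(1)[OF that] c(2) by (auto simp: indicator_def intro!: power_mono)
    have hM[measurable]: "?h \<in> borel_measurable M" by (rule measurable_F_M[OF h])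
    have "mean_square \<theta> \<le> (\<integral>\<^sup>+w. ennreal (?h w * (norm (B ?v w - B ?u w))\<^sup>2) \<partial>M)"
    proof (intro nn_integral_mono ennreal_leI)
      fix w
      have "\<bar>\<eta> i w \<bullet> (B ?v w - B ?u w)\<bar> \<le> norm (\<eta> i w) * norm (B ?v w - B ?u w)"
        by (rule Cauchy_Schwarz_ineq2)
      then have "(\<eta> i w \<bullet> (B ?v w - B ?u w))\<^sup>2 \<le> (norm (\<eta> i w) * norm (B ?v w - B ?u w))\<^sup>2"
        by (metis abs_ge_zero power2_abs power_mono)
      then show "(\<theta> w)\<^sup>2 \<le> ?h w * (norm (B ?v w - B ?u w))\<^sup>2"
        by (simp add: \<theta>_def clipped_step_def p_def indicator_def power_mult_distrib)
    qed
    also have "\<dots> = ennreal (\<integral>w. ?h w * (norm (B ?v w - B ?u w))\<^sup>2 \<partial>M)"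
    proof (rule nn_integral_eq_integral)
      show "integrable M (\<lambda>w. ?h w * (norm (B ?v w - B ?u w))\<^sup>2)"
        by (rule increment_weighted_square(1)[OF p0(1) pm h hb])
      show "AE w in M. 0 \<le> ?h w * (norm (B ?v w - B ?u w))\<^sup>2"
        by (intro AE_I2 mult_nonneg_nonneg) auto
    qed
    also have "\<dots> = ennreal ((\<integral>w. ?h w \<partial>M) * (real CARD('d) * (?v - ?u)))"
      by (simp only: increment_weighted_square(2)[OF p0(1) pm h hb])
    also have "\<dots> = ennreal (real CARD('d) * (\<integral>w. ?h w * (?v - ?u) \<partial>M))"
      unfolding integral_mult_left_zero by (simp only: mult_ac)
    also have "\<dots> = ennreal (real CARD('d)) * ennreal (\<integral>w. ?h w * (?v - ?u) \<partial>M)"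
      using pm by (intro ennreal_mult integral_nonneg_AE) auto
    also have "ennreal (\<integral>w. ?h w * (?v - ?u) \<partial>M) = (\<integral>\<^sup>+w. ennreal (?h w * (?v - ?u)) \<partial>M)"
    proof (rule nn_integral_eq_integral[symmetric])
      show "integrable M (\<lambda>w. ?h w * (?v - ?u))"
        using hb by (intro integrable_mult_left integrable_const_bound[where B="c\<^sup>2"] hM) auto
    qed (use pm in auto)
    finally have "mean_square \<theta> \<le> ennreal (real CARD('d)) * (\<integral>\<^sup>+w. ennreal (?h w * (?v - ?u)) \<partial>M)" .
    then show ?thesis using 1 \<open>\<theta> \<in> borel_measurable (F ?v)\<close> by (simp add: ennreal_of_nat_eq_real_of_nat)
  qed
qed

lemma simple_integral_increment_facts:
  fixes A :: "'w set"
  assumes SI: "simple_integrand F k s \<eta>" and t: "0 \<le> t0" "t0 \<le> t" and A: "A \<in> sets (F t0)"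
  defines "D \<equiv> \<lambda>w. simple_integral B k s \<eta> t w - simple_integral B k s \<eta> t0 w"
  shows "(\<lambda>w. indicator A w * D w) \<in> borel_measurable M"
    and "integrable M (\<lambda>w. (indicator A w * D w)\<^sup>2)"
    and "(\<integral>w. indicator A w * D w \<partial>M) = 0"
    and "mean_square (\<lambda>w. indicator A w * D w) \<le>
      CARD('d) * (\<integral>\<^sup>+w. indicator A w * (\<integral>\<^sup>+r\<in>{t0<..t}. ennreal ((norm (simple_process k s \<eta> r w))\<^sup>2) \<partial>lborel) \<partial>M)"
proof -
  let ?p = "\<lambda>u. max t0 (min u t)"
  let ?\<theta> = "\<lambda>i w. indicator A w * clipped_step t0 t s \<eta> i w"
  note all = clipped_step_facts[OF SI t _ A]
  note facts = all[THEN conjunct1] all[THEN conjunct2, THEN conjunct1]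
    all[THEN conjunct2, THEN conjunct2, THEN conjunct1] all[THEN conjunct2, THEN conjunct2, THEN conjunct2]
  have mono: "\<And>i. i < k \<Longrightarrow> s i \<le> s (Suc i)" using SI by (simp add: simple_integrand_def)
  have s_mono: "a \<le> b \<Longrightarrow> b \<le> k \<Longrightarrow> s a \<le> s b" for a b
    by (rule mono_up_to[of k s]) (use mono in auto)
  have p_mono: "?p (s a) \<le> ?p (s b)" if "a \<le> b" "b \<le> k" for a b
    using s_mono[OF that] t by (auto simp: max_def min_def)
  have D_eq: "indicator A w * D w = (\<Sum>i<k. ?\<theta> i w)" for w
    unfolding D_def simple_integral_increment[OF t(2)] sum_distrib_left ..
  have adapted: "?\<theta> j \<in> borel_measurable (F (?p (s i)))" if "j < i" "i < k" for i j
  proof (rule measurable_F_mono[OF facts(2)[of j]])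
    show "ereal (?p (s (Suc j))) \<le> ereal (?p (s i))"
      using p_mono[of "Suc j" i] that by (simp only: ereal_less_eq(3))
  qed (use that in simp)
  have sq: "integrable M (\<lambda>w. (\<Sum>i<k. ?\<theta> i w)\<^sup>2) \<and>
      (\<integral>w. (\<Sum>i<k. ?\<theta> i w)\<^sup>2 \<partial>M) = (\<Sum>i<k. \<integral>w. (?\<theta> i w)\<^sup>2 \<partial>M)"
    by (rule square_of_null_mean_sum[where G="\<lambda>i. F (?p (s i))"]) (use facts(1) adapted subalgebra_F in auto)
  have \<theta>M: "?\<theta> i \<in> borel_measurable M" "integrable M (\<lambda>w. (?\<theta> i w)\<^sup>2)" if "i < k" for i
    using facts(1)[OF that] by (auto simp: null_mean_on_def)
  show DM: "(\<lambda>w. indicator A w * D w) \<in> borel_measurable M"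
    unfolding D_eq using \<theta>M by (intro borel_measurable_sum) auto
  show int: "integrable M (\<lambda>w. (indicator A w * D w)\<^sup>2)"
    unfolding D_eq using sq by simp
  have "(\<integral>w. ?\<theta> i w \<partial>M) = 0" if "i < k" for i
  proof -
    have "(\<integral>w. indicator (space M) w * ?\<theta> i w \<partial>M) = 0"
      using facts(1)[OF that] sets.top[of "F (?p (s i))"] unfolding null_mean_on_def space_F by blast
    moreover have "(\<integral>w. indicator (space M) w * ?\<theta> i w \<partial>M) = (\<integral>w. ?\<theta> i w \<partial>M)"
      by (intro Bochner_Integration.integral_cong) auto
    ultimately show ?thesis by simp
  qed
  moreover have "(\<integral>w. (\<Sum>i<k. ?\<theta> i w) \<partial>M) = (\<Sum>i<k. \<integral>w. ?\<theta> i w \<partial>M)"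
    by (rule Bochner_Integration.integral_sum) (rule integrable_of_square[OF \<theta>M], auto)
  ultimately show "(\<integral>w. indicator A w * D w \<partial>M) = 0"
    unfolding D_eq by simp
  have AM[measurable]: "A \<in> sets M" by (rule sets_F_M[OF A])
  let ?h = "\<lambda>i w. indicator A w * (norm (\<eta> i w))\<^sup>2 * (?p (s (Suc i)) - ?p (s i))"
  have "mean_square (\<lambda>w. indicator A w * D w) = ennreal (\<Sum>i<k. \<integral>w. (?\<theta> i w)\<^sup>2 \<partial>M)"
    using sq int unfolding D_eq by (subst nn_integral_eq_integral) auto
  also have "\<dots> = (\<Sum>i<k. ennreal (\<integral>w. (?\<theta> i w)\<^sup>2 \<partial>M))"
    by (rule sum_ennreal[symmetric]) simp
  also have "\<dots> = (\<Sum>i<k. mean_square (\<lambda>w. ?\<theta> i w))"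
    using \<theta>M by (intro sum.cong refl nn_integral_eq_integral[symmetric]) auto
  also have "\<dots> \<le> (\<Sum>i<k. CARD('d) * (\<integral>\<^sup>+w. ennreal (?h i w) \<partial>M))"
    by (intro sum_mono facts(4)) simp
  also have "\<dots> = CARD('d) * (\<integral>\<^sup>+w. (\<Sum>i<k. ennreal (?h i w)) \<partial>M)"
    using facts(3) by (subst nn_integral_sum) (auto simp: sum_distrib_left)
  also have "(\<integral>\<^sup>+w. (\<Sum>i<k. ennreal (?h i w)) \<partial>M)
    = (\<integral>\<^sup>+w. indicator A w * (\<integral>\<^sup>+r\<in>{t0<..t}. ennreal ((norm (simple_process k s \<eta> r w))\<^sup>2) \<partial>lborel) \<partial>M)"
  proof (rule nn_integral_cong)
    fix w
    have h0: "0 \<le> ?h i w" if "i < k" for i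
      using p_mono[of i "Suc i"] that by simp
    have "(\<Sum>i<k. ennreal (?h i w)) = ennreal (\<Sum>i<k. ?h i w)"
      using h0 by (intro sum_ennreal) auto
    also have "(\<Sum>i<k. ?h i w) = indicator A w * (\<Sum>i<k. (norm (\<eta> i w))\<^sup>2 * (?p (s (Suc i)) - ?p (s i)))"
      by (simp add: sum_distrib_left mult.assoc)
    also have "ennreal \<dots> = indicator A w * ennreal (\<Sum>i<k. (norm (\<eta> i w))\<^sup>2 * (?p (s (Suc i)) - ?p (s i)))"
      by (auto simp: indicator_def)
    also have "\<dots> = indicator A w * (\<integral>\<^sup>+r\<in>{t0<..t}. ennreal ((norm (simple_process k s \<eta> r w))\<^sup>2) \<partial>lborel)"
      unfolding simple_process_def
      by (subst nn_integral_simple_process[of k s, OF mono t(2)]) simp_all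
    finally show "(\<Sum>i<k. ennreal (?h i w)) = \<dots>" .
  qed
  finally show "mean_square (\<lambda>w. indicator A w * D w) \<le>
      CARD('d) * (\<integral>\<^sup>+w. indicator A w * (\<integral>\<^sup>+r\<in>{t0<..t}. ennreal ((norm (simple_process k s \<eta> r w))\<^sup>2) \<partial>lborel) \<partial>M)" .
qed

lemma simple_integral_zero:
  assumes SI: "simple_integrand F k s \<eta>"
  shows "simple_integral B k s \<eta> 0 w = 0"
proof -
  have mono: "\<And>i. i < k \<Longrightarrow> s i \<le> s (Suc i)" and s0: "0 \<le> s 0" using SI by (auto simp: simple_integrand_def)
  have "0 \<le> s b" if "b \<le> k" for b
    using mono_up_to[of k s 0 b] mono s0 that by force
  then have "min (s b) 0 = 0" if "b \<le> k" for b using that by (simp add: min_absorb2)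
  then show ?thesis unfolding simple_integral_def by (intro sum.neutral) auto
qed

end

section \<open>Stochastic integrals as continuous martingales\<close>

lemma integrable_square_iff_nn_integral:
  fixes f :: "'a \<Rightarrow> real"
  assumes "f \<in> borel_measurable M"
  shows "integrable M (\<lambda>w. (f w)\<^sup>2) \<longleftrightarrow> (\<integral>\<^sup>+w. ennreal ((f w)\<^sup>2) \<partial>M) < \<infinity>"
  using assms by (auto simp: integrable_iff_bounded)

lemma (in prob_space) mean_square_sum3:
  fixes x y z :: "'a \<Rightarrow> real"
  assumes [measurable]: "x \<in> borel_measurable M" "y \<in> borel_measurable M" "z \<in> borel_measurable M"
  shows "mean_square (\<lambda>w. x w + y w + z w) \<le>
    3 * (mean_square x + mean_square y + mean_square z)"
proof -
  have "(a + b + c)\<^sup>2 \<le> 3 * (a\<^sup>2 + b\<^sup>2 + c\<^sup>2)" for a b c :: real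
  proof -
    have "3 * (a\<^sup>2 + b\<^sup>2 + c\<^sup>2) - (a + b + c)\<^sup>2 = (a - b)\<^sup>2 + (b - c)\<^sup>2 + (a - c)\<^sup>2"
      by (simp add: power2_eq_square algebra_simps)
    then show ?thesis using zero_le_power2[of "a - b"] zero_le_power2[of "b - c"] zero_le_power2[of "a - c"]
      by linarith
  qed
  then have "mean_square (\<lambda>w. x w + y w + z w) \<le>
    (\<integral>\<^sup>+w. ennreal (3 * ((x w)\<^sup>2 + (y w)\<^sup>2 + (z w)\<^sup>2)) \<partial>M)"
    by (intro nn_integral_mono ennreal_leI)
  also have "\<dots> = (\<integral>\<^sup>+w. 3 * (ennreal ((x w)\<^sup>2) + ennreal ((y w)\<^sup>2) + ennreal ((z w)\<^sup>2)) \<partial>M)"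
    by (intro nn_integral_cong, subst ennreal_mult) (simp_all add: ennreal_plus)
  also have "\<dots> = 3 * (mean_square x + mean_square y + mean_square z)"
    by (simp add: nn_integral_cmult nn_integral_add)
  finally show ?thesis .
qed

context brownian_space
begin

text \<open>
  The only properties of a stochastic integral that the comparison and the upcrossing estimate use.
\<close>

definition L2_martingale :: "(real \<Rightarrow> 'w \<Rightarrow> real) \<Rightarrow> bool" where
  "L2_martingale I \<longleftrightarrow>
     (\<forall>t\<ge>0. I t \<in> borel_measurable (F t)) \<and>
     (\<forall>t\<ge>0. integrable M (\<lambda>w. (I t w)\<^sup>2)) \<and>
     (\<forall>s t. 0 \<le> s \<and> s \<le> t \<longrightarrow> null_mean_on M (F s) (\<lambda>w. I t w - I s w)) \<and>
     (AE w in M. continuous_on {0..} (\<lambda>t. I t w))"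

lemma L2_martingale_diff:
  assumes "L2_martingale I" "L2_martingale J"
  shows "L2_martingale (\<lambda>t w. I t w - J t w)"
proof -
  have I: "I t \<in> borel_measurable (F t)" "integrable M (\<lambda>w. (I t w)\<^sup>2)"
    and J: "J t \<in> borel_measurable (F t)" "integrable M (\<lambda>w. (J t w)\<^sup>2)" if "0 \<le> t" for t
    using assms that unfolding L2_martingale_def by blast+
  have "null_mean_on M (F s) (\<lambda>w. (I t w - J t w) - (I s w - J s w))" if st: "0 \<le> s" "s \<le> t" for s t
  proof -
    have nI: "null_mean_on M (F s) (\<lambda>w. I t w - I s w)"
      and nJ: "null_mean_on M (F s) (\<lambda>w. J t w - J s w)"
      using assms st unfolding L2_martingale_def by blast+
    have "null_mean_on M (F s) (\<lambda>w. (-1) * (J t w - J s w))"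
      by (rule null_mean_on_mult_bounded[OF subalgebra_F nJ, where c=1]) auto
    from null_mean_on_add[OF subalgebra_F nI this] show ?thesis by (simp add: algebra_simps)
  qed
  moreover have "AE w in M. continuous_on {0..} (\<lambda>t. I t w - J t w)"
    using assms unfolding L2_martingale_def by (auto elim!: eventually_elim2 intro: continuous_on_diff)
  moreover have "integrable M (\<lambda>w. (I t w - J t w)\<^sup>2)" if "0 \<le> t" for t
    using I[OF that] J[OF that] measurable_F_M by (intro integrable_square_diff) auto
  ultimately show ?thesis
    unfolding L2_martingale_def using I J by simp
qed

lemma simple_integral_measurable:
  assumes SI: "simple_integrand F k s \<eta>" and t: "0 \<le> t"
  shows "simple_integral B k s \<eta> t \<in> borel_measurable M"
    and "integrable M (\<lambda>w. (simple_integral B k s \<eta> t w)\<^sup>2)"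
proof -
  have "(\<lambda>w. indicator (space M) w * simple_integral B k s \<eta> t w) \<in> borel_measurable M"
    "integrable M (\<lambda>w. (indicator (space M) w * simple_integral B k s \<eta> t w)\<^sup>2)"
    using simple_integral_increment_facts(1,2)[OF SI order_refl t, of "space M"]
      sets.top[of "F 0"] by (simp_all add: simple_integral_zero[OF SI] zero_ereal_def)
  moreover have "(\<lambda>w. indicator (space M) w * simple_integral B k s \<eta> t w) \<in> borel_measurable M
    \<longleftrightarrow> simple_integral B k s \<eta> t \<in> borel_measurable M"
    by (intro measurable_cong) simp
  moreover have "integrable M (\<lambda>w. (indicator (space M) w * simple_integral B k s \<eta> t w)\<^sup>2)
    \<longleftrightarrow> integrable M (\<lambda>w. (simple_integral B k s \<eta> t w)\<^sup>2)"
    by (intro Bochner_Integration.integrable_cong) simp_all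
  ultimately show "simple_integral B k s \<eta> t \<in> borel_measurable M"
    "integrable M (\<lambda>w. (simple_integral B k s \<eta> t w)\<^sup>2)" by blast+
qed

definition ito_approx ::
    "(real \<Rightarrow> 'w \<Rightarrow> real ^ 'd) \<Rightarrow> (real \<Rightarrow> 'w \<Rightarrow> real) \<Rightarrow> real \<Rightarrow>
      (nat \<Rightarrow> nat) \<Rightarrow> (nat \<Rightarrow> nat \<Rightarrow> real) \<Rightarrow> (nat \<Rightarrow> nat \<Rightarrow> 'w \<Rightarrow> real ^ 'd) \<Rightarrow> bool" where
  "ito_approx H I T k s \<eta> \<longleftrightarrow> (\<forall>n. simple_integrand F (k n) (s n) (\<eta> n)) \<and>
    (\<lambda>n. \<integral>\<^sup>+w. (\<integral>\<^sup>+t\<in>{0..T}.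
      ennreal ((norm (simple_process (k n) (s n) (\<eta> n) t w - H t w))\<^sup>2) \<partial>lborel) \<partial>M) \<longlonglongrightarrow> 0 \<and>
    (\<forall>t\<in>{0..T}. (\<lambda>n. mean_square (\<lambda>w. simple_integral B (k n) (s n) (\<eta> n) t w - I t w)) \<longlonglongrightarrow> 0)"

lemma ito_integral_approx:
  assumes "ito_integral M B H I" "0 \<le> T"
  shows "\<exists>k s \<eta>. ito_approx H I T k s \<eta>"
  using assms(2) unfolding ito_approx_def
  by (rule assms(1)[unfolded ito_integral_def, THEN conjunct2, THEN conjunct2, THEN conjunct2,
      THEN conjunct2, THEN spec, THEN mp])

lemma ito_approxD:
  assumes "ito_approx H I T k s \<eta>"
  shows "simple_integrand F (k n) (s n) (\<eta> n)"
    "(\<lambda>n. \<integral>\<^sup>+w. (\<integral>\<^sup>+t\<in>{0..T}.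
      ennreal ((norm (simple_process (k n) (s n) (\<eta> n) t w - H t w))\<^sup>2) \<partial>lborel) \<partial>M) \<longlonglongrightarrow> 0"
    "0 \<le> r \<Longrightarrow> r \<le> T \<Longrightarrow>
      (\<lambda>n. mean_square (\<lambda>w. simple_integral B (k n) (s n) (\<eta> n) r w - I r w)) \<longlonglongrightarrow> 0"
  using assms unfolding ito_approx_def by simp_all

lemma ito_integral_measurable:
  assumes "ito_integral M B H I" "0 \<le> t"
  shows "I t \<in> borel_measurable (F t)" "I t \<in> borel_measurable M"
  using assms measurable_F_M unfolding ito_integral_def by blast+

lemma ito_integral_square_integrable:
  assumes ito: "ito_integral M B H I" and t: "0 \<le> t"
  shows "integrable M (\<lambda>w. (I t w)\<^sup>2)"
proof -
  obtain k s \<eta> where approx: "ito_approx H I t k s \<eta>"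
    using ito_integral_approx[OF ito t] by blast
  note SI = ito_approxD(1)[OF approx] and limH = ito_approxD(2)[OF approx] and lim = ito_approxD(3)[OF approx]
  note lim = lim[OF t order_refl]
  note Im = ito_integral_measurable(2)[OF ito t]
  have "eventually (\<lambda>n. mean_square (\<lambda>w. simple_integral B (k n) (s n) (\<eta> n) t w - I t w) < 1) sequentially"
    using order_tendstoD(2)[OF lim, of 1] by simp
  then obtain n where "mean_square (\<lambda>w. simple_integral B (k n) (s n) (\<eta> n) t w - I t w) < 1"
    by (auto simp: eventually_sequentially)
  then have fin: "mean_square (\<lambda>w. simple_integral B (k n) (s n) (\<eta> n) t w - I t w) < \<infinity>"
    by (rule order_less_trans) simp
  note S = simple_integral_measurable[OF SI[of n] t]
  have "integrable M (\<lambda>w. (simple_integral B (k n) (s n) (\<eta> n) t w - I t w)\<^sup>2)"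
    by (subst integrable_square_iff_nn_integral) (use S Im fin in auto)
  from integrable_square_diff[OF S(1) _ S(2) this] S Im show ?thesis by simp
qed

text \<open>
  The mean over \<open>A\<close> of the increment vanishes for simple integrands, and the squared mean is at most
  the squared \<open>L\<^sup>2\<close> norm.
\<close>

lemma ito_integral_increment_mean:
  assumes ito: "ito_integral M B H I" and t: "0 \<le> t0" "t0 \<le> t"
  shows "null_mean_on M (F t0) (\<lambda>w. I t w - I t0 w)"
proof -
  have t': "0 \<le> t" using t by simp
  obtain k s \<eta> where approx: "ito_approx H I t k s \<eta>"
    using ito_integral_approx[OF ito t'] by blast
  note SI = ito_approxD(1)[OF approx] and limH = ito_approxD(2)[OF approx] and lim = ito_approxD(3)[OF approx]
  let ?S = "\<lambda>n. simple_integral B (k n) (s n) (\<eta> n)"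
  have Im: "I t \<in> borel_measurable M" "I t0 \<in> borel_measurable M"
    using ito_integral_measurable(2)[OF ito] t t' by blast+
  have Isq: "integrable M (\<lambda>w. (I t w)\<^sup>2)" "integrable M (\<lambda>w. (I t0 w)\<^sup>2)"
    using ito_integral_square_integrable[OF ito] t t' by blast+
  have "(\<integral>w. indicator A w * (I t w - I t0 w) \<partial>M) = 0" if A: "A \<in> sets (F t0)" for A
  proof -
    let ?c = "\<integral>w. indicator A w * (I t w - I t0 w) \<partial>M"
    have AM[measurable]: "A \<in> sets M" by (rule sets_F_M[OF A])
    have bound: "ennreal (?c\<^sup>2) \<le> 3 * (mean_square (\<lambda>w. ?S n t w - I t w)
        + mean_square (\<lambda>w. ?S n t0 w - I t0 w) + (\<integral>\<^sup>+w. ennreal (0\<^sup>2) \<partial>M))" for n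
    proof -
      note St = simple_integral_measurable[OF SI[of n] t'] and S0 = simple_integral_measurable[OF SI[of n] t(1)]
      note [measurable] = St(1) S0(1) Im
      let ?X = "\<lambda>w. (I t w - I t0 w) - (?S n t w - ?S n t0 w)"
      have int_I: "integrable M (\<lambda>w. (I t w - I t0 w)\<^sup>2)"
        by (rule integrable_square_diff[OF Im Isq])
      have int_S: "integrable M (\<lambda>w. (?S n t w - ?S n t0 w)\<^sup>2)"
        by (rule integrable_square_diff[OF St(1) S0(1) St(2) S0(2)])
      have intX: "integrable M (\<lambda>w. (?X w)\<^sup>2)"
        by (rule integrable_square_diff[OF _ _ int_I int_S]) measurable
      have ind: "integrable M (\<lambda>w. indicator A w * f w)"
        if "f \<in> borel_measurable M" "integrable M (\<lambda>w. (f w)\<^sup>2)" for f :: "'w \<Rightarrow> real"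
        using integrable_mult_indicator[OF AM integrable_of_square[OF that]] by simp
      have "(\<integral>w. indicator A w * ?X w \<partial>M) = ?c - (\<integral>w. indicator A w * (?S n t w - ?S n t0 w) \<partial>M)"
        unfolding right_diff_distrib[of _ "I t _ - I t0 _"]
        by (rule Bochner_Integration.integral_diff[OF ind[OF _ int_I] ind[OF _ int_S]]) measurable
      then have c: "?c = (\<integral>w. indicator A w * ?X w \<partial>M)"
        using simple_integral_increment_facts(3)[OF SI t A] by simp
      have "integrable M (\<lambda>w. (indicator A w * ?X w)\<^sup>2)"
        by (rule integrable_square_bounded_mult[OF _ _ intX, where c=1]) (auto simp: indicator_def)
      then have "?c\<^sup>2 \<le> (\<integral>w. (indicator A w * ?X w)\<^sup>2 \<partial>M)"
        unfolding c by (intro square_integral_le) measurable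
      also have "\<dots> \<le> (\<integral>w. (?X w)\<^sup>2 \<partial>M)"
        by (rule integral_mono[OF \<open>integrable M (\<lambda>w. (indicator A w * ?X w)\<^sup>2)\<close> intX]) (auto simp: indicator_def)
      finally have "ennreal (?c\<^sup>2) \<le> ennreal (\<integral>w. (?X w)\<^sup>2 \<partial>M)" by (rule ennreal_leI)
      also have "\<dots> = mean_square ?X"
        by (rule nn_integral_eq_integral[OF intX, symmetric]) simp
      also have "\<dots> = mean_square (\<lambda>w. - (?S n t w - I t w) + (?S n t0 w - I t0 w) + 0)"
        by (intro nn_integral_cong) (simp add: algebra_simps)
      also have "\<dots> \<le> 3 * (mean_square (\<lambda>w. - (?S n t w - I t w))
        + mean_square (\<lambda>w. ?S n t0 w - I t0 w) + (\<integral>\<^sup>+w. ennreal (0\<^sup>2) \<partial>M))"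
        by (rule mean_square_sum3) measurable
      finally show ?thesis unfolding power2_minus .
    qed
    have "(\<lambda>n. 3 * (mean_square (\<lambda>w. ?S n t w - I t w)
        + mean_square (\<lambda>w. ?S n t0 w - I t0 w) + (\<integral>\<^sup>+w. ennreal (0\<^sup>2) \<partial>M))) \<longlonglongrightarrow> 3 * (0 + 0 + 0)"
      using lim[OF t' order_refl] lim[OF t]
      by (intro ennreal_tendsto_cmult tendsto_add) auto
    then have "ennreal (?c\<^sup>2) \<le> 3 * (0 + 0 + 0)"
      by (rule tendsto_lowerbound) (use bound in auto)
    then show ?thesis by (simp add: ennreal_eq_0_iff flip: zero_less_power2)
  qed
  then show ?thesis
    unfolding null_mean_on_def using Im integrable_square_diff[OF Im Isq] by simp
qed

lemma ito_integral_L2_martingale: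
  assumes "ito_integral M B H I"
  shows "L2_martingale I"
proof -
  have "AE w in M. continuous_on {0..} (\<lambda>t. I t w)"
    using assms by (simp add: ito_integral_def)
  then show ?thesis
    unfolding L2_martingale_def
    using ito_integral_measurable(1)[OF assms] ito_integral_square_integrable[OF assms]
      ito_integral_increment_mean[OF assms] by blast
qed

lemma ito_integral_zero:
  assumes ito: "ito_integral M B H I"
  shows "AE w in M. I 0 w = 0"
proof -
  obtain k s \<eta> where approx: "ito_approx H I 0 k s \<eta>"
    using ito_integral_approx[OF ito order_refl] by blast
  note SI = ito_approxD(1)[OF approx] and limH = ito_approxD(2)[OF approx] and lim = ito_approxD(3)[OF approx]
  note lim = lim[OF order_refl order_refl]
  from lim have "mean_square (\<lambda>w. I 0 w) = 0"
    by (simp add: simple_integral_zero[OF SI] tendsto_const_iff)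
  then show ?thesis
    using ito_integral_measurable(2)[OF ito order_refl]
    by (simp add: nn_integral_0_iff_AE ennreal_eq_0_iff)
qed

text \<open>
  The increment of the approximating simple integral over \<open>A\<close> is bounded by the simple integrand on
  \<open>A \<times> (t0, t]\<close>, which there coincides with its difference to \<open>H\<close> and so tends to zero. Taking for \<open>A\<close> the
  event that a random time has passed shows that the integral stops when the integrand does.
\<close>

lemma ito_integral_local:
  assumes ito: "ito_integral M B H I" and t: "0 \<le> t0" "t0 \<le> t" and A: "A \<in> sets (F t0)"
    and H: "AE w in M. w \<in> A \<longrightarrow> (\<forall>r. t0 < r \<and> r \<le> t \<longrightarrow> H r w = 0)"
  shows "AE w in M. w \<in> A \<longrightarrow> I t w = I t0 w"
proof -
  have t': "0 \<le> t" using t by simp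
  obtain k s \<eta> where approx: "ito_approx H I t k s \<eta>"
    using ito_integral_approx[OF ito t'] by blast
  note SI = ito_approxD(1)[OF approx] and limH = ito_approxD(2)[OF approx] and lim = ito_approxD(3)[OF approx]
  let ?S = "\<lambda>n. simple_integral B (k n) (s n) (\<eta> n)"
  let ?P = "\<lambda>n. simple_process (k n) (s n) (\<eta> n)"
  have Im[measurable]: "I t \<in> borel_measurable M" "I t0 \<in> borel_measurable M"
    using ito_integral_measurable(2)[OF ito] t t' by blast+
  have AM[measurable]: "A \<in> sets M" by (rule sets_F_M[OF A])
  let ?E = "\<lambda>n. \<integral>\<^sup>+w. (\<integral>\<^sup>+r\<in>{0..t}. ennreal ((norm (?P n r w - H r w))\<^sup>2) \<partial>lborel) \<partial>M"
  let ?c = "mean_square (\<lambda>w. indicator A w * (I t w - I t0 w))"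
  have bound: "?c \<le> 3 * (mean_square (\<lambda>w. ?S n t w - I t w)
        + mean_square (\<lambda>w. ?S n t0 w - I t0 w) + CARD('d) * ?E n)" for n
  proof -
    note St = simple_integral_measurable[OF SI[of n] t'] and S0 = simple_integral_measurable[OF SI[of n] t(1)]
    note [measurable] = St(1) S0(1)
    let ?D = "\<lambda>w. ?S n t w - ?S n t0 w"
    have D: "mean_square (\<lambda>w. indicator A w * ?D w) \<le> CARD('d) * ?E n"
    proof -
      have "mean_square (\<lambda>w. indicator A w * ?D w) \<le>
        CARD('d) * (\<integral>\<^sup>+w. indicator A w * (\<integral>\<^sup>+r\<in>{t0<..t}. ennreal ((norm (?P n r w))\<^sup>2) \<partial>lborel) \<partial>M)"
        by (rule simple_integral_increment_facts(4)[OF SI t A])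
      also have "(\<integral>\<^sup>+w. indicator A w * (\<integral>\<^sup>+r\<in>{t0<..t}. ennreal ((norm (?P n r w))\<^sup>2) \<partial>lborel) \<partial>M) \<le> ?E n"
      proof (rule nn_integral_mono_AE)
        from H show "AE w in M. indicator A w * (\<integral>\<^sup>+r\<in>{t0<..t}. ennreal ((norm (?P n r w))\<^sup>2) \<partial>lborel)
          \<le> (\<integral>\<^sup>+r\<in>{0..t}. ennreal ((norm (?P n r w - H r w))\<^sup>2) \<partial>lborel)"
        proof eventually_elim
          case (elim w)
          show ?case
          proof (cases "w \<in> A")
            case True
            have "(\<integral>\<^sup>+r\<in>{t0<..t}. ennreal ((norm (?P n r w))\<^sup>2) \<partial>lborel)
              \<le> (\<integral>\<^sup>+r\<in>{0..t}. ennreal ((norm (?P n r w - H r w))\<^sup>2) \<partial>lborel)"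
              using elim True t by (intro nn_integral_mono) (auto simp: indicator_def)
            then show ?thesis using True by simp
          qed simp
        qed
      qed
      finally show ?thesis by (simp add: mult_left_mono)
    qed
    have "?c = mean_square (\<lambda>w. indicator A w * - (?S n t w - I t w) + indicator A w * (?S n t0 w - I t0 w)
        + indicator A w * ?D w)"
      by (intro nn_integral_cong) (simp add: algebra_simps)
    also have "\<dots> \<le> 3 * (mean_square (\<lambda>w. indicator A w * - (?S n t w - I t w))
        + mean_square (\<lambda>w. indicator A w * (?S n t0 w - I t0 w))
        + mean_square (\<lambda>w. indicator A w * ?D w))"
      by (rule mean_square_sum3) measurable
    also have "\<dots> \<le> 3 * (mean_square (\<lambda>w. ?S n t w - I t w)
        + mean_square (\<lambda>w. ?S n t0 w - I t0 w) + CARD('d) * ?E n)"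
    proof (intro mult_left_mono add_mono D nn_integral_mono ennreal_leI)
      show "(indicator A w * - (?S n t w - I t w))\<^sup>2 \<le> (?S n t w - I t w)\<^sup>2" for w
        by (auto simp: indicator_def power2_commute)
      show "(indicator A w * (?S n t0 w - I t0 w))\<^sup>2 \<le> (?S n t0 w - I t0 w)\<^sup>2" for w
        by (auto simp: indicator_def)
    qed simp
    finally show ?thesis .
  qed
  have "(\<lambda>n. 3 * (mean_square (\<lambda>w. ?S n t w - I t w)
      + mean_square (\<lambda>w. ?S n t0 w - I t0 w) + CARD('d) * ?E n)) \<longlonglongrightarrow> 3 * (0 + 0 + of_nat CARD('d) * 0)"
    using lim[OF t' order_refl] lim[OF t] limH
    by (intro ennreal_tendsto_cmult tendsto_add) (auto simp: of_nat_less_top)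
  then have "?c \<le> 3 * (0 + 0 + of_nat CARD('d) * 0)"
    by (rule tendsto_lowerbound) (use bound in auto)
  then have "AE w in M. ennreal ((indicator A w * (I t w - I t0 w))\<^sup>2) = 0"
    by (subst (asm) mult_zero_right) (simp add: nn_integral_0_iff_AE)
  then show ?thesis by eventually_elim (auto simp: indicator_def ennreal_eq_0_iff)
qed

end

section \<open>A comparison principle\<close>

text \<open>
  A bound in \<open>L\<^sup>2\<close> gives uniform integrability. Here Fatou's lemma is applied to the nonnegative
  functions \<open>e x\<^sup>2 + 1 / (4 e) - x\<close>, and \<open>e\<close> tends to zero.
\<close>

lemma (in prob_space) integral_nonneg_of_L2_bounded_limit:
  fixes X :: "nat \<Rightarrow> 'a \<Rightarrow> real"
  assumes X[measurable]: "\<And>n. X n \<in> borel_measurable M" and L[measurable]: "L \<in> borel_measurable M"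
    and sq: "\<And>n. integrable M (\<lambda>w. (X n w)\<^sup>2)" "\<And>n. (\<integral>w. (X n w)\<^sup>2 \<partial>M) \<le> C"
    and mean: "\<And>n. (\<integral>w. X n w \<partial>M) = 0"
    and lim: "AE w in M. (\<lambda>n. X n w) \<longlonglongrightarrow> L w"
  shows "integrable M (\<lambda>w. (L w)\<^sup>2)" and "0 \<le> (\<integral>w. L w \<partial>M)"
proof -
  have C0: "0 \<le> C" using sq(2)[of 0] by (rule order_trans[rotated]) (intro integral_nonneg_AE, simp)
  have fatou: "(\<integral>\<^sup>+w. ennreal (f (L w)) \<partial>M) \<le> ennreal c"
    if f: "continuous_on UNIV f" and c: "\<And>n. (\<integral>\<^sup>+w. ennreal (f (X n w)) \<partial>M) \<le> ennreal c" for f c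
  proof -
    have [measurable]: "f \<in> borel_measurable borel"
      using f by (rule borel_measurable_continuous_onI)
    have "(\<integral>\<^sup>+w. ennreal (f (L w)) \<partial>M) \<le> (\<integral>\<^sup>+w. liminf (\<lambda>n. ennreal (f (X n w))) \<partial>M)"
    proof (rule nn_integral_mono_AE)
      from lim show "AE w in M. ennreal (f (L w)) \<le> liminf (\<lambda>n. ennreal (f (X n w)))"
      proof eventually_elim
        case (elim w)
        then have "(\<lambda>n. f (X n w)) \<longlonglongrightarrow> f (L w)"
          using f by (intro continuous_on_tendsto_compose[OF f]) auto
        then have "(\<lambda>n. ennreal (f (X n w))) \<longlonglongrightarrow> ennreal (f (L w))" by (rule tendsto_ennrealI)
        from lim_imp_Liminf[OF _ this] show ?case by simp
      qed
    qed
    also have "\<dots> \<le> liminf (\<lambda>n. \<integral>\<^sup>+w. ennreal (f (X n w)) \<partial>M)"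
      by (rule nn_integral_liminf) measurable
    also have "\<dots> \<le> ennreal c"
      using c by (intro Liminf_le) auto
    finally show ?thesis .
  qed
  have "(\<integral>\<^sup>+w. ennreal ((X n w)\<^sup>2) \<partial>M) \<le> ennreal C" for n
    using sq(2)[of n] by (subst nn_integral_eq_integral[OF sq(1)]) (auto intro: ennreal_leI)
  then have "(\<integral>\<^sup>+w. ennreal ((L w)\<^sup>2) \<partial>M) \<le> ennreal C"
    by (intro fatou[of "\<lambda>x. x\<^sup>2"]) (auto intro!: continuous_intros)
  then show L2: "integrable M (\<lambda>w. (L w)\<^sup>2)"
    by (subst integrable_square_iff_nn_integral) (auto intro: order_le_less_trans)
  note intL = integrable_of_square[OF L L2]
  have key: "- e * C \<le> (\<integral>w. L w \<partial>M)" if e: "0 < e" for e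
  proof -
    \<comment> \<open>A parabola touching the axis: nonnegative, and of slope \<open>-1\<close> at the origin.\<close>
    let ?f = "\<lambda>x. e * x\<^sup>2 + 1 / (4 * e) - x"
    have f0: "0 \<le> ?f x" for x
    proof -
      have "?f x = e * (x - 1 / (2 * e))\<^sup>2"
        using e by (simp add: power2_eq_square field_simps)
      then show ?thesis using e by simp
    qed
    have val: "(\<integral>\<^sup>+w. ennreal (?f (Z w)) \<partial>M) = ennreal (e * (\<integral>w. (Z w)\<^sup>2 \<partial>M) + 1 / (4 * e) - (\<integral>w. Z w \<partial>M))"
      if Z: "Z \<in> borel_measurable M" "integrable M (\<lambda>w. (Z w)\<^sup>2)" for Z
    proof -
      note intZ = integrable_of_square[OF Z]
      have int: "integrable M (\<lambda>w. ?f (Z w))"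
        by (intro Bochner_Integration.integrable_diff Bochner_Integration.integrable_add integrable_mult_right Z intZ integrable_const)
      have "(\<integral>\<^sup>+w. ennreal (?f (Z w)) \<partial>M) = ennreal (\<integral>w. ?f (Z w) \<partial>M)"
        using f0 by (intro nn_integral_eq_integral int) auto
      also have "(\<integral>w. ?f (Z w) \<partial>M) = e * (\<integral>w. (Z w)\<^sup>2 \<partial>M) + 1 / (4 * e) - (\<integral>w. Z w \<partial>M)"
        using Z intZ by (simp add: prob_space)
      finally show ?thesis .
    qed
    have "(\<integral>\<^sup>+w. ennreal (?f (X n w)) \<partial>M) \<le> ennreal (e * C + 1 / (4 * e))" for n
      unfolding val[OF X sq(1)] using mean sq(2)[of n] e by (intro ennreal_leI) simp
    then have "(\<integral>\<^sup>+w. ennreal (?f (L w)) \<partial>M) \<le> ennreal (e * C + 1 / (4 * e))"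
      by (intro fatou) (auto intro!: continuous_intros)
    then have "e * (\<integral>w. (L w)\<^sup>2 \<partial>M) + 1 / (4 * e) - (\<integral>w. L w \<partial>M) \<le> e * C + 1 / (4 * e)"
      unfolding val[OF L L2] using e C0 by (subst (asm) ennreal_le_iff) auto
    moreover have "0 \<le> e * (\<integral>w. (L w)\<^sup>2 \<partial>M)"
      using e by (intro mult_nonneg_nonneg integral_nonneg_AE) auto
    ultimately show ?thesis by simp
  qed
  show "0 \<le> (\<integral>w. L w \<partial>M)"
  proof (rule field_le_epsilon)
    fix e :: real assume e: "0 < e"
    have "- (e / (C + 1)) * C \<le> (\<integral>w. L w \<partial>M)" using e C0 by (intro key) simp
    moreover have "(e / (C + 1)) * C \<le> e" using e C0 by (simp add: field_simps)
    ultimately show "0 \<le> (\<integral>w. L w \<partial>M) + e" by simp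
  qed
qed

text \<open>
  This turns the event that a continuous path is nonnegative on an interval into a countable
  intersection.
\<close>

lemma nonneg_on_rationals:
  fixes u :: "real \<Rightarrow> real"
  assumes cont: "continuous_on {s..v} u" and "s < v" and rat: "\<forall>q\<in>\<rat>. s \<le> q \<and> q \<le> v \<longrightarrow> 0 \<le> u q"
    and r: "r \<in> {s..v}"
  shows "0 \<le> u r"
proof (rule ccontr)
  assume "\<not> 0 \<le> u r"
  then have "0 < - u r" by simp
  then obtain d where d: "0 < d" "\<And>x. x \<in> {s..v} \<Longrightarrow> dist x r < d \<Longrightarrow> dist (u x) (u r) < - u r"
    using cont r unfolding continuous_on_iff by metis
  have "max s (r - d) < min v (r + d)" using r d(1) \<open>s < v\<close> by auto
  then obtain q where q: "q \<in> \<rat>" "max s (r - d) < q" "q < min v (r + d)" using Rats_dense_in_real by blast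
  then have "dist (u q) (u r) < - u r" by (intro d(2)) (auto simp: dist_real_def)
  moreover have "0 \<le> u q" using rat q by auto
  ultimately show False by (simp add: dist_real_def)
qed

lemma first_negative_time:
  fixes u :: "real \<Rightarrow> real"
  assumes cont: "continuous_on {s..t} u" and "s \<le> t" and us: "0 \<le> u s"
  shows "\<exists>\<rho>. s \<le> \<rho> \<and> \<rho> \<le> t \<and> (\<forall>r\<in>{s..\<rho>}. 0 \<le> u r) \<and> (\<rho> = t \<or> u \<rho> \<le> 0) \<and>
    (\<forall>v\<in>{s..t}. (\<forall>r\<in>{s..v}. 0 \<le> u r) \<longleftrightarrow> v \<le> \<rho>)"
proof -
  define S where "S = {v \<in> {s..t}. \<forall>r\<in>{s..v}. 0 \<le> u r}"
  define \<rho> where "\<rho> = Sup S"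
  have sS: "s \<in> S" using us \<open>s \<le> t\<close> by (simp add: S_def)
  have bdd: "bdd_above S" by (rule bdd_aboveI[of _ t]) (auto simp: S_def)
  have st: "s \<le> \<rho>" "\<rho> \<le> t"
  proof -
    show "s \<le> \<rho>" unfolding \<rho>_def by (rule cSup_upper[OF sS bdd])
    show "\<rho> \<le> t" unfolding \<rho>_def
    proof (rule cSup_least)
      show "S \<noteq> {}" using sS by blast
      show "v \<le> t" if "v \<in> S" for v using that by (simp add: S_def)
    qed
  qed
  have below: "0 \<le> u r" if "s \<le> r" "r < \<rho>" for r
  proof -
    obtain v where "v \<in> S" "r < v"
      using less_cSupD[of S r] sS \<open>r < \<rho>\<close> unfolding \<rho>_def by blast
    then show ?thesis using \<open>s \<le> r\<close> by (auto simp: S_def)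
  qed
  have local: "\<exists>d>0. \<forall>x\<in>{s..t}. dist x \<rho> < d \<longrightarrow> dist (u x) (u \<rho>) < e" if "0 < e" for e
    using cont st that unfolding continuous_on_iff by auto
  have at: "0 \<le> u \<rho>"
  proof (cases "s = \<rho>")
    case False
    show ?thesis
    proof (rule ccontr)
      assume neg: "\<not> 0 \<le> u \<rho>"
      then obtain d where d: "0 < d" "\<forall>x\<in>{s..t}. dist x \<rho> < d \<longrightarrow> dist (u x) (u \<rho>) < - u \<rho>"
        using local[of "- u \<rho>"] by auto
      let ?x = "max s (\<rho> - d / 2)"
      have "0 \<le> u ?x" using below[of ?x] False st d(1) by auto
      moreover have "dist (u ?x) (u \<rho>) < - u \<rho>"
        using d False st by (intro d(2)[THEN bspec, THEN mp]) (auto simp: dist_real_def)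
      ultimately show False by (simp add: dist_real_def)
    qed
  qed (use us in simp)
  have nonneg: "0 \<le> u r" if "r \<in> {s..\<rho>}" for r
    using below[of r] at that by (cases "r = \<rho>") auto
  have "\<rho> = t \<or> u \<rho> \<le> 0"
  proof (rule ccontr)
    assume "\<not> (\<rho> = t \<or> u \<rho> \<le> 0)"
    then have c: "\<rho> < t" "0 < u \<rho>" using st by auto
    then obtain d where d: "0 < d" "\<forall>x\<in>{s..t}. dist x \<rho> < d \<longrightarrow> dist (u x) (u \<rho>) < u \<rho>"
      using local[of "u \<rho>"] by auto
    let ?v = "min t (\<rho> + d / 2)"
    have "0 \<le> u r" if "r \<in> {s..?v}" for r
    proof (cases "r \<le> \<rho>")
      case False
      then have "dist (u r) (u \<rho>) < u \<rho>"
        using d st that by (intro d(2)[THEN bspec, THEN mp]) (auto simp: dist_real_def)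
      then show ?thesis by (simp add: dist_real_def)
    qed (use nonneg that in auto)
    then have "?v \<in> S" using st c d by (auto simp: S_def)
    then have "?v \<le> \<rho>" unfolding \<rho>_def using bdd by (rule cSup_upper)
    then show False using c d by auto
  qed
  moreover have "(\<forall>r\<in>{s..v}. 0 \<le> u r) \<longleftrightarrow> v \<le> \<rho>" if "v \<in> {s..t}" for v
  proof
    assume "\<forall>r\<in>{s..v}. 0 \<le> u r"
    then have "v \<in> S" using that by (simp add: S_def)
    then show "v \<le> \<rho>" unfolding \<rho>_def using bdd by (rule cSup_upper)
  qed (use nonneg in auto)
  ultimately show ?thesis using st nonneg by (intro exI[of _ \<rho>]) auto
qed

text \<open>
  The uniform subdivision of \<open>[s, t]\<close> into \<open>n + 1\<close> steps; the successor avoids a division by zero.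
\<close>

definition grid :: "real \<Rightarrow> real \<Rightarrow> nat \<Rightarrow> nat \<Rightarrow> real" where
  "grid s t n j = s + real j * ((t - s) / real (Suc n))"

lemma grid_0 [simp]: "grid s t n 0 = s" by (simp add: grid_def)

lemma grid_end [simp]: "grid s t n (Suc n) = t" by (simp add: grid_def)

lemma grid_mono: "s \<le> t \<Longrightarrow> i \<le> j \<Longrightarrow> grid s t n i \<le> grid s t n j"
  unfolding grid_def by (intro add_mono mult_right_mono) auto

lemma grid_in: "s \<le> t \<Longrightarrow> j \<le> Suc n \<Longrightarrow> grid s t n j \<in> {s..t}"
  using grid_mono[of s t 0 j n] grid_mono[of s t j "Suc n" n] by simp

text \<open>
  The sum telescopes to the value of \<open>i\<close> at the first grid point after \<open>\<rho>\<close>, or at \<open>t\<close> if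
  there is none.
\<close>

lemma grid_stopped_sum_tendsto:
  fixes i :: "real \<Rightarrow> real"
  assumes cont: "continuous_on {s..t} i" and "s < t" and \<rho>: "s \<le> \<rho>" "\<rho> \<le> t"
  shows "(\<lambda>n. \<Sum>j<Suc n. of_bool (grid s t n j \<le> \<rho>) * (i (grid s t n (Suc j)) - i (grid s t n j)))
    \<longlonglongrightarrow> i \<rho> - i s"
proof -
  define h where "h n = (t - s) / real (Suc n)" for n
  define m where "m n = nat \<lfloor>(\<rho> - s) / h n\<rfloor>" for n
  define \<kappa> where "\<kappa> n = grid s t n (min (Suc n) (Suc (m n)))" for n
  have h: "0 < h n" for n using \<open>s < t\<close> by (simp add: h_def)
  have grid_h: "grid s t n j = s + real j * h n" for n j by (simp only: grid_def h_def)
  have le_iff: "grid s t n j \<le> \<rho> \<longleftrightarrow> j \<le> m n" for n j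
  proof -
    have "grid s t n j \<le> \<rho> \<longleftrightarrow> real j \<le> (\<rho> - s) / h n"
      using h[of n] by (simp add: grid_h pos_le_divide_eq le_diff_eq add.commute)
    also have "\<dots> \<longleftrightarrow> j \<le> m n"
    proof -
      have "0 \<le> (\<rho> - s) / h n" using h[of n] \<rho> by simp
      then show ?thesis
        unfolding m_def by (simp only: le_nat_iff le_floor_iff zero_le_floor of_int_of_nat_eq)
    qed
    finally show ?thesis .
  qed
  have sum_eq: "(\<Sum>j<Suc n. of_bool (grid s t n j \<le> \<rho>) * (i (grid s t n (Suc j)) - i (grid s t n j))) = i (\<kappa> n) - i s" for n
  proof -
    have "(\<Sum>j<Suc n. of_bool (grid s t n j \<le> \<rho>) * (i (grid s t n (Suc j)) - i (grid s t n j)))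
      = (\<Sum>j\<in>{..<Suc n} \<inter> {j. j \<le> m n}. i (grid s t n (Suc j)) - i (grid s t n j))"
      unfolding le_iff by (rule sum_of_bool_mult_eq) simp
    also have "{..<Suc n} \<inter> {j. j \<le> m n} = {..<min (Suc n) (Suc (m n))}" by auto
    also have "(\<Sum>j<min (Suc n) (Suc (m n)). i (grid s t n (Suc j)) - i (grid s t n j)) = i (\<kappa> n) - i (grid s t n 0)"
      unfolding \<kappa>_def by (rule sum_lessThan_telescope)
    finally show ?thesis by simp
  qed
  have \<kappa>_in: "\<kappa> n \<in> {s..t}" for n
    unfolding \<kappa>_def using \<open>s < t\<close> by (intro grid_in) auto
  have near: "\<bar>\<kappa> n - \<rho>\<bar> \<le> h n" for n
  proof (cases "m n \<le> n")
    case True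
    then have "\<kappa> n = grid s t n (m n) + h n"
      by (simp add: \<kappa>_def grid_h algebra_simps min_absorb2)
    moreover have "grid s t n (m n) \<le> \<rho>" "\<not> grid s t n (Suc (m n)) \<le> \<rho>" using le_iff by auto
    ultimately show ?thesis using True h[of n] by (auto simp: \<kappa>_def min_absorb2)
  next
    case False
    then have "\<kappa> n = t" by (simp add: \<kappa>_def min_absorb1)
    moreover have "t \<le> \<rho>" using le_iff[of n "Suc n"] False by simp
    ultimately show ?thesis using \<rho> h[of n] by simp
  qed
  have "h \<longlonglongrightarrow> 0"
    unfolding h_def using LIMSEQ_Suc[OF lim_const_over_n[of "t - s"]] by simp
  then have "(\<lambda>n. \<kappa> n - \<rho>) \<longlonglongrightarrow> 0"
    by (rule Lim_null_comparison[rotated]) (use near in auto)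
  then have "\<kappa> \<longlonglongrightarrow> \<rho>" by (simp add: LIM_zero_iff)
  then have "(\<lambda>n. i (\<kappa> n)) \<longlonglongrightarrow> i \<rho>"
    using \<rho> \<kappa>_in by (intro continuous_on_tendsto_compose[OF cont]) auto
  then show ?thesis unfolding sum_eq by (intro tendsto_diff) auto
qed

context brownian_space
begin

text \<open>
  Discrete stochastic integration: the transforms are used to stop (indicators of not yet having
  stopped) and to follow the upcrossing strategy.
\<close>

lemma martingale_transform:
  fixes h :: "nat \<Rightarrow> 'w \<Rightarrow> real"
  assumes I: "L2_martingale I" and g: "0 \<le> g 0" "\<And>j. j < k \<Longrightarrow> g j \<le> g (Suc j)"
    and h: "\<And>j. j < k \<Longrightarrow> h j \<in> borel_measurable (F (g j))"
    and bound: "\<And>j w. j < k \<Longrightarrow> w \<in> space M \<Longrightarrow> \<bar>h j w\<bar> \<le> c"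
  defines "X \<equiv> \<lambda>w. \<Sum>j<k. h j w * (I (g (Suc j)) w - I (g j) w)"
  shows "X \<in> borel_measurable M" "integrable M (\<lambda>w. (X w)\<^sup>2)" "(\<integral>w. X w \<partial>M) = 0"
    "(\<integral>w. (X w)\<^sup>2 \<partial>M) \<le> c\<^sup>2 * (\<integral>w. (I (g k) w - I (g 0) w)\<^sup>2 \<partial>M)"
proof -
  let ?d = "\<lambda>j w. I (g (Suc j)) w - I (g j) w"
  have gm: "g i \<le> g j" if "i \<le> j" "j \<le> k" for i j
    by (rule mono_up_to[of k g]) (use g that in auto)
  have g0: "0 \<le> g j" if "j \<le> k" for j using gm[of 0 j] g(1) that by simp
  have Im: "I t \<in> borel_measurable (F t)" if "0 \<le> t" for t
    using I that unfolding L2_martingale_def by blast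
  have nd: "null_mean_on M (F (g j)) (?d j)" if "j < k" for j
    using I g0[of j] g(2)[of j] that unfolding L2_martingale_def by simp
  have nt: "null_mean_on M (F (g j)) (\<lambda>w. h j w * ?d j w)" if "j < k" for j
    by (rule null_mean_on_mult_bounded[OF subalgebra_F nd h]) (use that bound in auto)
  have ad: "?d j \<in> borel_measurable (F (g i))" if "j < i" "i < k" for i j
  proof (rule borel_measurable_diff)
    show "I (g (Suc j)) \<in> borel_measurable (F (g i))"
      using that gm[of "Suc j" i] g0[of "Suc j"] by (intro measurable_F_mono[OF Im]) auto
    show "I (g j) \<in> borel_measurable (F (g i))"
      using that gm[of j i] g0[of j] by (intro measurable_F_mono[OF Im]) auto
  qed
  have at: "(\<lambda>w. h j w * ?d j w) \<in> borel_measurable (F (g i))" if "j < i" "i < k" for i j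
  proof (rule borel_measurable_times[OF _ ad[OF that]])
    show "h j \<in> borel_measurable (F (g i))"
      using that gm[of j i] by (intro measurable_F_mono[OF h]) auto
  qed
  have sum_d: "(\<Sum>j<k. ?d j w) = I (g k) w - I (g 0) w" for w
    by (rule sum_lessThan_telescope)
  have d: "(\<integral>w. (I (g k) w - I (g 0) w)\<^sup>2 \<partial>M) = (\<Sum>j<k. \<integral>w. (?d j w)\<^sup>2 \<partial>M)"
    using square_of_null_mean_sum[of k "\<lambda>j. F (g j)" ?d, OF subalgebra_F nd ad] unfolding sum_d by blast
  have X2: "integrable M (\<lambda>w. (X w)\<^sup>2) \<and> (\<integral>w. (X w)\<^sup>2 \<partial>M) = (\<Sum>j<k. \<integral>w. (h j w * ?d j w)\<^sup>2 \<partial>M)"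
    unfolding X_def by (rule square_of_null_mean_sum[of k "\<lambda>j. F (g j)", OF subalgebra_F nt at])
  then show "integrable M (\<lambda>w. (X w)\<^sup>2)" by blast
  have meas: "(\<lambda>w. h j w * ?d j w) \<in> borel_measurable M" "integrable M (\<lambda>w. (h j w * ?d j w)\<^sup>2)"
    "integrable M (\<lambda>w. (?d j w)\<^sup>2)" if "j < k" for j
    using nt[OF that] nd[OF that] unfolding null_mean_on_def by blast+
  show "X \<in> borel_measurable M" unfolding X_def using meas(1) by (intro borel_measurable_sum) auto
  have zero: "(\<integral>w. h j w * ?d j w \<partial>M) = 0" if "j < k" for j
  proof -
    have "(\<integral>w. indicator (space M) w * (h j w * ?d j w) \<partial>M) = 0"
      using nt[OF that] sets.top[of "F (g j)"] unfolding null_mean_on_def space_F by blast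
    moreover have "(\<integral>w. indicator (space M) w * (h j w * ?d j w) \<partial>M) = (\<integral>w. h j w * ?d j w \<partial>M)"
      by (intro Bochner_Integration.integral_cong) auto
    ultimately show ?thesis by simp
  qed
  have "(\<integral>w. X w \<partial>M) = (\<Sum>j<k. \<integral>w. h j w * ?d j w \<partial>M)"
    unfolding X_def by (rule Bochner_Integration.integral_sum) (rule integrable_of_square[OF meas(1,2)], auto)
  then show "(\<integral>w. X w \<partial>M) = 0" using zero by simp
  have "(\<integral>w. (h j w * ?d j w)\<^sup>2 \<partial>M) \<le> c\<^sup>2 * (\<integral>w. (?d j w)\<^sup>2 \<partial>M)" if "j < k" for j
  proof -
    have "(\<integral>w. (h j w * ?d j w)\<^sup>2 \<partial>M) \<le> (\<integral>w. c\<^sup>2 * (?d j w)\<^sup>2 \<partial>M)"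
    proof (rule integral_mono[OF meas(2)[OF that] integrable_mult_right[OF meas(3)[OF that]]])
      fix w assume "w \<in> space M"
      then have "(h j w)\<^sup>2 \<le> c\<^sup>2"
        using bound[OF that, of w] by (simp add: abs_le_square_iff[symmetric])
      then show "(h j w * ?d j w)\<^sup>2 \<le> c\<^sup>2 * (?d j w)\<^sup>2"
        by (simp add: power_mult_distrib mult_right_mono)
    qed
    then show ?thesis by simp
  qed
  then show "(\<integral>w. (X w)\<^sup>2 \<partial>M) \<le> c\<^sup>2 * (\<integral>w. (I (g k) w - I (g 0) w)\<^sup>2 \<partial>M)"
    unfolding d sum_distrib_left using X2 by (auto intro!: sum_mono)
qed

text \<open>
  On \<open>A = {U s > 0}\<close> let \<open>\<rho>\<close> be the first time after \<open>s\<close> at which \<open>U\<close> becomes negative, or \<open>t\<close> if that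
  is earlier. Up to \<open>\<rho>\<close> the process \<open>U\<close> is nonnegative, so \<open>U s \<le> U \<rho> - (I \<rho> - I s)\<close>, and
  \<open>U \<rho> \<le> max 0 (U t)\<close>. It remains that the stopped increment \<open>I \<rho> - I s\<close> does not have negative mean
  on \<open>A\<close>; it is the limit of martingale transforms along grids, bounded in \<open>L\<^sup>2\<close>.
\<close>

lemma comparison_step:
  fixes U :: "real \<Rightarrow> 'w \<Rightarrow> real" and s t :: real
  assumes I: "L2_martingale I" and U: "\<And>t. 0 \<le> t \<Longrightarrow> U t \<in> borel_measurable (F t)"
    and cont: "AE w in M. continuous_on {0..} (\<lambda>t. U t w)"
    and drift: "AE w in M. \<forall>s t. 0 \<le> s \<and> s \<le> t \<and> (\<forall>r\<in>{s..t}. 0 \<le> U r w) \<longrightarrow>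
      I t w - I s w \<le> U t w - U s w"
    and st: "0 \<le> s" "s < t"
  shows "(\<integral>\<^sup>+w. ennreal (U s w) \<partial>M) \<le> (\<integral>\<^sup>+w. ennreal (U t w) \<partial>M)"
proof (cases "(\<integral>\<^sup>+w. ennreal (U t w) \<partial>M) = \<infinity>")
  case False
  let ?g = "grid s t"
  define A where "A = {w\<in>space M. 0 < U s w}"
  \<comment> \<open>If \<open>s\<close> is irrational then \<open>E s\<close> is the whole space; the sign at \<open>s\<close> itself comes from \<open>A\<close>.\<close>
  define E where "E v = {w\<in>space M. \<forall>q\<in>\<rat>. s \<le> q \<and> q \<le> v \<longrightarrow> 0 \<le> U q w}" for v
  define X where "X n w = (\<Sum>j<Suc n. indicator (A \<inter> E (?g n j)) w * (I (?g n (Suc j)) w - I (?g n j) w))" for n w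
  define L where "L w = lim (\<lambda>n. X n w)" for w
  have UM: "U r \<in> borel_measurable M" if "0 \<le> r" for r using measurable_F_M[OF U[OF that]] .
  have A: "A \<in> sets (F v)" if "s \<le> v" for v
  proof -
    have [measurable]: "U s \<in> borel_measurable (F v)" using measurable_F_mono[OF U[OF st(1)]] that by simp
    have "A = {w\<in>space (F v). 0 < U s w}" by (simp add: A_def)
    also have "\<dots> \<in> sets (F v)" by measurable
    finally show ?thesis .
  qed
  have E: "E v \<in> sets (F v)" if "s \<le> v" for v
  proof -
    have eq: "E v = space M \<inter> (\<Inter>q\<in>{q\<in>\<rat>. s \<le> q \<and> q \<le> v}. {w\<in>space (F v). 0 \<le> U q w})"
      by (auto simp: E_def)
    have "countable {q\<in>\<rat>. s \<le> q \<and> q \<le> v}"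
      by (rule countable_subset[OF _ countable_rat]) auto
    moreover have "{w\<in>space (F v). 0 \<le> U q w} \<in> sets (F v)" if "q \<in> {q\<in>\<rat>. s \<le> q \<and> q \<le> v}" for q
    proof -
      have [measurable]: "U q \<in> borel_measurable (F v)"
        using measurable_F_mono[OF U[of q], of v] that st by simp
      show ?thesis by measurable
    qed
    ultimately show ?thesis
    proof (cases "{q\<in>\<rat>. s \<le> q \<and> q \<le> v} = {}")
      case True
      then have "E v = space M" by (auto simp: E_def)
      then show ?thesis using sets.top[of "F v"] by simp
    next
      case False
      then show ?thesis unfolding eq
        using \<open>countable _\<close> \<open>\<And>q. q \<in> _ \<Longrightarrow> _ \<in> sets (F v)\<close> sets.top[of "F v"]
        by (intro sets.Int sets.countable_INT') auto
    qed
  qed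
  have AE_g: "indicator (A \<inter> E (?g n j)) \<in> borel_measurable (F (?g n j))" if "j < Suc n" for n j
    using A[of "?g n j"] E[of "?g n j"] grid_in[of s t j n] st that by (intro borel_measurable_indicator) auto
  have gm: "\<And>j. j < Suc n \<Longrightarrow> ?g n j \<le> ?g n (Suc j)" for n
    using st by (intro grid_mono) auto
  have X: "X n \<in> borel_measurable M" "integrable M (\<lambda>w. (X n w)\<^sup>2)" "(\<integral>w. X n w \<partial>M) = 0"
    "(\<integral>w. (X n w)\<^sup>2 \<partial>M) \<le> (\<integral>w. (I t w - I s w)\<^sup>2 \<partial>M)" for n
  proof -
    have g0: "0 \<le> ?g n 0" using st by simp
    have bound: "\<bar>indicator (A \<inter> E (?g n j)) w\<bar> \<le> (1 :: real)" for j w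
      by (simp add: indicator_def)
    note tr = martingale_transform[where g="?g n" and k="Suc n" and h="\<lambda>j. indicator (A \<inter> E (?g n j))" and c=1,
        OF I g0 gm AE_g bound]
    show "X n \<in> borel_measurable M" unfolding X_def by (rule tr(1))
    show "integrable M (\<lambda>w. (X n w)\<^sup>2)" unfolding X_def by (rule tr(2))
    show "(\<integral>w. X n w \<partial>M) = 0" unfolding X_def by (rule tr(3))
    show "(\<integral>w. (X n w)\<^sup>2 \<partial>M) \<le> (\<integral>w. (I t w - I s w)\<^sup>2 \<partial>M)"
      unfolding X_def using tr(4) by (simp only: grid_0 grid_end power_one mult_1)
  qed
  have L: "L \<in> borel_measurable M" unfolding L_def using X(1) by (intro borel_measurable_lim_metric)
  have Icont: "AE w in M. continuous_on {0..} (\<lambda>t. I t w)"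
    using I unfolding L2_martingale_def by blast
  have path: "AE w in M. (\<lambda>n. X n w) \<longlonglongrightarrow> L w \<and> (w \<notin> A \<longrightarrow> L w = 0) \<and> (w \<in> A \<longrightarrow> U s w \<le> max 0 (U t w) - L w)"
    using cont Icont drift AE_space
  proof eventually_elim
    case (elim w)
    show ?case
    proof (cases "w \<in> A")
      case False
      then have "X n w = 0" for n by (simp add: X_def)
      then show ?thesis using False by (simp add: L_def)
    next
      case True
      then have Us: "0 < U s w" by (simp add: A_def)
      have cu: "continuous_on {s..v} (\<lambda>t. U t w)" and ci: "continuous_on {s..v} (\<lambda>t. I t w)" for v
        using elim(1,2) st by (auto elim: continuous_on_subset)
      have "0 \<le> U s w" using Us by simp
      from first_negative_time[OF cu[of t] less_imp_le[OF st(2)] this]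
      obtain \<rho> where \<rho>: "s \<le> \<rho>" "\<rho> \<le> t" "\<forall>r\<in>{s..\<rho>}. 0 \<le> U r w" "\<rho> = t \<or> U \<rho> w \<le> 0"
        "\<forall>v\<in>{s..t}. (\<forall>r\<in>{s..v}. 0 \<le> U r w) \<longleftrightarrow> v \<le> \<rho>"
        by (elim exE conjE)
      have E_iff: "w \<in> E v \<longleftrightarrow> v \<le> \<rho>" if v: "v \<in> {s..t}" for v
      proof -
        have "w \<in> E v \<longleftrightarrow> (\<forall>r\<in>{s..v}. 0 \<le> U r w)"
        proof (cases "s = v")
          case True
          then show ?thesis using Us elim(4) by (auto simp: E_def)
        next
          case False
          then have "s < v" using v by simp
          then show ?thesis
            using nonneg_on_rationals[OF cu \<open>s < v\<close>] elim(4) by (auto simp: E_def)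
        qed
        then show ?thesis using \<rho>(5) v by blast
      qed
      have "X n w = (\<Sum>j<Suc n. of_bool (?g n j \<le> \<rho>) * (I (?g n (Suc j)) w - I (?g n j) w))" for n
        unfolding X_def
      proof (rule sum.cong[OF refl])
        fix j assume "j \<in> {..<Suc n}"
        then have "?g n j \<in> {s..t}" using st by (intro grid_in) auto
        from E_iff[OF this] True show "indicator (A \<inter> E (?g n j)) w * (I (?g n (Suc j)) w - I (?g n j) w)
          = of_bool (?g n j \<le> \<rho>) * (I (?g n (Suc j)) w - I (?g n j) w)" by (simp add: indicator_def)
      qed
      then have lim: "(\<lambda>n. X n w) \<longlonglongrightarrow> I \<rho> w - I s w"
        using grid_stopped_sum_tendsto[OF ci st(2) \<rho>(1,2)] by simp
      then have L_eq: "L w = I \<rho> w - I s w" unfolding L_def by (rule limI)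
      have "I \<rho> w - I s w \<le> U \<rho> w - U s w" using elim(3) \<rho>(1,3) st by auto
      moreover have "U \<rho> w \<le> max 0 (U t w)" using \<rho>(4) by auto
      ultimately show ?thesis using lim L_eq True by simp
    qed
  qed
  have lim: "AE w in M. (\<lambda>n. X n w) \<longlonglongrightarrow> L w" using path by eventually_elim blast
  note L2 = integral_nonneg_of_L2_bounded_limit[OF X(1) L X(2,4,3) lim]
  have intL: "integrable M L" by (rule integrable_of_square[OF L L2(1)])
  have [measurable]: "U t \<in> borel_measurable M" "U s \<in> borel_measurable M" "A \<in> sets M" "L \<in> borel_measurable M"
    using UM[of t] UM[of s] st A[of s] sets_F_M L by auto
  have eqm: "(\<integral>\<^sup>+w. ennreal (max 0 (U t w)) \<partial>M) = (\<integral>\<^sup>+w. ennreal (U t w) \<partial>M)"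
    by (intro nn_integral_cong) (simp add: max_def ennreal_neg)
  have intU: "integrable M (\<lambda>w. max 0 (U t w))"
    using False eqm by (auto simp: integrable_iff_bounded less_top)
  have intUA: "integrable M (\<lambda>w. indicator A w * max 0 (U t w))"
    using integrable_mult_indicator[OF \<open>A \<in> sets M\<close> intU] by simp
  have "(\<integral>\<^sup>+w. ennreal (U s w) \<partial>M) \<le> (\<integral>\<^sup>+w. ennreal (indicator A w * max 0 (U t w) - L w) \<partial>M)"
  proof (rule nn_integral_mono_AE)
    from path AE_space show "AE w in M. ennreal (U s w) \<le> ennreal (indicator A w * max 0 (U t w) - L w)"
      by eventually_elim (auto simp: A_def ennreal_neg intro!: ennreal_leI split: split_indicator)
  qed
  also have "\<dots> = ennreal (\<integral>w. indicator A w * max 0 (U t w) - L w \<partial>M)"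
  proof (rule nn_integral_eq_integral)
    from path AE_space show "AE w in M. 0 \<le> indicator A w * max 0 (U t w) - L w"
      by eventually_elim (auto simp: A_def split: split_indicator)
  qed (use intUA intL in simp)
  also have "(\<integral>w. indicator A w * max 0 (U t w) - L w \<partial>M) \<le> (\<integral>w. indicator A w * max 0 (U t w) \<partial>M)"
    using intUA intL L2(2) by simp
  also have "(\<integral>w. indicator A w * max 0 (U t w) \<partial>M) \<le> (\<integral>w. max 0 (U t w) \<partial>M)"
    by (rule integral_mono[OF intUA intU]) (auto simp: indicator_def)
  also have "ennreal (\<integral>w. max 0 (U t w) \<partial>M) = (\<integral>\<^sup>+w. ennreal (U t w) \<partial>M)"
    unfolding eqm[symmetric] by (rule nn_integral_eq_integral[OF intU, symmetric]) simp
  finally show ?thesis by (simp add: ennreal_leI)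
qed simp

lemma comparison:
  fixes U :: "real \<Rightarrow> 'w \<Rightarrow> real"
  assumes I: "L2_martingale I" and U: "\<And>t. 0 \<le> t \<Longrightarrow> U t \<in> borel_measurable (F t)"
    and cont: "AE w in M. continuous_on {0..} (\<lambda>t. U t w)"
    and drift: "AE w in M. \<forall>s t. 0 \<le> s \<and> s \<le> t \<and> (\<forall>r\<in>{s..t}. 0 \<le> U r w) \<longrightarrow>
      I t w - I s w \<le> U t w - U s w"
    and decay: "(\<lambda>n::nat. \<integral>\<^sup>+w. ennreal (U (real n) w) \<partial>M) \<longlonglongrightarrow> 0"
  shows "AE w in M. \<forall>t\<ge>0. U t w \<le> 0"
proof -
  have "AE w in M. U s w \<le> 0" if s: "0 \<le> s" for s
  proof -
    have "eventually (\<lambda>n. (\<integral>\<^sup>+w. ennreal (U s w) \<partial>M) \<le> (\<integral>\<^sup>+w. ennreal (U (real n) w) \<partial>M)) sequentially"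
      using filterlim_real_sequentially[THEN filterlim_at_top_dense[THEN iffD1], THEN spec, of s]
      by eventually_elim (rule comparison_step[OF I U cont drift s])
    then have "(\<integral>\<^sup>+w. ennreal (U s w) \<partial>M) \<le> 0"
      by (intro tendsto_lowerbound[OF decay]) auto
    then have "(\<integral>\<^sup>+w. ennreal (U s w) \<partial>M) = 0" by simp
    moreover have "U s \<in> borel_measurable M" using measurable_F_M[OF U[OF s]] .
    ultimately show ?thesis by (simp add: nn_integral_0_iff_AE ennreal_eq_0_iff)
  qed
  then have "AE w in M. \<forall>q\<in>{q\<in>\<rat>. 0 \<le> q}. U q w \<le> 0"
    by (intro AE_ball_countable[THEN iffD2])
      (auto intro: countable_subset[OF _ countable_rat])
  with cont show ?thesis
  proof eventually_elim
    case (elim w)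
    show ?case
    proof (intro allI impI)
      fix t :: real assume t: "0 \<le> t"
      have "0 \<le> - U t w"
      proof (rule nonneg_on_rationals[of 0 "t + 1" "\<lambda>t. - U t w"])
        show "continuous_on {0..t + 1} (\<lambda>t. - U t w)"
          using elim(1) by (auto intro!: continuous_intros elim: continuous_on_subset)
      qed (use elim t in auto)
      then show "U t w \<le> 0" by simp
    qed
  qed
qed

end

section \<open>Regularity and order of the backward solutions\<close>

text \<open>
  The integral of a function that is not integrable is zero by convention, so the equation itself
  does not say that the drift is integrable. If it failed to be integrable on \<open>[0, T]\<close>, then
  intervals around the critical time \<open>Sup J\<close> would carry no drift, so \<open>y - i\<close> would be constant off that
  single time; but then \<open>y\<close> agrees almost everywhere with a continuous function and the drift is
  integrable after all.
\<close>

lemma integral_equation_regular: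
  fixes y i \<phi> :: "real \<Rightarrow> real"
  assumes T: "0 \<le> T" and y: "y \<in> borel_measurable (restrict_space borel {0..T})"
    and \<phi>: "continuous_on UNIV \<phi>" and i: "continuous_on {0..T} i"
    and eq: "\<And>s t. 0 \<le> s \<Longrightarrow> s \<le> t \<Longrightarrow> t \<le> T \<Longrightarrow>
      y s = y t - (LINT r:{s..t}|lborel. \<phi> (y r)) - (i t - i s)"
  shows "set_integrable lborel {0..T} (\<lambda>r. \<phi> (y r))" "continuous_on {0..T} y"
proof -
  have \<phi>m: "\<phi> \<in> borel_measurable borel" by (rule borel_measurable_continuous_onI[OF \<phi>])
  have meas: "set_borel_measurable lborel {0..T} (\<lambda>r. \<phi> (y r))"
    using measurable_compose[OF y \<phi>m] unfolding set_borel_measurable_def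
    by (subst (asm) borel_measurable_restrict_space_iff) auto
  have no_drift: "y t - i t = y s - i s"
    if "0 \<le> s" "s \<le> t" "t \<le> T" "\<not> set_integrable lborel {s..t} (\<lambda>r. \<phi> (y r))" for s t
  proof -
    have "(LINT r:{s..t}|lborel. \<phi> (y r)) = 0"
      using that(4) unfolding set_integrable_def set_lebesgue_integral_def by (rule not_integrable_integral_eq)
    then show ?thesis using eq[OF that(1-3)] by simp
  qed
  show int: "set_integrable lborel {0..T} (\<lambda>r. \<phi> (y r))"
  proof (rule ccontr)
    assume not: "\<not> set_integrable lborel {0..T} (\<lambda>r. \<phi> (y r))"
    define c where "c = y 0 - i 0"
    have cT: "y T - i T = c" unfolding c_def using no_drift[of 0 T] T not by simp
    define J where "J = {t\<in>{0..T}. set_integrable lborel {0..t} (\<lambda>r. \<phi> (y r))}"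
    have bdd: "bdd_above J" by (rule bdd_aboveI[of _ T]) (auto simp: J_def)
    have const: "y s - i s = c" if s: "s \<in> {0..T}" "s \<noteq> Sup J" for s
    proof (cases "s \<in> J")
      case False
      then show ?thesis unfolding c_def using no_drift[of 0 s] s by (auto simp: J_def)
    next
      case True
      then have "set_integrable lborel {0..s} (\<lambda>r. \<phi> (y r))" by (simp add: J_def)
      moreover have "{0..s} \<union> {s..T} = {0..T}" using s by auto
      ultimately have "\<not> set_integrable lborel {s..T} (\<lambda>r. \<phi> (y r))"
        using not set_integrable_Un[of lborel "{0..s}" "\<lambda>r. \<phi> (y r)" "{s..T}"] by auto
      then show ?thesis using no_drift[of s T] s cT by simp
    qed
    have "set_integrable lborel {0..T} (\<lambda>r. \<phi> (c + i r))"
    proof (rule borel_integrable_atLeastAtMost')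
      show "continuous_on {0..T} (\<lambda>r. \<phi> (c + i r))"
        by (rule continuous_on_compose2[OF \<phi>]) (auto intro!: continuous_intros i)
    qed
    moreover have "AE r in lborel. indicator {0..T} r *\<^sub>R \<phi> (c + i r) = indicator {0..T} r *\<^sub>R \<phi> (y r)"
      using AE_lborel_singleton[of "Sup J"]
    proof eventually_elim
      case (elim r)
      show ?case
      proof (cases "r \<in> {0..T}")
        case True
        then have "c + i r = y r" using const[OF True elim] by simp
        then show ?thesis by simp
      qed simp
    qed
    ultimately have "set_integrable lborel {0..T} (\<lambda>r. \<phi> (y r))"
      using integrable_cong_AE_imp[OF _ meas[unfolded set_borel_measurable_def]]
      unfolding set_integrable_def by blast
    then show False using not by simp
  qed
  have sub: "set_integrable lborel {0..t} (\<lambda>r. \<phi> (y r))" if "t \<le> T" for t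
    by (rule set_integrable_subset[OF int]) (use that in auto)
  have "continuous_on {0..T} (\<lambda>t. y 0 + integral {0..t} (\<lambda>r. \<phi> (y r)) + (i t - i 0))"
    using set_borel_integral_eq_integral(1)[OF int]
    by (intro continuous_intros i indefinite_integral_continuous_1)
  then show "continuous_on {0..T} y"
  proof (rule continuous_on_eq)
    show "y 0 + integral {0..t} (\<lambda>r. \<phi> (y r)) + (i t - i 0) = y t" if "t \<in> {0..T}" for t
      using eq[of 0 t] that set_borel_integral_eq_integral(2)[OF sub[of t]] by simp
  qed
qed

lemma constant_after:
  fixes i :: "real \<Rightarrow> real"
  assumes cont: "continuous_on {0..} i" and "0 \<le> c"
    and const: "\<And>p q. p \<in> \<rat> \<Longrightarrow> q \<in> \<rat> \<Longrightarrow> c < p \<Longrightarrow> p \<le> q \<Longrightarrow> i q = i p" and "c \<le> t"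
  shows "i t = i c"
proof -
  define S where "S = {q\<in>\<rat>. c < q}"
  obtain p where p: "p \<in> S" unfolding S_def using Rats_dense_in_real[of c "c + 1"] by auto
  have val: "i q = i p" if "q \<in> S" for q
  proof (cases "p \<le> q")
    case True
    then show ?thesis using const[of p q] that p unfolding S_def by blast
  next
    case False
    then show ?thesis using const[of q p] that p unfolding S_def by force
  qed
  have "closure S \<subseteq> {c..}" by (rule closure_minimal) (auto simp: S_def)
  then have contS: "continuous_on (closure S) i"
    using \<open>0 \<le> c\<close> by (intro continuous_on_subset[OF cont]) auto
  have "x \<in> closure S" if "c \<le> x" for x
    unfolding closure_approachable
  proof (intro allI impI)
    fix e :: real assume "0 < e"
    then obtain q where "q \<in> \<rat>" "x < q" "q < x + e" using Rats_dense_in_real[of x "x + e"] by auto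
    then show "\<exists>y\<in>S. dist y x < e" using that by (intro bexI[of _ q]) (auto simp: S_def dist_real_def)
  qed
  then have "i x = i p" if "c \<le> x" for x
    using continuous_constant_on_closure[OF contS val] that by blast
  then show ?thesis using \<open>c \<le> t\<close> by simp
qed

lemma (in brownian_space) progressive_adapted:
  fixes Y :: "real \<Rightarrow> 'w \<Rightarrow> 'b::topological_space"
  assumes "progressively_measurable F Y" "0 \<le> t"
  shows "Y t \<in> borel_measurable (F t)"
proof -
  have *: "(\<lambda>(t, w). Y t w) \<in> borel_measurable (restrict_space borel {0..t} \<Otimes>\<^sub>M F (ereal t))"
    using assms by (simp add: progressively_measurable_def)
  have "(\<lambda>w. (t, w)) \<in> F (ereal t) \<rightarrow>\<^sub>M restrict_space borel {0..t} \<Otimes>\<^sub>M F (ereal t)"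
    by (rule measurable_Pair1') (use assms in \<open>simp add: space_restrict_space\<close>)
  from measurable_compose[OF this *] show ?thesis by simp
qed

text \<open>
  The event \<open>past t\<close> is an \<open>F t\<close>-measurable version of \<open>{\<tau> < t}\<close>. The strict inequality is
  what makes such a version available for an exit time: leaving a closed set before \<open>t\<close> is witnessed
  at a rational time before \<open>t\<close>.
\<close>

locale terminal_time = brownian_space M B
  for M :: "'w measure" and B :: "real \<Rightarrow> 'w \<Rightarrow> real ^ 'd" +
  fixes \<tau> :: "'w \<Rightarrow> ereal" and past :: "real \<Rightarrow> 'w set" and q \<beta> :: real
  assumes q: "0 < q" and \<beta>: "0 < \<beta>"
    and past: "\<And>t. 0 \<le> t \<Longrightarrow> past t \<in> sets (F t)"
    and past_iff: "\<And>t. 0 \<le> t \<Longrightarrow> AE w in M. w \<in> past t \<longleftrightarrow> \<tau> w < ereal t"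
    and \<tau>_finite: "AE w in M. 0 \<le> \<tau> w \<and> \<tau> w < \<infinity>"
begin

definition \<phi> :: "real \<Rightarrow> real" where
  "\<phi> y = y * \<bar>y\<bar> powr q"

lemma continuous_\<phi>: "continuous_on UNIV \<phi>"
  unfolding \<phi>_def using q by (intro continuous_intros continuous_on_powr') auto

lemma \<phi>_mono: "x \<le> y \<Longrightarrow> \<phi> x \<le> \<phi> y"
proof -
  assume xy: "x \<le> y"
  have pos: "\<phi> x \<le> \<phi> y" if "0 \<le> x" "x \<le> y" for x y
    unfolding \<phi>_def using that q by (intro mult_mono powr_mono2) auto
  have neg: "\<phi> (- x) = - \<phi> x" for x by (simp add: \<phi>_def)
  have sgn: "0 \<le> x \<Longrightarrow> 0 \<le> \<phi> x" for x by (simp add: \<phi>_def)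
  show ?thesis
  proof (cases "0 \<le> x")
    case False
    show ?thesis
    proof (cases "0 \<le> y")
      case True
      then show ?thesis using sgn[of y] sgn[of "- x"] neg[of x] False by simp
    next
      case False
      then show ?thesis using pos[of "- y" "- x"] neg xy by simp
    qed
  qed (use pos xy in auto)
qed

lemma \<phi>_nonneg: "0 \<le> x \<Longrightarrow> 0 \<le> \<phi> x"
  by (simp add: \<phi>_def)

definition T0 :: "'w \<Rightarrow> real" where "T0 w = real_of_ereal (\<tau> w)"

lemma T0_eq: "0 \<le> \<tau> w \<and> \<tau> w < \<infinity> \<Longrightarrow> \<tau> w = ereal (T0 w) \<and> 0 \<le> T0 w"
  by (cases "\<tau> w") (auto simp: T0_def)

text \<open>
  The drift is switched off after the terminal time, so that the backward equation holds without
  stopping the time variable.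
\<close>

definition drift :: "(real \<Rightarrow> 'w \<Rightarrow> real) \<Rightarrow> 'w \<Rightarrow> real \<Rightarrow> real" where
  "drift Y w r = indicator {..T0 w} r * \<phi> (Y r w)"

abbreviation tail_mean :: "(real \<Rightarrow> 'w \<Rightarrow> real) \<Rightarrow> nat \<Rightarrow> ennreal" where
  "tail_mean Y n \<equiv> \<integral>\<^sup>+w. ennreal (indicator (space M - past (real n)) w * \<bar>Y (real n) w\<bar>) \<partial>M"

text \<open>
  A solution of the backward equation extended to all times, with continuous paths and integrable
  drift. The last clause, a consequence of the weight \<open>exp (\<beta> t)\<close>, makes the contribution of
  \<open>{t \<le> \<tau>}\<close> negligible for large \<open>t\<close>; it feeds the comparison principle.
\<close>

definition regular_solution :: "(real \<Rightarrow> 'w \<Rightarrow> real) \<Rightarrow> (real \<Rightarrow> 'w \<Rightarrow> real) \<Rightarrow> ('w \<Rightarrow> real) \<Rightarrow> bool" where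
  "regular_solution Y I \<zeta> \<longleftrightarrow>
     L2_martingale I \<and> (\<forall>t\<ge>0. Y t \<in> borel_measurable (F t)) \<and>
     (AE w in M. continuous_on {0..} (\<lambda>t. Y t w)) \<and>
     (AE w in M. \<forall>t\<ge>0. \<tau> w \<le> ereal t \<longrightarrow> Y t w = \<zeta> w) \<and>
     (AE w in M. \<forall>s t. 0 \<le> s \<and> s \<le> t \<longrightarrow> set_integrable lborel {s..t} (drift Y w) \<and>
        Y t w - Y s w = (LINT r:{s..t}|lborel. drift Y w r) + (I t w - I s w)) \<and>
     tail_mean Y \<longlonglongrightarrow> 0"

lemma regular_solutionD:
  assumes "regular_solution Y I \<zeta>"
  shows "L2_martingale I" "\<forall>t\<ge>0. Y t \<in> borel_measurable (F t)"
    "AE w in M. continuous_on {0..} (\<lambda>t. Y t w)"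
    "AE w in M. \<forall>t\<ge>0. \<tau> w \<le> ereal t \<longrightarrow> Y t w = \<zeta> w"
    "AE w in M. \<forall>s t. 0 \<le> s \<and> s \<le> t \<longrightarrow> set_integrable lborel {s..t} (drift Y w) \<and>
        Y t w - Y s w = (LINT r:{s..t}|lborel. drift Y w r) + (I t w - I s w)"
    "tail_mean Y \<longlonglongrightarrow> 0"
  using assms unfolding regular_solution_def by blast+

lemma progressive_path:
  fixes Y :: "real \<Rightarrow> 'w \<Rightarrow> real"
  assumes "progressively_measurable F Y" "0 \<le> T" "w \<in> space M"
  shows "(\<lambda>t. Y t w) \<in> borel_measurable (restrict_space borel {0..T})"
proof -
  have *: "(\<lambda>(t, w). Y t w) \<in> borel_measurable (restrict_space borel {0..T} \<Otimes>\<^sub>M F (ereal T))"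
    using assms by (simp add: progressively_measurable_def)
  have "(\<lambda>t. (t, w)) \<in> restrict_space borel {0..T} \<rightarrow>\<^sub>M restrict_space borel {0..T} \<Otimes>\<^sub>M F (ereal T)"
    by (rule measurable_Pair2') (use assms in simp)
  from measurable_compose[OF this *] show ?thesis by simp
qed

text \<open>
  The local property is applied at rational times; continuity of the path does the rest.
\<close>

lemma ito_integral_stops:
  assumes ito: "ito_integral M B Z I" and Z: "AE w in M. \<forall>t\<ge>0. \<tau> w \<le> ereal t \<longrightarrow> Z t w = 0"
  shows "AE w in M. \<forall>t\<ge>T0 w. I t w = I (T0 w) w"
proof -
  let ?R = "{x\<in>\<rat>. (0::real) \<le> x}"
  have cR: "countable ?R" by (rule countable_subset[OF _ countable_rat]) auto
  have step: "AE w in M. \<tau> w < ereal p \<longrightarrow> p \<le> r \<longrightarrow> I r w = I p w" if "p \<in> ?R" for p r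
  proof (cases "p \<le> r")
    case True
    have p0: "0 \<le> p" using that by simp
    have "AE w in M. w \<in> past p \<longrightarrow> (\<forall>u. p < u \<and> u \<le> r \<longrightarrow> Z u w = 0)"
      using past_iff[OF p0] Z
    proof eventually_elim
      case (elim w)
      show ?case
      proof (intro impI allI)
        fix u assume a: "w \<in> past p" "p < u \<and> u \<le> r"
        then have "\<tau> w < ereal p" using elim by blast
        also have "ereal p \<le> ereal u" using a by simp
        finally show "Z u w = 0" using elim a p0 by (auto intro: less_imp_le)
      qed
    qed
    from ito_integral_local[OF ito p0 True past[OF p0] this] past_iff[OF p0]
    show ?thesis by eventually_elim auto
  qed simp
  have "AE w in M. \<forall>p\<in>?R. \<forall>r\<in>?R. \<tau> w < ereal p \<longrightarrow> p \<le> r \<longrightarrow> I r w = I p w"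
    unfolding AE_ball_countable[OF cR] by (intro ballI step)
  moreover have "AE w in M. continuous_on {0..} (\<lambda>t. I t w)"
    using ito by (simp add: ito_integral_def)
  ultimately show ?thesis using \<tau>_finite
  proof eventually_elim
    case (elim w)
    have \<tau>_eq: "\<tau> w = ereal (T0 w)" and T0: "0 \<le> T0 w"
      using T0_eq[OF elim(3)] by simp_all
    show ?case
    proof (intro allI impI)
      fix t assume "T0 w \<le> t"
      show "I t w = I (T0 w) w"
      proof (rule constant_after[OF elim(2) T0 _ \<open>T0 w \<le> t\<close>])
        fix p r :: real assume "p \<in> \<rat>" "r \<in> \<rat>" "T0 w < p" "p \<le> r"
        then show "I r w = I p w" using elim(1) T0 \<tau>_eq by auto
      qed
    qed
  qed
qed

text \<open>
  The supremum over times need not be a measurable function of \<open>w\<close>, so it is only ever bounded from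
  below by its value at one time.
\<close>

lemma exp_moment_decay:
  fixes Y :: "real \<Rightarrow> 'w \<Rightarrow> real"
  assumes Y: "\<And>t. 0 \<le> t \<Longrightarrow> Y t \<in> borel_measurable (F t)"
    and bound: "(\<integral>\<^sup>+w. ((SUP t\<in>{t. 0 \<le> t \<and> ereal t \<le> \<tau> w}. ennreal (exp (\<beta> * t) * \<bar>Y t w\<bar>\<^sup>2)) + R w) \<partial>M) < \<infinity>"
  shows "tail_mean Y \<longlonglongrightarrow> 0"
proof -
  let ?C = "\<integral>\<^sup>+w. ((SUP t\<in>{t. 0 \<le> t \<and> ereal t \<le> \<tau> w}. ennreal (exp (\<beta> * t) * \<bar>Y t w\<bar>\<^sup>2)) + R w) \<partial>M"
  have le: "tail_mean Y n \<le> ennreal (exp (- (\<beta> / 2) * n)) * (1 + ?C)" for n :: nat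
  proof -
    have [measurable]: "past n \<in> sets M" using sets_F_M[OF past] by simp
    have [measurable]: "Y n \<in> borel_measurable M" using measurable_F_M[OF Y] by simp
    let ?V = "\<lambda>w. indicator (space M - past n) w * (exp (\<beta> * n) * \<bar>Y n w\<bar>\<^sup>2)"
    have V: "(\<integral>\<^sup>+w. ennreal (?V w) \<partial>M) \<le> ?C"
    proof (rule nn_integral_mono_AE)
      have "AE w in M. w \<in> past (real n) \<longleftrightarrow> \<tau> w < ereal (real n)" by (rule past_iff) simp
      then show "AE w in M. ennreal (?V w) \<le>
        (SUP t\<in>{t. 0 \<le> t \<and> ereal t \<le> \<tau> w}. ennreal (exp (\<beta> * t) * \<bar>Y t w\<bar>\<^sup>2)) + R w"
      proof eventually_elim
        case (elim w)
        show ?case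
        proof (cases "w \<in> space M - past n")
          case True
          then have "real n \<in> {t. 0 \<le> t \<and> ereal t \<le> \<tau> w}" using elim by auto
          then have "ennreal (exp (\<beta> * n) * \<bar>Y n w\<bar>\<^sup>2) \<le> (SUP t\<in>{t. 0 \<le> t \<and> ereal t \<le> \<tau> w}. ennreal (exp (\<beta> * t) * \<bar>Y t w\<bar>\<^sup>2))"
            by (rule SUP_upper)
          then show ?thesis using True by (simp add: add_increasing2)
        next
          case False
          then have z: "indicator (space M - past n) w = (0 :: real)" by (rule indicator_simps(2))
          show ?thesis unfolding z by simp
        qed
      qed
    qed
    have "tail_mean Y n
      \<le> (\<integral>\<^sup>+w. ennreal (exp (- (\<beta> / 2) * n)) * (1 + ennreal (?V w)) \<partial>M)"
    proof (rule nn_integral_mono)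
      fix w
      have "indicator (space M - past n) w * \<bar>Y n w\<bar> \<le> exp (- (\<beta> / 2) * n) * (1 + ?V w)"
      proof (cases "w \<in> space M - past n")
        case True
        let ?z = "exp (\<beta> / 2 * n) * \<bar>Y n w\<bar>"
        have "?z \<le> 1 + ?z\<^sup>2"
          using zero_le_power2[of "?z - 1 / 2"] by (simp add: power2_eq_square algebra_simps)
        also have "?z\<^sup>2 = exp (\<beta> * n) * \<bar>Y n w\<bar>\<^sup>2"
          by (simp add: power_mult_distrib exp_of_nat_mult[symmetric] flip: exp_double)
        finally have "exp (- (\<beta> / 2) * n) * ?z \<le> exp (- (\<beta> / 2) * n) * (1 + exp (\<beta> * n) * \<bar>Y n w\<bar>\<^sup>2)"
          by (intro mult_left_mono) auto
        moreover have "exp (- (\<beta> / 2) * n) * exp (\<beta> / 2 * n) = 1" by (simp flip: exp_add)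
        then have "exp (- (\<beta> / 2) * n) * ?z = \<bar>Y n w\<bar>"
          by (simp only: mult.assoc[symmetric] mult_1_left)
        moreover have o: "indicator (space M - past n) w = (1 :: real)" using True by (rule indicator_simps(1))
        ultimately show ?thesis unfolding o mult_1_left by linarith
      next
        case False
        then have z: "indicator (space M - past n) w = (0 :: real)" by (rule indicator_simps(2))
        show ?thesis unfolding z by simp
      qed
      then have "ennreal (indicator (space M - past n) w * \<bar>Y n w\<bar>) \<le> ennreal (exp (- (\<beta> / 2) * n) * (1 + ?V w))"
        by (rule ennreal_leI)
      also have "\<dots> = ennreal (exp (- (\<beta> / 2) * n)) * (1 + ennreal (?V w))"
        by (subst ennreal_mult) (auto simp: ennreal_plus indicator_def)
      finally show "ennreal (indicator (space M - past n) w * \<bar>Y n w\<bar>) \<le> \<dots>" .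
    qed
    also have "\<dots> = ennreal (exp (- (\<beta> / 2) * n)) * (1 + (\<integral>\<^sup>+w. ennreal (?V w) \<partial>M))"
    proof -
      have Vm: "(\<lambda>w. ennreal (?V w)) \<in> borel_measurable M" by measurable
      have "(\<integral>\<^sup>+w. 1 + ennreal (?V w) \<partial>M) = (\<integral>\<^sup>+w. 1 \<partial>M) + (\<integral>\<^sup>+w. ennreal (?V w) \<partial>M)"
        by (rule nn_integral_add[OF _ Vm]) simp
      also have "(\<integral>\<^sup>+w. 1 \<partial>M) = (1 :: ennreal)" by (simp add: emeasure_space_1)
      finally have e: "(\<integral>\<^sup>+w. 1 + ennreal (?V w) \<partial>M) = 1 + (\<integral>\<^sup>+w. ennreal (?V w) \<partial>M)" .
      show ?thesis unfolding e[symmetric]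
        by (rule nn_integral_cmult) (rule borel_measurable_add[OF borel_measurable_const Vm])
    qed
    also have "\<dots> \<le> ennreal (exp (- (\<beta> / 2) * n)) * (1 + ?C)"
      by (intro mult_left_mono add_left_mono V) simp
    finally show ?thesis .
  qed
  have "filterlim (\<lambda>n. - (\<beta> / 2) * real n) at_bot sequentially"
    using \<beta> by (intro filterlim_tendsto_neg_mult_at_bot[OF tendsto_const] filterlim_real_sequentially) auto
  then have "(\<lambda>n. exp (- (\<beta> / 2) * real n)) \<longlonglongrightarrow> 0"
    by (rule filterlim_compose[OF exp_at_bot])
  then have "(\<lambda>n. (1 + ?C) * ennreal (exp (- (\<beta> / 2) * real n))) \<longlonglongrightarrow> (1 + ?C) * ennreal 0"
    using bound by (intro ennreal_tendsto_cmult tendsto_ennrealI) (simp_all add: less_top)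
  then have lim: "(\<lambda>n. ennreal (exp (- (\<beta> / 2) * real n)) * (1 + ?C)) \<longlonglongrightarrow> 0" by (simp add: mult.commute)
  show ?thesis
    by (rule tendsto_sandwich[OF _ _ tendsto_const lim]) (use le in auto)
qed

lemma bsde_regular_solution:
  assumes sol: "bsde_solution M B q \<beta> \<tau> \<zeta> Y Z"
  shows "\<exists>I. regular_solution Y I \<zeta>"
proof -
  have prog: "progressively_measurable F Y"
    and final: "AE w in M. \<forall>t\<ge>0. \<tau> w \<le> ereal t \<longrightarrow> Y t w = \<zeta> w \<and> Z t w = 0"
    using sol unfolding bsde_solution_def by blast+
  obtain I where ito: "ito_integral M B Z I" and
    eq: "AE w in M. \<forall>t T. 0 \<le> t \<and> t \<le> T \<longrightarrow>
           Y (stopped t (\<tau> w)) w = Y (stopped T (\<tau> w)) w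
             - (LINT r:{stopped t (\<tau> w)..stopped T (\<tau> w)}|lborel. Y r w * \<bar>Y r w\<bar> powr q)
             - (I (stopped T (\<tau> w)) w - I (stopped t (\<tau> w)) w)"
    using sol unfolding bsde_solution_def by blast
  note adapted = progressive_adapted[OF prog]
  have I: "L2_martingale I" by (rule ito_integral_L2_martingale[OF ito])
  have Icont: "AE w in M. continuous_on {0..} (\<lambda>t. I t w)" using I unfolding L2_martingale_def by blast
  have "AE w in M. \<forall>t\<ge>0. \<tau> w \<le> ereal t \<longrightarrow> Z t w = 0" using final by eventually_elim blast
  note stops = ito_integral_stops[OF ito this]
  have path: "AE w in M. continuous_on {0..} (\<lambda>t. Y t w) \<and>
    (\<forall>s t. 0 \<le> s \<and> s \<le> t \<longrightarrow> set_integrable lborel {s..t} (drift Y w) \<and>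
        Y t w - Y s w = (LINT r:{s..t}|lborel. drift Y w r) + (I t w - I s w))"
    using final eq Icont stops \<tau>_finite AE_space
  proof eventually_elim
    case (elim w)
    let ?T = "T0 w" and ?y = "\<lambda>t. Y t w" and ?i = "\<lambda>t. I t w"
    have \<tau>_eq: "\<tau> w = ereal ?T" and T: "0 \<le> ?T"
      using T0_eq[OF elim(5)] by simp_all
    have stopped: "stopped t (\<tau> w) = min t ?T" for t
      by (cases "t \<le> ?T") (simp_all add: stopped_def \<tau>_eq min_def)
    have eq': "?y s = ?y t - (LINT r:{s..t}|lborel. \<phi> (?y r)) - (?i t - ?i s)"
      if "0 \<le> s" "s \<le> t" "t \<le> ?T" for s t
      using elim(2)[THEN spec, THEN spec, of s t] that unfolding stopped \<phi>_def by (simp add: min_absorb1)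
    note reg = integral_equation_regular[OF T progressive_path[OF prog T elim(6)] continuous_\<phi>
        continuous_on_subset[OF elim(3)] eq']
    have int: "set_integrable lborel {0..?T} (\<lambda>r. \<phi> (?y r))" and cont: "continuous_on {0..?T} ?y"
      using reg by auto
    have y_after: "?y t = ?y ?T" if "?T \<le> t" for t
      using elim(1) \<tau>_eq T that by (auto dest: spec[of _ t] spec[of _ ?T])
    have i_after: "?i t = ?i ?T" if "?T \<le> t" for t using elim(4) that by blast
    have "continuous_on {0..} (\<lambda>t. ?y (min t ?T))"
      by (rule continuous_on_compose2[OF cont]) (use T in \<open>auto intro!: continuous_intros\<close>)
    moreover have "?y (min t ?T) = ?y t" for t
      using y_after[of t] by (auto simp: min_def)
    ultimately have contY: "continuous_on {0..} ?y" by simp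
    have intD: "set_integrable lborel {s..t} (drift Y w)" if "0 \<le> s" for s t
    proof -
      have "set_integrable lborel ({s..t} \<inter> {..?T}) (\<lambda>r. \<phi> (?y r))"
        by (rule set_integrable_subset[OF int]) (use that in auto)
      moreover have "indicator ({s..t} \<inter> {..?T}) r *\<^sub>R \<phi> (?y r) = indicator {s..t} r *\<^sub>R drift Y w r" for r
        by (auto simp: drift_def indicator_def)
      ultimately show ?thesis unfolding set_integrable_def by simp
    qed
    have eqD: "?y t - ?y s = (LINT r:{s..t}|lborel. drift Y w r) + (?i t - ?i s)"
      if st: "0 \<le> s" "s \<le> t" for s t
    proof (cases "s \<le> ?T")
      case True
      have "indicator {s..min t ?T} r *\<^sub>R \<phi> (?y r) = indicator {s..t} r *\<^sub>R drift Y w r" for r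
        by (auto simp: drift_def indicator_def)
      then have "(LINT r:{s..min t ?T}|lborel. \<phi> (?y r)) = (LINT r:{s..t}|lborel. drift Y w r)"
        unfolding set_lebesgue_integral_def by simp
      moreover have "?y (min t ?T) = ?y t" "?i (min t ?T) = ?i t"
        using y_after[of t] i_after[of t] by (auto simp: min_def)
      ultimately show ?thesis using eq'[of s "min t ?T"] st True by simp
    next
      case False
      then have "indicator {s..t} r *\<^sub>R drift Y w r = 0" for r
        by (auto simp: drift_def indicator_def)
      then have "(LINT r:{s..t}|lborel. drift Y w r) = 0"
        unfolding set_lebesgue_integral_def by (simp only: Bochner_Integration.integral_zero)
      then show ?thesis
        using y_after[of s] y_after[of t] i_after[of s] i_after[of t] False st by simp
    qed
    show ?case using contY intD eqD by blast
  qed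
  have decay: "tail_mean Y \<longlonglongrightarrow> 0"
    by (rule exp_moment_decay[OF adapted sol[unfolded bsde_solution_def, THEN conjunct2, THEN conjunct2,
          THEN conjunct2, THEN conjunct2]])
  have "regular_solution Y I \<zeta>"
    unfolding regular_solution_def
  proof (intro conjI)
    show "AE w in M. continuous_on {0..} (\<lambda>t. Y t w)" using path by eventually_elim blast
    show "AE w in M. \<forall>t\<ge>0. \<tau> w \<le> ereal t \<longrightarrow> Y t w = \<zeta> w" using final by eventually_elim blast
    show "AE w in M. \<forall>s t. 0 \<le> s \<and> s \<le> t \<longrightarrow> set_integrable lborel {s..t} (drift Y w) \<and>
        Y t w - Y s w = (LINT r:{s..t}|lborel. drift Y w r) + (I t w - I s w)"
      using path by eventually_elim blast
  qed (use I adapted decay in auto)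
  then show ?thesis by blast
qed

text \<open>
  As \<open>\<phi>\<close> is increasing, the drift of \<open>Y - Y'\<close> is nonnegative where \<open>Y \<ge> Y'\<close>.
\<close>

lemma regular_solution_le:
  assumes Y: "regular_solution Y I \<zeta>" and Y': "regular_solution Y' I' \<zeta>'"
    and le: "AE w in M. \<zeta> w \<le> \<zeta>' w"
  shows "AE w in M. \<forall>t\<ge>0. Y t w \<le> Y' t w"
proof -
  note D = regular_solutionD[OF Y]
  note I = D(1,2) and cont = D(3) and final = D(4) and eq = D(5) and decay = D(6)
  note D' = regular_solutionD[OF Y']
  note I' = D'(1,2) and cont' = D'(3) and final' = D'(4) and eq' = D'(5) and decay' = D'(6)
  let ?U = "\<lambda>t w. Y t w - Y' t w"
  have "AE w in M. \<forall>t\<ge>0. ?U t w \<le> 0"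
  proof (rule comparison[OF L2_martingale_diff[OF I(1) I'(1)]])
    show "?U t \<in> borel_measurable (F t)" if "0 \<le> t" for t
      by (intro borel_measurable_diff I(2)[rule_format] I'(2)[rule_format] that)
    show "AE w in M. continuous_on {0..} (\<lambda>t. ?U t w)"
      using cont cont' by eventually_elim (rule continuous_on_diff)
    show "AE w in M. \<forall>s t. 0 \<le> s \<and> s \<le> t \<and> (\<forall>r\<in>{s..t}. 0 \<le> ?U r w) \<longrightarrow>
      (I t w - I' t w) - (I s w - I' s w) \<le> ?U t w - ?U s w"
      using eq eq'
    proof eventually_elim
      case (elim w)
      show ?case
      proof (intro allI impI)
        fix s t :: real assume st: "0 \<le> s \<and> s \<le> t \<and> (\<forall>r\<in>{s..t}. 0 \<le> ?U r w)"
        have "(LINT r:{s..t}|lborel. drift Y' w r) \<le> (LINT r:{s..t}|lborel. drift Y w r)"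
        proof (rule set_integral_mono)
          show "drift Y' w r \<le> drift Y w r" if "r \<in> {s..t}" for r
            unfolding drift_def using st that by (intro mult_left_mono \<phi>_mono) auto
        qed (use elim st in auto)
        moreover have "Y t w - Y s w = (LINT r:{s..t}|lborel. drift Y w r) + (I t w - I s w)"
          "Y' t w - Y' s w = (LINT r:{s..t}|lborel. drift Y' w r) + (I' t w - I' s w)"
          using elim st by blast+
        ultimately show "(I t w - I' t w) - (I s w - I' s w) \<le> ?U t w - ?U s w" by linarith
      qed
    qed
    show "(\<lambda>n. \<integral>\<^sup>+w. ennreal (?U (real n) w) \<partial>M) \<longlonglongrightarrow> 0"
    proof (rule tendsto_sandwich[OF _ _ tendsto_const])
      let ?a = "\<lambda>n w. ennreal (indicator (space M - past n) w * \<bar>Y n w\<bar>)"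
      let ?b = "\<lambda>n w. ennreal (indicator (space M - past n) w * \<bar>Y' n w\<bar>)"
      show "(\<lambda>n::nat. (\<integral>\<^sup>+w. ?a n w \<partial>M) + (\<integral>\<^sup>+w. ?b n w \<partial>M)) \<longlonglongrightarrow> 0"
        using tendsto_add[OF decay decay'] by simp
      have "(\<integral>\<^sup>+w. ennreal (?U (real n) w) \<partial>M) \<le> (\<integral>\<^sup>+w. ?a n w \<partial>M) + (\<integral>\<^sup>+w. ?b n w \<partial>M)" for n :: nat
      proof -
        have [measurable]: "past n \<in> sets M" using sets_F_M[OF past] by simp
        have [measurable]: "Y n \<in> borel_measurable M" "Y' n \<in> borel_measurable M"
          using measurable_F_M I(2) I'(2) of_nat_0_le_iff by blast+
        have "(\<integral>\<^sup>+w. ennreal (?U (real n) w) \<partial>M) \<le> (\<integral>\<^sup>+w. ?a n w + ?b n w \<partial>M)"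
        proof (rule nn_integral_mono_AE)
          have "AE w in M. w \<in> past (real n) \<longleftrightarrow> \<tau> w < ereal (real n)" by (rule past_iff) simp
          with final final' le AE_space
          show "AE w in M. ennreal (?U (real n) w) \<le> ?a n w + ?b n w"
          proof eventually_elim
            case (elim w)
            show ?case
            proof (cases "w \<in> past (real n)")
              case True
              then have "\<tau> w \<le> ereal (real n)" using elim by auto
              then have "?U (real n) w \<le> 0" using elim by simp
              then show ?thesis by (simp add: ennreal_neg)
            next
              case False
              have "ennreal (?U (real n) w) \<le> ennreal (\<bar>Y n w\<bar> + \<bar>Y' n w\<bar>)" by (intro ennreal_leI) simp
              then show ?thesis using False elim by (simp add: ennreal_plus)
            qed
          qed
        qed
        also have "\<dots> = (\<integral>\<^sup>+w. ?a n w \<partial>M) + (\<integral>\<^sup>+w. ?b n w \<partial>M)" by (rule nn_integral_add) measurable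
        finally show ?thesis .
      qed
      then show "\<forall>\<^sub>F n in sequentially. (\<integral>\<^sup>+w. ennreal (?U (real n) w) \<partial>M) \<le> (\<integral>\<^sup>+w. ?a n w \<partial>M) + (\<integral>\<^sup>+w. ?b n w \<partial>M)"
        by simp
    qed simp
  qed
  then show ?thesis by eventually_elim auto
qed

lemma regular_solution_zero: "regular_solution (\<lambda>_ _. 0) (\<lambda>_ _. 0) (\<lambda>_. 0)"
  unfolding regular_solution_def L2_martingale_def
  by (simp add: null_mean_on_zero drift_def \<phi>_def set_integrable_def set_lebesgue_integral_def)

lemma regular_solution_bounded:
  assumes Y: "regular_solution Y I \<zeta>" and le: "AE w in M. \<zeta> w \<le> c" and c: "0 \<le> c"
  shows "AE w in M. \<forall>t\<ge>0. Y t w \<le> c"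
proof -
  note D = regular_solutionD[OF Y]
  note I = D(1,2) and cont = D(3) and final = D(4) and eq = D(5) and decay = D(6)
  let ?U = "\<lambda>t w. Y t w - c"
  have "AE w in M. \<forall>t\<ge>0. ?U t w \<le> 0"
  proof (rule comparison[OF I(1)])
    show "?U t \<in> borel_measurable (F t)" if "0 \<le> t" for t
      by (intro borel_measurable_diff I(2)[rule_format] that borel_measurable_const)
    show "AE w in M. continuous_on {0..} (\<lambda>t. ?U t w)"
      using cont by eventually_elim (intro continuous_intros)
    show "AE w in M. \<forall>s t. 0 \<le> s \<and> s \<le> t \<and> (\<forall>r\<in>{s..t}. 0 \<le> ?U r w) \<longrightarrow>
      I t w - I s w \<le> ?U t w - ?U s w"
      using eq
    proof eventually_elim
      case (elim w)
      show ?case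
      proof (intro allI impI)
        fix s t :: real assume st: "0 \<le> s \<and> s \<le> t \<and> (\<forall>r\<in>{s..t}. 0 \<le> ?U r w)"
        have "0 \<le> drift Y w r" if "r \<in> {s..t}" for r
        proof -
          have "0 \<le> ?U r w" using st that by blast
          then have "0 \<le> Y r w" using c by linarith
          then show ?thesis unfolding drift_def by (intro mult_nonneg_nonneg \<phi>_nonneg) auto
        qed
        then have "0 \<le> (LINT r:{s..t}|lborel. drift Y w r)"
          unfolding set_lebesgue_integral_def by (intro integral_nonneg_AE) (auto simp: indicator_def)
        moreover have "Y t w - Y s w = (LINT r:{s..t}|lborel. drift Y w r) + (I t w - I s w)"
          using elim st by blast
        ultimately show "I t w - I s w \<le> ?U t w - ?U s w" by linarith
      qed
    qed
    show "(\<lambda>n. \<integral>\<^sup>+w. ennreal (?U (real n) w) \<partial>M) \<longlonglongrightarrow> 0"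
    proof (rule tendsto_sandwich[OF _ _ tendsto_const decay])
      have "(\<integral>\<^sup>+w. ennreal (?U (real n) w) \<partial>M) \<le> tail_mean Y n" for n :: nat
      proof (rule nn_integral_mono_AE)
        have "AE w in M. w \<in> past (real n) \<longleftrightarrow> \<tau> w < ereal (real n)" by (rule past_iff) simp
        with final le AE_space
        show "AE w in M. ennreal (?U (real n) w) \<le> ennreal (indicator (space M - past n) w * \<bar>Y n w\<bar>)"
        proof eventually_elim
          case (elim w)
          show ?case
          proof (cases "w \<in> past (real n)")
            case True
            then have "\<tau> w \<le> ereal (real n)" using elim by auto
            then have "?U (real n) w \<le> 0" using elim by simp
            then show ?thesis by (simp add: ennreal_neg)
          next
            case False
            then show ?thesis using elim c by (intro ennreal_leI) simp
          qed
        qed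
      qed
      then show "\<forall>\<^sub>F n in sequentially. (\<integral>\<^sup>+w. ennreal (?U (real n) w) \<partial>M) \<le>
          tail_mean Y n"
        by simp
    qed simp
  qed
  then show ?thesis by eventually_elim auto
qed

end

section \<open>Upcrossings\<close>

text \<open>
  The strategy of Doob's upcrossing inequality: buy below \<open>a\<close>, sell above \<open>b\<close>.
\<close>

fun holding :: "real \<Rightarrow> real \<Rightarrow> (nat \<Rightarrow> real) \<Rightarrow> nat \<Rightarrow> bool" where
  "holding a b x 0 \<longleftrightarrow> x 0 < a"
| "holding a b x (Suc i) \<longleftrightarrow> (if holding a b x i then x (Suc i) \<le> b else x (Suc i) < a)"

fun upcrossings :: "real \<Rightarrow> real \<Rightarrow> (nat \<Rightarrow> real) \<Rightarrow> nat \<Rightarrow> nat" where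
  "upcrossings a b x 0 = 0"
| "upcrossings a b x (Suc i) = upcrossings a b x i + of_bool (holding a b x i \<and> b < x (Suc i))"

lemma upcrossings_le: "upcrossings a b x i \<le> i"
  by (induction i) (auto simp: of_bool_def)

lemma upcrossings_mono: "i \<le> j \<Longrightarrow> upcrossings a b x i \<le> upcrossings a b x j"
  by (induction j) (auto simp: le_Suc_eq)

text \<open>
  Every completed upcrossing earns \<open>f b - f a\<close>; the second term on the left is the running gain or
  loss of an open position.
\<close>

lemma upcrossings_gain:
  fixes f :: "real \<Rightarrow> real"
  assumes ab: "a < b" and f: "\<And>y z. 0 \<le> y \<Longrightarrow> y \<le> z \<Longrightarrow> f y \<le> f z" and a: "0 \<le> a" and x: "\<And>i. 0 \<le> x i"
  shows "(f b - f a) * real (upcrossings a b x n) + of_bool (holding a b x n) * (f (x n) - f a)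
    \<le> (\<Sum>i<n. of_bool (holding a b x i) * (f (x (Suc i)) - f (x i)))"
proof (induction n)
  case 0
  then show ?case using f[OF x, of 0 a] by simp
next
  case (Suc n)
  show ?case
  proof (cases "holding a b x n")
    case True
    show ?thesis
    proof (cases "b < x (Suc n)")
      case True
      then have "f b \<le> f (x (Suc n))" using f[of b "x (Suc n)"] ab a by simp
      then show ?thesis using Suc \<open>holding a b x n\<close> True by (simp add: algebra_simps)
    next
      case False
      then show ?thesis using Suc \<open>holding a b x n\<close> by (simp add: algebra_simps)
    qed
  next
    case False
    then show ?thesis using Suc f[OF x, of "Suc n" a] by (auto simp: of_bool_def)
  qed
qed

lemma holding_below:
  assumes "a < b" "x i < a"
  shows "holding a b x i"
  using assms by (cases i) auto

lemma upcrossings_increase: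
  assumes "holding a b x i" "i \<le> j" "b < x j" "x i < b"
  shows "Suc (upcrossings a b x i) \<le> upcrossings a b x j"
proof -
  have "(holding a b x j \<and> x j \<le> b) \<or> Suc (upcrossings a b x i) \<le> upcrossings a b x j"
    using assms(2)
  proof (induction j rule: dec_induct)
    case (step n)
    then show ?case using upcrossings_mono[of i n a b x] by (auto simp: of_bool_def)
  qed (use assms in auto)
  then show ?thesis using assms(3) by auto
qed

lemma upcrossings_ge:
  assumes ab: "a < b" and t: "\<And>m n. m \<le> n \<Longrightarrow> t m \<le> (t n :: nat)"
    and low: "\<And>m. m < k \<Longrightarrow> x (t (2 * m)) < a" and high: "\<And>m. m < k \<Longrightarrow> b < x (t (2 * m + 1))"
    and N: "\<And>m. m < 2 * k \<Longrightarrow> t m \<le> N"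
  shows "k \<le> upcrossings a b x N"
proof -
  have all: "Suc m \<le> upcrossings a b x (t (2 * m + 1))" if "m < k" for m
    using that
  proof (induction m)
    case 0
    have "Suc (upcrossings a b x (t 0)) \<le> upcrossings a b x (t 1)"
      using low[of 0] high[of 0] 0 ab t[of 0 1] by (intro upcrossings_increase holding_below) auto
    then show ?case by simp
  next
    case (Suc m)
    have "Suc m \<le> upcrossings a b x (t (2 * m + 1))" using Suc by simp
    also have "\<dots> \<le> upcrossings a b x (t (2 * Suc m))"
      by (intro upcrossings_mono t) simp
    also have "Suc \<dots> \<le> upcrossings a b x (t (2 * Suc m + 1))"
      using low[of "Suc m"] high[of "Suc m"] Suc.prems ab t[of "2 * Suc m" "2 * Suc m + 1"]
      by (intro upcrossings_increase holding_below) auto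
    finally show ?case by simp
  qed
  show ?thesis
  proof (cases k)
    case (Suc k')
    have "Suc k' \<le> upcrossings a b x (t (2 * k' + 1))" by (rule all) (simp add: Suc)
    also have "\<dots> \<le> upcrossings a b x N" using N[of "2 * k' + 1"] Suc by (intro upcrossings_mono) auto
    finally show ?thesis using Suc by simp
  qed simp
qed

context terminal_time
begin

text \<open>
  The change of scale that makes the solutions supermartingales up to a bounded drift.
\<close>

definition scale :: "real \<Rightarrow> real" where "scale y = - ((1 + y) powr - q)"

definition scale_deriv :: "real \<Rightarrow> real" where "scale_deriv y = q * (1 + y) powr (- q - 1)"

lemma scale_tangent:
  assumes "0 \<le> x" "0 \<le> y"
  shows "scale y - scale x \<le> scale_deriv x * (y - x)"
proof -
  let ?h = "\<lambda>y::real. (1 + y) powr - q"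
  let ?h' = "\<lambda>y::real. - q * (1 + y) powr (- q - 1)"
  have d: "((\<lambda>y. (1 + y) powr r) has_real_derivative r * (1 + z) powr (r - 1)) (at z)"
    if "z \<in> {-1<..}" for r z :: real
  proof -
    have "((\<lambda>y. (1 + y) powr r) has_real_derivative r * (1 + z) powr (r - 1) * 1) (at z)"
    proof (rule DERIV_chain2[where g="\<lambda>y. 1 + y" and f="\<lambda>w. w powr r"])
      show "((\<lambda>w. w powr r) has_real_derivative r * (1 + z) powr (r - 1)) (at (1 + z))"
        by (rule has_real_derivative_powr) (use that in auto)
      show "((\<lambda>y. 1 + y) has_real_derivative 1) (at z)" by (auto intro!: derivative_eq_intros)
    qed
    then show ?thesis by simp
  qed
  have d1: "(?h has_real_derivative ?h' z) (at z)" if "z \<in> {-1<..}" for z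
    by (rule d[OF that])
  have d2: "(?h' has_real_derivative (- q) * ((- q - 1) * (1 + z) powr (- q - 1 - 1))) (at z)" if "z \<in> {-1<..}" for z
    by (rule DERIV_cmult[OF d[OF that]])
  have "convex_on {-1<..} ?h"
  proof (rule f''_ge0_imp_convex[OF _ d1 d2])
    show "0 \<le> (- q) * ((- q - 1) * (1 + z) powr (- q - 1 - 1))" for z
    proof -
      have "(- q) * ((- q - 1) * (1 + z) powr (- q - 1 - 1)) = q * ((q + 1) * (1 + z) powr (- q - 1 - 1))"
        by (simp add: algebra_simps)
      then show ?thesis using q by simp
    qed
  qed (auto simp: convex_real_interval)
  moreover have "x \<in> interior {-1<..}" using assms by (simp add: interior_open)
  moreover have "(?h has_real_derivative ?h' x) (at x within {-1<..})"
    using d1[of x] assms by (auto intro: has_field_derivative_at_within)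
  ultimately have "?h' x * (y - x) \<le> ?h y - ?h x"
    using assms by (intro convex_on_imp_above_tangent[of "{-1<..}"]) auto
  then show ?thesis by (simp add: scale_def scale_deriv_def)
qed

lemma scale_strict_mono: "0 \<le> x \<Longrightarrow> x < y \<Longrightarrow> scale x < scale y"
  unfolding scale_def using q by (simp add: powr_less_mono2_neg)

lemma scale_mono: "0 \<le> x \<Longrightarrow> x \<le> y \<Longrightarrow> scale x \<le> scale y"
  using scale_strict_mono[of x y] by (cases "x = y") auto

lemma scale_range:
  assumes "0 \<le> x"
  shows "- 1 \<le> scale x" "scale x \<le> 0"
proof -
  have "scale 0 \<le> scale x" by (rule scale_mono) (use assms in auto)
  then show "- 1 \<le> scale x" by (simp add: scale_def)
  show "scale x \<le> 0" by (simp add: scale_def)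
qed

lemma scale_deriv_range:
  assumes "0 \<le> x"
  shows "0 \<le> scale_deriv x" "scale_deriv x \<le> q"
proof -
  have "(1 + x) powr (- q - 1) \<le> 1"
    using powr_mono2'[of "- q - 1" 1 "1 + x"] assms q by simp
  then show "scale_deriv x \<le> q" using q by (simp add: scale_deriv_def)
  show "0 \<le> scale_deriv x" using q by (simp add: scale_deriv_def)
qed

lemma scale_deriv_continuous: "continuous_on {0..} scale_deriv"
  unfolding scale_deriv_def by (intro continuous_intros) auto

lemma scale_deriv_\<phi>:
  assumes "0 \<le> y"
  shows "scale_deriv y * \<phi> y \<le> q"
proof -
  have "\<phi> y \<le> (1 + y) powr (q + 1)"
  proof (cases "y = 0")
    case False
    then have "\<phi> y = y powr (q + 1)" using assms by (simp add: \<phi>_def powr_add)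
    also have "\<dots> \<le> (1 + y) powr (q + 1)" using assms q by (intro powr_mono2) auto
    finally show ?thesis .
  qed (simp add: \<phi>_def)
  then have "scale_deriv y * \<phi> y \<le> (q * (1 + y) powr (- q - 1)) * (1 + y) powr (q + 1)"
    unfolding scale_deriv_def using q by (intro mult_left_mono) auto
  also have "\<dots> = q * (1 + y) powr (- q - 1 + (q + 1))" by (simp only: powr_add mult.assoc)
  also have "\<dots> = q" using assms by simp
  finally show ?thesis .
qed

text \<open>
  The drift that the upcrossing strategy collects along a grid. The second bound depends on \<open>c\<close> and
  only serves as a dominating constant. The last bound, which does not depend on \<open>c\<close>, holds for fine grids
  because \<open>scale_deriv (y s) * \<phi> (y r)\<close> is close to the value at \<open>s = r\<close>, which is at most \<open>q\<close>.
\<close>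

lemma drift_sum_bounds:
  assumes T: "0 < T" and cont: "continuous_on {0..} y" and y: "\<And>t. 0 \<le> t \<Longrightarrow> 0 \<le> y t \<and> y t \<le> c"
    and d: "\<And>r. 0 \<le> r \<Longrightarrow> 0 \<le> d r \<and> d r \<le> \<phi> (y r)" and int: "\<And>s t. 0 \<le> s \<Longrightarrow> s \<le> t \<Longrightarrow> set_integrable lborel {s..t} d"
    and h: "\<And>m j. 0 \<le> h m j \<and> h m j \<le> scale_deriv (y (grid 0 T m j))"
  defines "D \<equiv> \<lambda>m. \<Sum>j<Suc m. h m j * (LINT r:{grid 0 T m j..grid 0 T m (Suc j)}|lborel. d r)"
  shows "0 \<le> D m" "D m \<le> q * \<phi> c * T" "eventually (\<lambda>m. D m \<le> (q + 1) * T) sequentially"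
proof -
  let ?g = "grid 0 T"
  have g0: "0 \<le> ?g m j" and gm: "?g m j \<le> ?g m (Suc j)" for m j
    using T grid_mono[of 0 T j "Suc j" m] by (auto simp: grid_def)
  have gd: "?g m (Suc j) - ?g m j = T / real (Suc m)" for m j
    by (simp add: grid_def algebra_simps add_divide_distrib)
  have \<phi>c: "\<phi> (y r) \<le> \<phi> c" "0 \<le> \<phi> (y r)" if "0 \<le> r" for r
    using y[OF that] \<phi>_mono \<phi>_nonneg by auto
  have pos: "0 \<le> (LINT r:{?g m j..?g m (Suc j)}|lborel. d r)" for m j
    unfolding set_lebesgue_integral_def using d g0[of m j] by (intro integral_nonneg_AE) (auto simp: indicator_def)
  show "0 \<le> D m" unfolding D_def using pos h by (intro sum_nonneg mult_nonneg_nonneg) auto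
  have key: "D m \<le> K * T"
    if K: "\<And>j r. j < Suc m \<Longrightarrow> r \<in> {?g m j..?g m (Suc j)} \<Longrightarrow> scale_deriv (y (?g m j)) * \<phi> (y r) \<le> K" for m K
  proof -
    have "h m j * (LINT r:{?g m j..?g m (Suc j)}|lborel. d r) \<le> K * (T / real (Suc m))" if j: "j < Suc m" for j
    proof -
      have "h m j * (LINT r:{?g m j..?g m (Suc j)}|lborel. d r) = (LINT r:{?g m j..?g m (Suc j)}|lborel. h m j * d r)"
        by simp
      also have "\<dots> \<le> (LINT r:{?g m j..?g m (Suc j)}|lborel. K)"
      proof (rule set_integral_mono)
        show "set_integrable lborel {?g m j..?g m (Suc j)} (\<lambda>r. h m j * d r)"
          using int[OF g0 gm] by simp
        show "set_integrable lborel {?g m j..?g m (Suc j)} (\<lambda>r. K)"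
          by (rule borel_integrable_atLeastAtMost') simp
        fix r assume r: "r \<in> {?g m j..?g m (Suc j)}"
        then have "0 \<le> r" using g0[of m j] by simp
        then have "h m j * d r \<le> scale_deriv (y (?g m j)) * \<phi> (y r)"
          using h[of m j] d[of r] by (intro mult_mono) auto
        also have "\<dots> \<le> K" by (rule K[OF j r])
        finally show "h m j * d r \<le> K" .
      qed
      also have "\<dots> = K * (?g m (Suc j) - ?g m j)"
        using gm[of m j] by (simp add: set_lebesgue_integral_def)
      finally show ?thesis unfolding gd .
    qed
    then have "D m \<le> (\<Sum>j<Suc m. K * (T / real (Suc m)))"
      unfolding D_def by (intro sum_mono) auto
    also have "\<dots> = K * T" by simp
    finally show ?thesis .
  qed
  show "D m \<le> q * \<phi> c * T"
  proof (rule key)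
    fix j r assume r: "r \<in> {?g m j..?g m (Suc j)}"
    then have "0 \<le> r" using g0[of m j] by simp
    then show "scale_deriv (y (?g m j)) * \<phi> (y r) \<le> q * \<phi> c"
      using scale_deriv_range[of "y (?g m j)"] y[OF g0[of m j]] \<phi>c[of r] q by (intro mult_mono) auto
  qed
  have "0 \<le> \<phi> c" using \<phi>c[of 0] by simp
  \<comment> \<open>A modulus of continuity small enough for the error \<open>e * \<phi> c\<close> to stay below one.\<close>
  define e where "e = 1 / (\<phi> c + 1)"
  have e: "0 < e" "e * \<phi> c \<le> 1" using \<open>0 \<le> \<phi> c\<close> by (auto simp: e_def field_simps)
  have "continuous_on {0..T} (\<lambda>t. scale_deriv (y t))"
  proof (rule continuous_on_compose2[OF scale_deriv_continuous])
    show "continuous_on {0..T} y" by (rule continuous_on_subset[OF cont]) auto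
    show "y ` {0..T} \<subseteq> {0..}"
    proof (rule image_subsetI)
      fix t assume "t \<in> {0..T}"
      then show "y t \<in> {0..}" using y[of t] by simp
    qed
  qed
  then have "uniformly_continuous_on {0..T} (\<lambda>t. scale_deriv (y t))"
    by (rule compact_uniformly_continuous) simp
  from this[unfolded uniformly_continuous_on_def, THEN spec, THEN mp, OF e(1)]
  obtain \<delta> where \<delta>: "0 < \<delta>" "\<forall>r\<in>{0..T}. \<forall>s\<in>{0..T}. dist s r < \<delta> \<longrightarrow>
      dist (scale_deriv (y s)) (scale_deriv (y r)) < e"
    by (elim exE conjE)
  have "(\<lambda>m. T / real (Suc m)) \<longlonglongrightarrow> 0"
    using LIMSEQ_Suc[OF lim_const_over_n[of T]] by simp
  then have "eventually (\<lambda>m. T / real (Suc m) < \<delta>) sequentially"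
    using \<delta>(1) by (rule order_tendstoD)
  then show "eventually (\<lambda>m. D m \<le> (q + 1) * T) sequentially"
  proof eventually_elim
    case (elim m)
    show ?case
    proof (rule key)
      fix j r assume j: "j < Suc m" and r: "r \<in> {?g m j..?g m (Suc j)}"
      have gj: "?g m j \<in> {0..T}" by (rule grid_in) (use j T in auto)
      have gj': "?g m (Suc j) \<in> {0..T}" by (rule grid_in) (use j T in auto)
      have r0: "r \<in> {0..T}" using r gj gj' by auto
      have "dist (?g m j) r < \<delta>" using r gd[of m j] elim by (auto simp: dist_real_def)
      then have "dist (scale_deriv (y (?g m j))) (scale_deriv (y r)) < e" by (rule \<delta>(2)[THEN bspec, THEN bspec, THEN mp, OF r0 gj])
      then have "scale_deriv (y (?g m j)) \<le> scale_deriv (y r) + e" by (simp add: dist_real_def)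
      then have "scale_deriv (y (?g m j)) * \<phi> (y r) \<le> (scale_deriv (y r) + e) * \<phi> (y r)"
        using \<phi>c[of r] r0 by (intro mult_right_mono) auto
      also have "\<dots> = scale_deriv (y r) * \<phi> (y r) + e * \<phi> (y r)" by (simp add: algebra_simps)
      also have "\<dots> \<le> q + e * \<phi> c"
        using \<phi>c[of r] y[of r] r0 e by (intro add_mono scale_deriv_\<phi> mult_left_mono) auto
      also have "\<dots> \<le> q + 1" using e by simp
      finally show "scale_deriv (y (?g m j)) * \<phi> (y r) \<le> q + 1" .
    qed
  qed
qed

lemma holding_event:
  fixes Y :: "real \<Rightarrow> 'w \<Rightarrow> real" and g :: "nat \<Rightarrow> real"
  assumes Y: "\<And>t. 0 \<le> t \<Longrightarrow> Y t \<in> borel_measurable (F t)" and g: "0 \<le> g 0" "\<And>i j. i \<le> j \<Longrightarrow> g i \<le> g j"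
  shows "{w\<in>space M. holding a b (\<lambda>j. Y (g j) w) i} \<in> sets (F (g i))"
proof (induction i)
  case 0
  have [measurable]: "Y (g 0) \<in> borel_measurable (F (g 0))" by (rule Y[OF g(1)])
  have "{w\<in>space (F (g 0)). Y (g 0) w < a} \<in> sets (F (g 0))" by measurable
  then show ?case by simp
next
  case (Suc i)
  have "0 \<le> g (Suc i)" using g(1) g(2)[of 0 "Suc i"] by simp
  then have [measurable]: "Y (g (Suc i)) \<in> borel_measurable (F (g (Suc i)))" by (rule Y)
  have [measurable]: "{w\<in>space M. holding a b (\<lambda>j. Y (g j) w) i} \<in> sets (F (g (Suc i)))"
    using Suc sets_F_mono[of "g i" "g (Suc i)"] g(2)[of i "Suc i"] by auto
  have "{w\<in>space (F (g (Suc i))). Y (g (Suc i)) w \<le> b} \<in> sets (F (g (Suc i)))"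
    "{w\<in>space (F (g (Suc i))). Y (g (Suc i)) w < a} \<in> sets (F (g (Suc i)))" by measurable
  moreover have "{w\<in>space M. holding a b (\<lambda>j. Y (g j) w) (Suc i)} =
    ({w\<in>space M. holding a b (\<lambda>j. Y (g j) w) i} \<inter> {w\<in>space M. Y (g (Suc i)) w \<le> b}) \<union>
    ({w\<in>space M. Y (g (Suc i)) w < a} - {w\<in>space M. holding a b (\<lambda>j. Y (g j) w) i})"
    by auto
  ultimately show ?case by auto
qed

lemma upcrossings_measurable:
  fixes Y :: "real \<Rightarrow> 'w \<Rightarrow> real" and g :: "nat \<Rightarrow> real"
  assumes Y: "\<And>t. 0 \<le> t \<Longrightarrow> Y t \<in> borel_measurable (F t)" and g: "0 \<le> g 0" "\<And>i j. i \<le> j \<Longrightarrow> g i \<le> g j"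
  shows "(\<lambda>w. real (upcrossings a b (\<lambda>j. Y (g j) w) i)) \<in> borel_measurable M"
proof (induction i)
  case (Suc i)
  have "0 \<le> g (Suc i)" using g(1) g(2)[of 0 "Suc i"] by simp
  then have [measurable]: "Y (g (Suc i)) \<in> borel_measurable M" using measurable_F_M[OF Y] by simp
  have H: "{w\<in>space M. holding a b (\<lambda>j. Y (g j) w) i} \<in> sets M"
    by (rule sets_F_M[OF holding_event[where Y=Y and g=g, OF Y g]])
  have "{w\<in>space M. b < Y (g (Suc i)) w} \<in> sets M" by measurable
  then have S: "{w\<in>space M. holding a b (\<lambda>j. Y (g j) w) i} \<inter> {w\<in>space M. b < Y (g (Suc i)) w} \<in> sets M" (is "?S \<in> _")
    using H by blast
  have "(\<lambda>w. real (upcrossings a b (\<lambda>j. Y (g j) w) i) + indicator ?S w) \<in> borel_measurable M"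
    using Suc S by (intro borel_measurable_add borel_measurable_indicator)
  moreover have "real (upcrossings a b (\<lambda>j. Y (g j) w) (Suc i)) = real (upcrossings a b (\<lambda>j. Y (g j) w) i) + indicator ?S w"
    if "w \<in> space M" for w using that by (simp add: indicator_def)
  ultimately show ?case by (subst measurable_cong) auto
qed simp

text \<open>
  The gain of the strategy is at most a martingale transform \<open>N\<close> of mean zero plus the drift sum
  \<open>P - N\<close>. The excess \<open>W\<close> of the drift sum over its asymptotic bound tends to zero dominatedly as the grids
  become finer. The resulting bound does not depend on \<open>c\<close>, hence is uniform over the truncations.
\<close>

lemma expected_upcrossings:
  assumes Y: "regular_solution Y I \<zeta>" and bounds: "AE w in M. \<forall>t\<ge>0. 0 \<le> Y t w \<and> Y t w \<le> c"
    and T: "0 < T" and ab: "0 \<le> a" "a < b"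
  shows "(\<integral>\<^sup>+w. liminf (\<lambda>m. ennreal ((scale b - scale a) * upcrossings a b (\<lambda>j. Y (grid 0 T m j) w) (Suc m))) \<partial>M)
    \<le> ennreal ((q + 1) * T + 1)"
proof -
  let ?g = "grid 0 T" and ?N = "\<lambda>m w. upcrossings a b (\<lambda>j. Y (grid 0 T m j) w) (Suc m)"
  let ?K = "(q + 1) * T"
  note D = regular_solutionD[OF Y]
  note I = D(1) and Ym = D(2)[rule_format] and cont = D(3) and eq = D(5)
  have g0: "0 \<le> ?g m j" and gm: "i \<le> j \<Longrightarrow> ?g m i \<le> ?g m j" for m i j
    using T grid_mono[of 0 T i j m] by (auto simp: grid_def)
  define h where "h m j w = indicator {w\<in>space M. holding a b (\<lambda>j. Y (?g m j) w) j} w * scale_deriv (max 0 (Y (?g m j) w))" for m j w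
  have hm: "h m j \<in> borel_measurable (F (?g m j))" for m j
  proof -
    have "scale_deriv \<circ> (\<lambda>x. max 0 x) \<in> borel_measurable borel"
      by (intro borel_measurable_continuous_onI continuous_on_compose continuous_intros
          continuous_on_subset[OF scale_deriv_continuous]) auto
    from measurable_compose[OF Ym[OF g0] this, of m j]
    have S: "(\<lambda>w. scale_deriv (max 0 (Y (?g m j) w))) \<in> borel_measurable (F (?g m j))" by (simp only: o_def)
    have H: "indicator {w\<in>space M. holding a b (\<lambda>j. Y (?g m j) w) j} \<in> borel_measurable (F (?g m j))"
      by (rule borel_measurable_indicator[OF holding_event[where Y=Y and g="?g m", OF Ym g0 gm]])
    show ?thesis unfolding h_def by (rule borel_measurable_times[OF H S])
  qed
  have hb: "0 \<le> h m j w" "\<bar>h m j w\<bar> \<le> q" for m j w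
    using scale_deriv_range[of "max 0 (Y (?g m j) w)"] q by (auto simp: h_def indicator_def)
  define N where "N m w = (\<Sum>j<Suc m. h m j w * (I (?g m (Suc j)) w - I (?g m j) w))" for m w
  define P where "P m w = (\<Sum>j<Suc m. h m j w * (Y (?g m (Suc j)) w - Y (?g m j) w))" for m w
  define W where "W m w = max 0 (P m w - N m w - ?K)" for m w
  note tr = martingale_transform[where g="?g m" and h="h m" and k="Suc m" for m,
      OF I g0 gm[OF le_SucI[OF order_refl]] hm hb(2)]
  have Nm[measurable]: "N m \<in> borel_measurable M" for m unfolding N_def by (rule tr(1))
  have N2: "integrable M (\<lambda>w. (N m w)\<^sup>2)" for m unfolding N_def by (rule tr(2))
  have N0: "(\<integral>w. N m w \<partial>M) = 0" for m unfolding N_def by (rule tr(3))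
  have Nint: "integrable M (N m)" for m by (rule integrable_of_square[OF Nm N2])
  have Pm[measurable]: "P m \<in> borel_measurable M" for m
    unfolding P_def using measurable_F_M[OF hm] measurable_F_M[OF Ym[OF g0]]
    by (intro borel_measurable_sum borel_measurable_times borel_measurable_diff)
  have path: "AE w in M. (\<forall>m. (scale b - scale a) * ?N m w \<le> P m w + 1 \<and> norm (W m w) \<le> q * \<phi> c * T) \<and>
      (\<lambda>m. W m w) \<longlonglongrightarrow> 0"
    using bounds cont eq AE_space
  proof eventually_elim
    case (elim w)
    have Y0: "0 \<le> Y (?g m j) w" for m j using elim(1) g0 by blast
    have h_eq: "h m j w = of_bool (holding a b (\<lambda>j. Y (?g m j) w) j) * scale_deriv (Y (?g m j) w)" for m j
      using elim(4) Y0 by (simp add: h_def indicator_def)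
    have up: "(scale b - scale a) * ?N m w \<le> P m w + 1" for m
    proof -
      let ?x = "\<lambda>j. Y (?g m j) w"
      have "(scale b - scale a) * ?N m w + of_bool (holding a b ?x (Suc m)) * (scale (?x (Suc m)) - scale a)
        \<le> (\<Sum>i<Suc m. of_bool (holding a b ?x i) * (scale (?x (Suc i)) - scale (?x i)))"
        by (rule upcrossings_gain[OF ab(2) scale_mono ab(1) Y0])
      also have "\<dots> \<le> P m w"
        unfolding P_def h_eq mult.assoc by (intro sum_mono mult_left_mono scale_tangent Y0) simp
      finally have "(scale b - scale a) * ?N m w + of_bool (holding a b ?x (Suc m)) * (scale (?x (Suc m)) - scale a) \<le> P m w" .
      moreover have "- 1 \<le> of_bool (holding a b ?x (Suc m)) * (scale (?x (Suc m)) - scale a)"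
        using scale_range(1)[OF Y0[of m "Suc m"]] scale_range(2)[OF ab(1)] by (auto simp: of_bool_def)
      ultimately show ?thesis by linarith
    qed
    define D where "D m = (\<Sum>j<Suc m. h m j w * (LINT r:{?g m j..?g m (Suc j)}|lborel. drift Y w r))" for m
    have PN: "P m w - N m w = D m" for m
    proof -
      have "Y (?g m (Suc j)) w - Y (?g m j) w - (I (?g m (Suc j)) w - I (?g m j) w)
        = (LINT r:{?g m j..?g m (Suc j)}|lborel. drift Y w r)" for j
        using elim(3)[THEN spec, THEN spec, of "?g m j" "?g m (Suc j)"] g0[of m j] gm[of j "Suc j" m] by simp
      then show ?thesis
        unfolding P_def N_def D_def sum_subtractf[symmetric] right_diff_distrib[symmetric] by simp
    qed
    have dr: "0 \<le> drift Y w r \<and> drift Y w r \<le> \<phi> (Y r w)" if "0 \<le> r" for r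
      using \<phi>_nonneg[of "Y r w"] elim(1) that by (auto simp: drift_def indicator_def)
    have hh: "0 \<le> h m j w \<and> h m j w \<le> scale_deriv (Y (?g m j) w)" for m j
      unfolding h_eq using scale_deriv_range[OF Y0[of m j]] by (auto simp: of_bool_def)
    have yy: "0 \<le> Y t w \<and> Y t w \<le> c" if "0 \<le> t" for t using elim(1) that by blast
    have ii: "set_integrable lborel {s..t} (drift Y w)" if "0 \<le> s" "s \<le> t" for s t using elim(3) that by blast
    note DB = drift_sum_bounds[where y="\<lambda>t. Y t w" and d="drift Y w" and h="\<lambda>m j. h m j w",
        OF T elim(2) yy dr ii hh, folded D_def]
    have K0: "0 \<le> ?K" using q T by simp
    have "norm (W m w) \<le> q * \<phi> c * T" for m
      unfolding W_def PN using DB(1)[of m] DB(2)[of m] K0 by auto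
    moreover have "W m w = 0" if "D m \<le> ?K" for m using that unfolding W_def PN by simp
    then have "(\<lambda>m. W m w) \<longlonglongrightarrow> 0"
      by (intro tendsto_eventually eventually_mono[OF DB(3)])
    ultimately show ?case using up by blast
  qed
  have Wm[measurable]: "W m \<in> borel_measurable M" for m unfolding W_def by measurable
  have Wbound: "AE w in M. norm (W m w) \<le> q * \<phi> c * T" for m using path by eventually_elim blast
  have Wint: "integrable M (W m)" for m by (rule integrable_const_bound[OF Wbound Wm])
  have "(\<lambda>m. \<integral>w. W m w \<partial>M) \<longlonglongrightarrow> (\<integral>w. 0 \<partial>M)"
  proof (rule integral_dominated_convergence[where w="\<lambda>_. q * \<phi> c * T"])
    show "AE w in M. (\<lambda>m. W m w) \<longlonglongrightarrow> 0" using path by eventually_elim blast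
  qed (use Wbound in auto)
  then have W0: "(\<lambda>m. \<integral>w. W m w \<partial>M) \<longlonglongrightarrow> 0" by simp
  have \<delta>: "0 \<le> scale b - scale a" using scale_mono[of a b] ab by simp
  have Um[measurable]: "(\<lambda>w. real (?N m w)) \<in> borel_measurable M" for m
    by (rule upcrossings_measurable[where Y=Y and g="?g m", OF Ym g0 gm])
  have Eb: "(\<integral>\<^sup>+w. ennreal ((scale b - scale a) * ?N m w) \<partial>M) \<le> ennreal ((\<integral>w. W m w \<partial>M) + (?K + 1))" for m
  proof -
    have le: "AE w in M. (scale b - scale a) * ?N m w \<le> N m w + W m w + (?K + 1)"
      using path by eventually_elim (auto simp: W_def dest: spec[of _ m])
    have int: "integrable M (\<lambda>w. (scale b - scale a) * ?N m w)"
    proof (rule integrable_const_bound[where B="(scale b - scale a) * real (Suc m)"])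
      show "AE w in M. norm ((scale b - scale a) * ?N m w) \<le> (scale b - scale a) * real (Suc m)"
      proof (rule AE_I2)
        fix w
        have "real (?N m w) \<le> real (Suc m)" by (simp only: of_nat_le_iff upcrossings_le)
        then show "norm ((scale b - scale a) * ?N m w) \<le> (scale b - scale a) * real (Suc m)"
          using \<delta> by (simp only: real_norm_def abs_mult abs_of_nonneg of_nat_0_le_iff mult_left_mono)
      qed
    qed measurable
    have "(\<integral>\<^sup>+w. ennreal ((scale b - scale a) * ?N m w) \<partial>M) = ennreal (\<integral>w. (scale b - scale a) * ?N m w \<partial>M)"
      by (rule nn_integral_eq_integral[OF int]) (use \<delta> in simp)
    also have "(\<integral>w. (scale b - scale a) * ?N m w \<partial>M) \<le> (\<integral>w. N m w + W m w + (?K + 1) \<partial>M)"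
      by (rule integral_mono_AE[OF int _ le])
        (intro Bochner_Integration.integrable_add Nint Wint integrable_const)
    also have "(\<integral>w. N m w + W m w + (?K + 1) \<partial>M) = (\<integral>w. W m w \<partial>M) + (?K + 1)"
      using Nint Wint N0 by (simp add: prob_space)
    finally show ?thesis by (simp add: ennreal_leI)
  qed
  have "(\<integral>\<^sup>+w. liminf (\<lambda>m. ennreal ((scale b - scale a) * ?N m w)) \<partial>M)
    \<le> liminf (\<lambda>m. \<integral>\<^sup>+w. ennreal ((scale b - scale a) * ?N m w) \<partial>M)"
    by (rule nn_integral_liminf) measurable
  also have "\<dots> \<le> liminf (\<lambda>m. ennreal ((\<integral>w. W m w \<partial>M) + (?K + 1)))"
    by (intro Liminf_mono always_eventually allI Eb)
  also have "\<dots> = ennreal (0 + (?K + 1))"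
    by (intro lim_imp_Liminf tendsto_ennrealI tendsto_add W0 tendsto_const) simp
  finally show ?thesis by simp
qed

end

section \<open>Existence of the left limit\<close>

text \<open>
  The times at which \<open>Y\<close> oscillates depend on the path and need not be rational, but only finitely
  many are used at once; at these the strict inequalities pass to \<open>y n\<close> for large \<open>n\<close>, and by continuity
  of \<open>y n\<close> to neighbouring grid points.
\<close>

lemma no_limit_upcrossings:
  fixes y :: "nat \<Rightarrow> real \<Rightarrow> real" and Y :: "real \<Rightarrow> ereal"
  assumes T: "0 < T0" "T0 \<le> T" and cont: "\<And>n. continuous_on {0..} (y n)"
    and conv: "\<And>t. 0 \<le> t \<Longrightarrow> (\<lambda>n. ereal (y n t)) \<longlonglongrightarrow> Y t" and ab: "a < b"
    and low: "frequently (\<lambda>t. Y t < ereal a) (at_left T0)"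
    and high: "frequently (\<lambda>t. ereal b < Y t) (at_left T0)"
  shows "eventually (\<lambda>n. eventually (\<lambda>m. k \<le> upcrossings a b (\<lambda>j. y n (grid 0 T m j)) (Suc m)) sequentially) sequentially"
proof -
  let ?C = "\<lambda>(i :: nat) t. if even i then Y t < ereal a else ereal b < Y t"
  have next_time: "\<exists>t. s < t \<and> t < T0 \<and> ?C i t" if "s < T0" for s and i :: nat
  proof (rule ccontr)
    assume no: "\<not> (\<exists>t. s < t \<and> t < T0 \<and> ?C i t)"
    have "eventually (\<lambda>t. t \<in> {s<..<T0}) (at_left T0)" by (rule eventually_at_left_real[OF that])
    then have "eventually (\<lambda>t. \<not> ?C i t) (at_left T0)"
      by eventually_elim (use no in auto)
    then show False
      using low high unfolding frequently_def by (cases "even i") simp_all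
  qed
  have "\<exists>u. \<forall>i. (0 < u i \<and> u i < T0 \<and> ?C i (u i)) \<and> u i < u (Suc i)"
  proof (rule dependent_nat_choice)
    show "\<exists>t. 0 < t \<and> t < T0 \<and> ?C 0 t"
    proof -
      from next_time[OF T(1), of 0] obtain t where "0 < t" "t < T0" "?C 0 t"
        by (elim exE conjE)
      then show ?thesis by (intro exI[of _ t] conjI)
    qed
    show "\<exists>t'. (0 < t' \<and> t' < T0 \<and> ?C (Suc i) t') \<and> t < t'" if "0 < t \<and> t < T0 \<and> ?C i t" for t i
    proof -
      from that have "t < T0" by blast
      from next_time[OF this, of "Suc i"] obtain t' where "t < t'" "t' < T0" "?C (Suc i) t'"
        by (elim exE conjE)
      then show ?thesis using that by (intro exI[of _ t'] conjI) simp_all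
    qed
  qed
  then obtain u where u: "\<And>i. 0 < u i" "\<And>i. u i < T0" "\<And>i. ?C i (u i)" "\<And>i. u i < u (Suc i)" by blast
  have u_mono: "u i \<le> u j" if "i \<le> j" for i j
    using lift_Suc_mono_le[of u i j] u(4) that by (simp add: less_imp_le)
  let ?c = "\<lambda>(i :: nat) z. if even i then z < a else b < (z :: real)"
  have ev_n: "eventually (\<lambda>n. \<forall>i\<in>{..<2 * k}. ?c i (y n (u i))) sequentially"
  proof (rule eventually_ball_finite[OF finite_lessThan], rule ballI)
    fix i
    have "(\<lambda>n. ereal (y n (u i))) \<longlonglongrightarrow> Y (u i)" using u(1)[of i] by (intro conv) simp
    from order_tendstoD(1)[OF this, of "ereal b"] order_tendstoD(2)[OF this, of "ereal a"] u(3)[of i]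
    show "eventually (\<lambda>n. ?c i (y n (u i))) sequentially"
      by (cases "even i") simp_all
  qed
  then show ?thesis
  proof eventually_elim
    case (elim n)
    define idx where "idx m i = nat \<lfloor>u i * real (Suc m) / T\<rfloor>" for m i
    have T0: "0 < T" using T by simp
    have near: "\<bar>grid 0 T m (idx m i) - u i\<bar> \<le> T / real (Suc m)" for m i
    proof -
      define h r where "h = T / real (Suc m)" and "r = u i * real (Suc m) / T"
      have h: "0 < h" using T0 by (simp add: h_def)
      have "0 \<le> r" using u(1)[of i] T0 by (simp add: r_def)
      then have "real (idx m i) \<le> r" "r \<le> real (idx m i) + 1"
        unfolding idx_def r_def[symmetric] by linarith+
      then have "\<bar>real (idx m i) - r\<bar> * h \<le> 1 * h"
        using h by (intro mult_right_mono) linarith+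
      moreover have "r * h = u i" using T0 by (simp add: r_def h_def)
      then have "grid 0 T m (idx m i) - u i = (real (idx m i) - r) * h"
        by (simp only: left_diff_distrib) (simp add: grid_def h_def)
      ultimately show ?thesis using h unfolding h_def[symmetric] by (simp add: abs_mult)
    qed
    have "(\<lambda>m. T / real (Suc m)) \<longlonglongrightarrow> 0"
      using LIMSEQ_Suc[OF lim_const_over_n[of T]] by simp
    then have "(\<lambda>m. grid 0 T m (idx m i) - u i) \<longlonglongrightarrow> 0" for i
      by (rule Lim_null_comparison[rotated]) (use near in auto)
    then have g_lim: "(\<lambda>m. grid 0 T m (idx m i)) \<longlonglongrightarrow> u i" for i
      by (simp add: LIM_zero_iff)
    have g_nonneg: "0 \<le> grid 0 T m j" for m j using T0 by (simp add: grid_def)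
    have y_lim: "(\<lambda>m. y n (grid 0 T m (idx m i))) \<longlonglongrightarrow> y n (u i)" for i
      by (rule continuous_on_tendsto_compose[OF cont g_lim]) (use u(1)[of i] g_nonneg in auto)
    have "eventually (\<lambda>m. \<forall>i\<in>{..<2 * k}. ?c i (y n (grid 0 T m (idx m i)))) sequentially"
    proof (rule eventually_ball_finite[OF finite_lessThan], rule ballI)
      fix i assume "i \<in> {..<2 * k}"
      then have "?c i (y n (u i))" using elim by blast
      then show "eventually (\<lambda>m. ?c i (y n (grid 0 T m (idx m i)))) sequentially"
        using order_tendstoD[OF y_lim[of i]] by (cases "even i") auto
    qed
    then show ?case
    proof eventually_elim
      case (elim m)
      show ?case
      proof (rule upcrossings_ge[where t="idx m", OF ab])
        show "idx m i \<le> idx m j" if "i \<le> j" for i j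
          unfolding idx_def using u_mono[OF that] T0
          by (intro nat_mono floor_mono divide_right_mono mult_right_mono) auto
        show "y n (grid 0 T m (idx m (2 * i))) < a" if "i < k" for i
          using elim[THEN bspec, of "2 * i"] that by simp
        show "b < y n (grid 0 T m (idx m (2 * i + 1)))" if "i < k" for i
          using elim[THEN bspec, of "2 * i + 1"] that by simp
        show "idx m i \<le> Suc m" if "i < 2 * k" for i
        proof -
          have "u i * real (Suc m) / T \<le> real (Suc m)"
            using u(2)[of i] T T0 by (simp add: pos_divide_le_eq mult.commute mult_left_mono)
          then have "\<lfloor>u i * real (Suc m) / T\<rfloor> \<le> int (Suc m)" by (simp add: floor_le_iff)
          then show ?thesis unfolding idx_def by linarith
        qed
      qed
    qed
  qed
qed

context terminal_time
begin

lemma finite_upcrossings: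
  assumes Y: "\<And>n. regular_solution (Y n) (I n) (\<zeta> n)"
    and bounds: "\<And>n. AE w in M. \<forall>t\<ge>0. 0 \<le> Y n t w \<and> Y n t w \<le> c n"
    and T: "0 < T" and ab: "0 \<le> a" "a < b"
  shows "AE w in M. liminf (\<lambda>n. liminf (\<lambda>m.
    ennreal ((scale b - scale a) * upcrossings a b (\<lambda>j. Y n (grid 0 T m j) w) (Suc m)))) \<noteq> \<infinity>"
proof -
  have Ym: "\<And>n t. 0 \<le> t \<Longrightarrow> Y n t \<in> borel_measurable (F t)"
    using Y unfolding regular_solution_def by blast
  have [measurable]: "(\<lambda>w. real (upcrossings a b (\<lambda>j. Y n (grid 0 T m j) w) (Suc m))) \<in> borel_measurable M" for n m
  proof (rule upcrossings_measurable[where Y="Y n" and g="grid 0 T m", OF Ym])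
    show "grid 0 T m i \<le> grid 0 T m j" if "i \<le> j" for i j using T that by (intro grid_mono) auto
  qed auto
  let ?G = "\<lambda>n w. liminf (\<lambda>m. ennreal ((scale b - scale a) * upcrossings a b (\<lambda>j. Y n (grid 0 T m j) w) (Suc m)))"
  have [measurable]: "?G n \<in> borel_measurable M" for n by measurable
  have "(\<integral>\<^sup>+w. liminf (\<lambda>n. ?G n w) \<partial>M) \<le> liminf (\<lambda>n. \<integral>\<^sup>+w. ?G n w \<partial>M)"
    by (rule nn_integral_liminf) measurable
  also have "\<dots> \<le> ennreal ((q + 1) * T + 1)"
    by (intro Liminf_le always_eventually allI expected_upcrossings[OF Y bounds T ab]) simp
  also have "\<dots> < \<infinity>" by simp
  finally have "(\<integral>\<^sup>+w. liminf (\<lambda>n. ?G n w) \<partial>M) \<noteq> \<infinity>" by simp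
  then show ?thesis by (intro nn_integral_PInf_AE) measurable
qed

text \<open>
  If the lower and upper left limits differed, rational levels \<open>a < b\<close> would separate them and the
  number of upcrossings would exceed every bound.
\<close>

lemma left_limit_exists:
  assumes Y: "\<And>n. regular_solution (Y n) (I n) (\<zeta> n)"
    and \<zeta>: "\<And>n. AE w in M. 0 \<le> \<zeta> n w \<and> \<zeta> n w \<le> \<zeta> (Suc n) w \<and> \<zeta> n w \<le> c n"
  shows "AE w in M. 0 < \<tau> w \<longrightarrow> (\<exists>L. 0 \<le> L \<and> (\<forall>n. ereal (\<zeta> n w) \<le> L) \<and>
    ((\<lambda>t. lim (\<lambda>n. ereal (Y n t w))) \<longlongrightarrow> L) (at_left (real_of_ereal (\<tau> w))))"
proof -
  have lower: "AE w in M. \<forall>t\<ge>0. 0 \<le> Y n t w" for n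
    by (rule regular_solution_le[OF regular_solution_zero Y]) (use \<zeta>[of n] in \<open>eventually_elim, simp\<close>)
  have upper: "AE w in M. \<forall>t\<ge>0. Y n t w \<le> max 0 (c n)" for n
    by (rule regular_solution_bounded[OF Y]) (use \<zeta>[of n] in \<open>eventually_elim, simp\<close>, simp)
  have bounds: "AE w in M. \<forall>t\<ge>0. 0 \<le> Y n t w \<and> Y n t w \<le> max 0 (c n)" for n
    using lower upper by eventually_elim blast
  have step: "AE w in M. \<forall>t\<ge>0. Y n t w \<le> Y (Suc n) t w" for n
    by (rule regular_solution_le[OF Y Y]) (use \<zeta>[of n] in \<open>eventually_elim, simp\<close>)
  have cont: "AE w in M. continuous_on {0..} (\<lambda>t. Y n t w)"
    and final: "AE w in M. \<forall>t\<ge>0. \<tau> w \<le> ereal t \<longrightarrow> Y n t w = \<zeta> n w" for n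
    using Y[of n] unfolding regular_solution_def by blast+
  let ?G = "\<lambda>a b N w. liminf (\<lambda>n. liminf (\<lambda>m.
    ennreal ((scale b - scale a) * upcrossings a b (\<lambda>j. Y n (grid 0 (real (Suc N)) m j) w) (Suc m))))"
  have "AE w in M. 0 \<le> a \<longrightarrow> a < b \<longrightarrow> ?G a b N w \<noteq> \<infinity>" for a b N
    using finite_upcrossings[where T="real (Suc N)" and a=a and b=b, OF Y bounds]
    by (cases "0 \<le> a \<and> a < b") auto
  then have fin: "AE w in M. \<forall>a\<in>\<rat>. \<forall>b\<in>\<rat>. \<forall>N. 0 \<le> a \<longrightarrow> a < b \<longrightarrow> ?G a b N w \<noteq> \<infinity>"
    unfolding AE_ball_countable[OF countable_rat] AE_all_countable by (intro ballI allI)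
  have all: "AE w in M. \<forall>n. (\<forall>t\<ge>0. 0 \<le> Y n t w) \<and> (\<forall>t\<ge>0. Y n t w \<le> Y (Suc n) t w) \<and>
      continuous_on {0..} (\<lambda>t. Y n t w) \<and> (\<forall>t\<ge>0. \<tau> w \<le> ereal t \<longrightarrow> Y n t w = \<zeta> n w)"
    unfolding AE_all_countable AE_conj_iff using lower step cont final by blast
  show ?thesis
    using fin all \<tau>_finite
  proof eventually_elim
    case (elim w)
    show ?case
    proof
      assume pos: "0 < \<tau> w"
      have \<tau>_eq: "\<tau> w = ereal (T0 w)" using T0_eq[OF elim(3)] by simp
      with pos have T0: "0 < T0 w" by simp
      let ?Y = "\<lambda>t. lim (\<lambda>n. ereal (Y n t w))"
      let ?F = "at_left (T0 w)"
      have nonneg: "0 \<le> Y n t w" if "0 \<le> t" for n t using elim(2) that by blast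
      have contn: "continuous_on {0..} (\<lambda>t. Y n t w)" for n using elim(2) by blast
      have inc: "incseq (\<lambda>n. ereal (Y n t w))" if "0 \<le> t" for t
        using elim(2) that by (intro incseq_SucI) auto
      have conv: "(\<lambda>n. ereal (Y n t w)) \<longlonglongrightarrow> ?Y t" if "0 \<le> t" for t
        using LIMSEQ_SUP[OF inc[OF that]] by (metis limI)
      have ge: "ereal (Y n t w) \<le> ?Y t" if "0 \<le> t" for n t
        by (rule incseq_le[OF inc[OF that] conv[OF that]])
      have ev: "eventually (\<lambda>t. 0 \<le> t) ?F"
        using eventually_at_left_real[OF T0] by eventually_elim simp
      have ntriv: "\<not> trivial_limit ?F" by simp
      have Y_lower: "0 \<le> Liminf ?F ?Y"
      proof (rule Liminf_bounded)
        show "eventually (\<lambda>t. 0 \<le> ?Y t) ?F"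
          using ev
        proof eventually_elim
          case (elim t)
          have "(0 :: ereal) \<le> ereal (Y 0 t w)" using nonneg[OF elim] by simp
          also have "\<dots> \<le> ?Y t" by (rule ge[OF elim])
          finally show ?case .
        qed
      qed
      have "\<not> Liminf ?F ?Y < Limsup ?F ?Y"
      proof
        assume less: "Liminf ?F ?Y < Limsup ?F ?Y"
        obtain a' where a': "Liminf ?F ?Y < ereal a'" "ereal a' < Limsup ?F ?Y"
          using ereal_dense2[OF less] by blast
        obtain b' where b': "ereal a' < ereal b'" "ereal b' < Limsup ?F ?Y"
          using ereal_dense2[OF a'(2)] by blast
        then have "a' < b'" by simp
        then obtain a where a: "a \<in> \<rat>" "a' < a" "a < b'" using Rats_dense_in_real by blast
        obtain b where b: "b \<in> \<rat>" "a < b" "b < b'" using Rats_dense_in_real[OF a(3)] by blast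
        have lo: "Liminf ?F ?Y < ereal a" using a'(1) a(2) by (meson ereal_less(3) less_ereal.simps(1) less_trans)
        have hi: "ereal b < Limsup ?F ?Y" using b'(2) b(3) by (meson less_ereal.simps(1) less_trans)
        have "(0 :: ereal) < ereal a" using Y_lower lo by (rule order_le_less_trans)
        then have a0: "0 \<le> a" by simp
        have low: "frequently (\<lambda>t. ?Y t < ereal a) ?F"
        proof (rule ccontr)
          assume "\<not> frequently (\<lambda>t. ?Y t < ereal a) ?F"
          then have "eventually (\<lambda>t. ereal a \<le> ?Y t) ?F" by (simp add: frequently_def not_less)
          then have "ereal a \<le> Liminf ?F ?Y" by (rule Liminf_bounded)
          then show False using lo by simp
        qed
        have high: "frequently (\<lambda>t. ereal b < ?Y t) ?F"
        proof (rule ccontr)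
          assume "\<not> frequently (\<lambda>t. ereal b < ?Y t) ?F"
          then have "eventually (\<lambda>t. ?Y t \<le> ereal b) ?F" by (simp add: frequently_def not_less)
          then have "Limsup ?F ?Y \<le> ereal b" by (rule Limsup_bounded)
          then show False using hi by simp
        qed
        obtain N :: nat where N: "T0 w < real N" using reals_Archimedean2 by blast
        then have TN: "T0 w \<le> real (Suc N)" by simp
        let ?\<delta> = "scale b - scale a"
        have \<delta>: "0 < ?\<delta>" using scale_strict_mono[OF a0 b(2)] by simp
        have crossings: "eventually (\<lambda>n. eventually (\<lambda>m.
            k \<le> upcrossings a b (\<lambda>j. Y n (grid 0 (real (Suc N)) m j) w) (Suc m)) sequentially) sequentially" for k
          by (rule no_limit_upcrossings[where y="\<lambda>n t. Y n t w" and Y="?Y", OF T0 TN contn _ b(2) low high])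
            (rule conv)
        have big: "ennreal (?\<delta> * real k) \<le> ?G a b N w" for k
        proof (rule Liminf_bounded)
          show "eventually (\<lambda>n. ennreal (?\<delta> * real k) \<le> liminf (\<lambda>m.
              ennreal (?\<delta> * upcrossings a b (\<lambda>j. Y n (grid 0 (real (Suc N)) m j) w) (Suc m)))) sequentially"
            using crossings[of k]
          proof eventually_elim
            case (elim n)
            show ?case
            proof (rule Liminf_bounded)
              show "eventually (\<lambda>m. ennreal (?\<delta> * real k) \<le>
                  ennreal (?\<delta> * upcrossings a b (\<lambda>j. Y n (grid 0 (real (Suc N)) m j) w) (Suc m))) sequentially"
                using elim
              proof eventually_elim
                case (elim m)
                then show ?case using \<delta> by (intro ennreal_leI mult_left_mono of_nat_mono) auto
              qed
            qed
          qed
        qed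
        have "?G a b N w \<noteq> \<infinity>" using elim(1) a(1) b(1,2) a0 by blast
        then obtain z where z: "0 \<le> z" "?G a b N w = ennreal z"
          by (cases "?G a b N w" rule: ennreal_cases) auto
        obtain k :: nat where "z / ?\<delta> < real k" using reals_Archimedean2 by blast
        then have "z < ?\<delta> * real k" using \<delta> by (simp add: pos_divide_less_eq mult.commute)
        moreover have "?\<delta> * real k \<le> z"
          using big[of k] z by (simp add: ennreal_le_iff)
        ultimately show False by simp
      qed
      then have "Limsup ?F ?Y = Liminf ?F ?Y"
        using Liminf_le_Limsup[OF ntriv, of ?Y] by (simp add: not_less antisym)
      then have lim: "(?Y \<longlongrightarrow> Liminf ?F ?Y) ?F" by (intro Liminf_eq_Limsup[OF ntriv refl])
      have "ereal (\<zeta> n w) \<le> Liminf ?F ?Y" for n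
      proof (rule tendsto_le[OF ntriv lim])
        have "((\<lambda>t. Y n t w) \<longlongrightarrow> Y n (T0 w) w) (at (T0 w) within {0..})"
          using contn[of n] T0 unfolding continuous_on_def by auto
        then have "((\<lambda>t. Y n t w) \<longlongrightarrow> Y n (T0 w) w) ?F"
        proof (rule tendsto_mono[rotated])
          have "at_left (T0 w) = at (T0 w) within {0..<T0 w}"
            using at_within_Icc_at_left[OF T0] at_within_nhd[of "T0 w" "{0<..}" "{..<T0 w}" "{0..<T0 w}"] T0 by force
          moreover have "at (T0 w) within {0..<T0 w} \<le> at (T0 w) within {0..}" by (rule at_le) auto
          ultimately show "?F \<le> at (T0 w) within {0..}" by simp
        qed
        moreover have "Y n (T0 w) w = \<zeta> n w" using elim(2) \<tau>_eq T0 by simp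
        ultimately show "((\<lambda>t. ereal (Y n t w)) \<longlongrightarrow> ereal (\<zeta> n w)) ?F" by (simp add: tendsto_ereal)
        show "eventually (\<lambda>t. ereal (Y n t w) \<le> ?Y t) ?F" using ev by eventually_elim (rule ge)
      qed
      moreover note Y_lower
      ultimately show "\<exists>L. 0 \<le> L \<and> (\<forall>n. ereal (\<zeta> n w) \<le> L) \<and> (?Y \<longlongrightarrow> L) (at_left (real_of_ereal (\<tau> w)))"
        using lim by (intro exI[of _ "Liminf ?F ?Y"]) (simp add: \<tau>_eq)
    qed
  qed
qed

end

lemma exit_time_less_iff:
  fixes X :: "real \<Rightarrow> 'w \<Rightarrow> 'b::topological_space"
  assumes cont: "continuous_on {0..} (\<lambda>t. X t w)" and A: "closed A"
  shows "exit_time A X w < ereal t \<longleftrightarrow> (\<exists>r\<in>\<rat>. 0 \<le> r \<and> r < t \<and> X r w \<notin> A)"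
proof
  assume "exit_time A X w < ereal t"
  then obtain s where s: "0 \<le> s" "X s w \<notin> A" "s < t"
    unfolding exit_time_def by (auto simp: Inf_less_iff)
  have "((\<lambda>t. X t w) \<longlongrightarrow> X s w) (at s within {0..})"
    using cont s(1) unfolding continuous_on_def by auto
  then have "((\<lambda>t. X t w) \<longlongrightarrow> X s w) (at_right s)"
    by (rule tendsto_within_subset) (use s(1) in auto)
  then have "eventually (\<lambda>r. X r w \<in> - A) (at_right s)"
    using A s(2) by (intro topological_tendstoD) (auto simp: open_Compl)
  then obtain u where u: "s < u" "\<And>r. s < r \<Longrightarrow> r < u \<Longrightarrow> X r w \<notin> A"
    unfolding eventually_at_right_field by auto
  obtain r where "r \<in> \<rat>" "s < r" "r < min u t" using Rats_dense_in_real[of s "min u t"] u(1) s(3) by auto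
  then show "\<exists>r\<in>\<rat>. 0 \<le> r \<and> r < t \<and> X r w \<notin> A"
    using u(2)[of r] s(1) by (intro bexI[of _ r]) auto
next
  assume "\<exists>r\<in>\<rat>. 0 \<le> r \<and> r < t \<and> X r w \<notin> A"
  then obtain r where "0 \<le> r" "r < t" "X r w \<notin> A" by blast
  then show "exit_time A X w < ereal t"
    unfolding exit_time_def Inf_less_iff by (intro bexI[of _ "ereal r"]) auto
qed

lemma exit_time_pos:
  fixes X :: "real \<Rightarrow> 'w \<Rightarrow> 'b::metric_space"
  assumes cont: "continuous_on {0..} (\<lambda>t. X t w)" and D: "open D" "X 0 w \<in> D" "D \<subseteq> A"
  shows "0 < exit_time A X w"
proof -
  have "((\<lambda>t. X t w) \<longlongrightarrow> X 0 w) (at 0 within {0..})"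
    using cont unfolding continuous_on_def by auto
  then have "((\<lambda>t. X t w) \<longlongrightarrow> X 0 w) (at_right 0)"
    by (rule tendsto_within_subset) auto
  then have "eventually (\<lambda>r. X r w \<in> D) (at_right 0)"
    using D by (intro topological_tendstoD)
  then obtain u where u: "0 < u" "\<And>r. 0 < r \<Longrightarrow> r < u \<Longrightarrow> X r w \<in> D"
    unfolding eventually_at_right_field by auto
  have "ereal u \<le> exit_time A X w"
    unfolding exit_time_def
  proof (rule Inf_greatest)
    fix z assume "z \<in> {ereal t | t. 0 \<le> t \<and> X t w \<notin> A}"
    then obtain t where t: "z = ereal t" "0 \<le> t" "X t w \<notin> A" by blast
    then show "ereal u \<le> z" using u(2)[of t] D by (cases "t = 0"; cases "t < u") auto
  qed
  moreover have "(0 :: ereal) < ereal u" using u(1) by simp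
  ultimately show ?thesis by (rule less_le_trans[rotated])
qed

context brownian_space
begin

text \<open>
  The expectation in \<open>exp_moment\<close> is finite, and the set where the exit time is infinite has a
  measurable version, so that set is null.
\<close>

lemma exit_time_terminal_time:
  fixes X :: "real \<Rightarrow> 'w \<Rightarrow> real ^ 'd"
  assumes prog: "progressively_measurable F X" and cont: "AE w in M. continuous_on {0..} (\<lambda>t. X t w)"
    and A: "closed A" and moment: "exp_moment M \<beta> (exit_time A X) < \<infinity>" and q: "0 < q" and \<beta>: "0 < \<beta>"
  shows "\<exists>past. terminal_time M B (exit_time A X) past q \<beta>"
proof -
  define past where "past t = {w\<in>space M. \<exists>r\<in>\<rat>. 0 \<le> r \<and> r < t \<and> X r w \<notin> A}" for t
  have past: "past t \<in> sets (F t)" if t: "0 \<le> t" for t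
  proof -
    have eq: "past t = (\<Union>r\<in>{r\<in>\<rat>. 0 \<le> r \<and> r < t}. {w\<in>space (F t). X r w \<notin> A})"
      by (auto simp: past_def)
    have "{w\<in>space (F t). X r w \<notin> A} \<in> sets (F t)" if r: "r \<in> {r\<in>\<rat>. 0 \<le> r \<and> r < t}" for r
    proof -
      have [measurable]: "X r \<in> borel_measurable (F t)"
        by (rule measurable_F_mono[OF progressive_adapted[OF prog]]) (use r in auto)
      have [measurable]: "A \<in> sets borel" using A by simp
      show ?thesis by measurable
    qed
    then show ?thesis unfolding eq
      by (intro sets.countable_UN'' countable_subset[OF _ countable_rat]) auto
  qed
  have iff: "AE w in M. w \<in> past t \<longleftrightarrow> exit_time A X w < ereal t" for t
    using cont AE_space by eventually_elim (simp add: past_def exit_time_less_iff[OF _ A])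
  let ?E = "space M - (\<Union>n::nat. past (real n))"
  have E[measurable]: "?E \<in> sets M" using sets_F_M[OF past] by (intro sets.Diff sets.countable_UN) auto
  have E_iff: "AE w in M. w \<in> ?E \<longleftrightarrow> exit_time A X w = \<infinity>"
  proof -
    have "AE w in M. \<forall>n::nat. w \<in> past (real n) \<longleftrightarrow> exit_time A X w < ereal (real n)"
      unfolding AE_all_countable using iff by blast
    then show ?thesis using AE_space
    proof eventually_elim
      case (elim w)
      have "w \<in> ?E \<longleftrightarrow> (\<forall>n::nat. \<not> exit_time A X w < ereal (real n))" using elim by blast
      also have "\<dots> \<longleftrightarrow> exit_time A X w = \<infinity>"
        using less_PInf_Ex_of_nat[of "exit_time A X w"] by auto
      finally show ?case .
    qed
  qed
  have "(\<integral>\<^sup>+w. \<infinity> * indicator ?E w \<partial>M) \<le> exp_moment M \<beta> (exit_time A X)"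
    unfolding exp_moment_def
  proof (rule nn_integral_mono_AE)
    from E_iff show "AE w in M. \<infinity> * indicator ?E w \<le>
      (if exit_time A X w = \<infinity> then \<infinity> else ennreal (exp (\<beta> * real_of_ereal (exit_time A X w))))"
      by eventually_elim (auto split: split_indicator)
  qed
  then have "\<infinity> * emeasure M ?E < \<infinity>"
    using moment by (simp only: nn_integral_cmult_indicator[OF E])
  then have "emeasure M ?E = 0" by (cases "emeasure M ?E = 0") (auto simp: ennreal_top_mult)
  then have "AE w in M. w \<notin> ?E" using E by (intro AE_not_in) auto
  then have "AE w in M. 0 \<le> exit_time A X w \<and> exit_time A X w < \<infinity>"
    using E_iff
  proof eventually_elim
    case (elim w)
    have "0 \<le> exit_time A X w" unfolding exit_time_def by (intro Inf_greatest) auto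
    then show ?case using elim by auto
  qed
  then have "terminal_time M B (exit_time A X) past q \<beta>"
    using q \<beta> past iff by unfold_locales auto
  then show ?thesis by blast
qed

lemma strong_solution_start:
  assumes "strong_solution M B b \<sigma> x X"
  shows "AE w in M. X 0 w = x"
proof -
  obtain I where ito: "\<forall>i. ito_integral M B (\<lambda>t w. row i (\<sigma> (X t w))) (I i)"
    and eq: "AE w in M. \<forall>t\<ge>0. X t w = x + (LINT r:{0..t}|lborel. b (X r w)) + (\<chi> i. I i t w)"
    using assms unfolding strong_solution_def by blast
  have "AE w in M. \<forall>i. I i 0 w = 0"
    unfolding AE_all_countable using ito_integral_zero ito by blast
  with eq show ?thesis
  proof eventually_elim
    case (elim w)
    have "(LINT r:{0..0}|lborel. b (X r w)) = 0"
      unfolding set_lebesgue_integral_def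
      by (rule integral_eq_zero_AE) (use AE_lborel_singleton[of "0::real"] in \<open>eventually_elim, simp\<close>)
    then show ?case using elim by (simp add: vec_eq_iff)
  qed
qed

end

theorem mainTheorem11:
  fixes M :: "'w measure"
    and B :: "real \<Rightarrow> 'w \<Rightarrow> real ^ 'd"
    and q K \<alpha> \<beta> :: real
    and D :: "(real ^ 'd) set"
    and b :: "real ^ 'd \<Rightarrow> real ^ 'd"
    and \<sigma> :: "real ^ 'd \<Rightarrow> real ^ 'd ^ 'd"
    and X :: "real ^ 'd \<Rightarrow> real \<Rightarrow> 'w \<Rightarrow> real ^ 'd"
    and \<tau> :: "real ^ 'd \<Rightarrow> 'w \<Rightarrow> ereal"
    and x :: "real ^ 'd"
    and \<xi> :: "'w \<Rightarrow> ereal"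
    and Yn :: "nat \<Rightarrow> real \<Rightarrow> 'w \<Rightarrow> real"
    and Zn :: "nat \<Rightarrow> real \<Rightarrow> 'w \<Rightarrow> real ^ 'd"
    and Y :: "real \<Rightarrow> 'w \<Rightarrow> ereal"
  assumes prob: "prob_space M"
    and complete: "complete_measure M"
    and BM: "brownian_motion M B"
    and q_pos: "0 < q"
    and D_open: "open D"
    and D_bounded: "bounded D"
    and D_C2: "C2_boundary D"
    and b_meas: "b \<in> borel_measurable borel"
    and \<sigma>_meas: "\<sigma> \<in> borel_measurable borel"
    and K_nonneg: "0 \<le> K"
    and \<alpha>_pos: "0 < \<alpha>"
    and \<sigma>_Lipschitz: "\<And>y z. norm (\<sigma> y - \<sigma> z) \<le> K * norm (y - z)"
    and coeff_bounded: "\<And>y. norm (b y) + norm (\<sigma> y) \<le> K"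
    and elliptic: "\<And>y v. \<alpha> * (v \<bullet> v) \<le> v \<bullet> ((\<sigma> y ** transpose (\<sigma> y)) *v v)"
    and X_sol: "\<And>y. strong_solution M B b \<sigma> y (X y)"
    and \<tau>_def: "\<And>y. \<tau> y = exit_time (closure D) (X y)"
    and \<beta>_pos: "0 < \<beta>"
    and \<beta>_moment: "(SUP y\<in>closure D. exp_moment M \<beta> (\<tau> y)) < \<infinity>"
    and x_in_D: "x \<in> D"
    and \<xi>_nonneg: "\<And>\<omega>. \<omega> \<in> space M \<Longrightarrow> 0 \<le> \<xi> \<omega>"
    and \<xi>_meas: "\<xi> \<in> borel_measurable
      (filtration.pre_sigma (space M) (augmented_filtration M B) (\<tau> x))"
    and \<xi>_singular: "0 < measure M {\<omega> \<in> space M. \<xi> \<omega> = \<infinity>}"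
    and Yn_sol: "\<And>n. 1 \<le> n \<Longrightarrow>
      bsde_solution M B q \<beta> (\<tau> x) (\<lambda>\<omega>. real_of_ereal (min (\<xi> \<omega>) (ereal (real n)))) (Yn n) (Zn n)"
    and Y_def: "\<And>t \<omega>. Y t \<omega> = lim (\<lambda>n. ereal (Yn n t \<omega>))"
  shows "AE \<omega> in M. \<exists>L. 0 \<le> L \<and> \<xi> \<omega> \<le> L \<and>
           ((\<lambda>t. Y t \<omega>) \<longlongrightarrow> L) (at_left (real_of_ereal (\<tau> x \<omega>)))"
proof -
  interpret brownian_space M B
    by (intro brownian_space.intro prob brownian_space_axioms.intro BM)
  have prog: "progressively_measurable F (X x)" and cont: "AE \<omega> in M. continuous_on {0..} (\<lambda>t. X x t \<omega>)"
    using X_sol[of x] unfolding strong_solution_def by blast+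
  have "exp_moment M \<beta> (\<tau> x) \<le> (SUP y\<in>closure D. exp_moment M \<beta> (\<tau> y))"
    using x_in_D closure_subset by (intro SUP_upper) auto
  then have moment: "exp_moment M \<beta> (exit_time (closure D) (X x)) < \<infinity>"
    using \<beta>_moment unfolding \<tau>_def by (rule order_le_less_trans)
  obtain past where "terminal_time M B (\<tau> x) past q \<beta>"
    using exit_time_terminal_time[OF prog cont closed_closure moment q_pos \<beta>_pos] unfolding \<tau>_def by blast
  then interpret terminal_time M B "\<tau> x" past q \<beta> .
  have start: "AE \<omega> in M. 0 < \<tau> x \<omega>"
    using cont strong_solution_start[OF X_sol[of x]]
  proof eventually_elim
    case (elim \<omega>)
    show ?case unfolding \<tau>_def
      by (rule exit_time_pos[where D=D]) (use elim D_open x_in_D closure_subset in auto)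
  qed
  \<comment> \<open>The sequence is shifted, because nothing is known of \<open>Yn 0\<close>.\<close>
  let ?\<zeta> = "\<lambda>n \<omega>. real_of_ereal (min (\<xi> \<omega>) (ereal (real (Suc n))))"
  have \<zeta>_eq: "ereal (?\<zeta> n \<omega>) = min (\<xi> \<omega>) (ereal (real (Suc n)))" if "\<omega> \<in> space M" for n \<omega>
    using \<xi>_nonneg[OF that] by (cases "\<xi> \<omega>") (auto simp: min_def)
  have "\<exists>I. regular_solution (Yn (Suc n)) I (?\<zeta> n)" for n
    by (rule bsde_regular_solution[OF Yn_sol]) simp
  then obtain I where sol: "\<And>n. regular_solution (Yn (Suc n)) (I n) (?\<zeta> n)" by metis
  have \<zeta>: "AE \<omega> in M. 0 \<le> ?\<zeta> n \<omega> \<and> ?\<zeta> n \<omega> \<le> ?\<zeta> (Suc n) \<omega> \<and> ?\<zeta> n \<omega> \<le> real (Suc n)" for n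
  proof (rule AE_I2)
    fix \<omega> assume \<omega>: "\<omega> \<in> space M"
    have "0 \<le> ereal (?\<zeta> n \<omega>)" "ereal (?\<zeta> n \<omega>) \<le> ereal (?\<zeta> (Suc n) \<omega>)" "ereal (?\<zeta> n \<omega>) \<le> ereal (real (Suc n))"
      unfolding \<zeta>_eq[OF \<omega>] using \<xi>_nonneg[OF \<omega>] by (auto simp: min_le_iff_disj)
    then show "0 \<le> ?\<zeta> n \<omega> \<and> ?\<zeta> n \<omega> \<le> ?\<zeta> (Suc n) \<omega> \<and> ?\<zeta> n \<omega> \<le> real (Suc n)"
      by (simp only: ereal_less_eq zero_ereal_def)
  qed
  \<comment> \<open>The value of \<open>lim\<close> is determined by the tail of the sequence, whether or not it converges.\<close>
  have Y_eq: "Y t \<omega> = lim (\<lambda>n. ereal (Yn (Suc n) t \<omega>))" for t \<omega>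
    unfolding Y_def lim_def filterlim_sequentially_Suc[of "\<lambda>n. ereal (Yn n t \<omega>)"] ..
  show ?thesis
    using left_limit_exists[where Y="\<lambda>n. Yn (Suc n)" and \<zeta>="?\<zeta>" and c="\<lambda>n. real (Suc n)", OF sol \<zeta>] start AE_space
  proof eventually_elim
    case (elim \<omega>)
    from elim(1)[THEN mp, OF elim(2), folded Y_eq]
    obtain L where L: "0 \<le> L" "\<forall>n. ereal (?\<zeta> n \<omega>) \<le> L"
      "((\<lambda>t. Y t \<omega>) \<longlongrightarrow> L) (at_left (real_of_ereal (\<tau> x \<omega>)))"
      by (elim exE conjE)
    have "\<xi> \<omega> \<le> L"
    proof (cases "L = \<infinity>")
      case False
      then obtain n :: nat where "L < ereal (real n)" using less_PInf_Ex_of_nat[of L] by auto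
      also have "ereal (real n) \<le> ereal (real (Suc n))" by simp
      finally have "L < ereal (real (Suc n))" .
      moreover have "min (\<xi> \<omega>) (ereal (real (Suc n))) \<le> L"
        using L(2)[THEN spec, of n] unfolding \<zeta>_eq[OF elim(3)] .
      ultimately show ?thesis unfolding min_le_iff_disj by (meson leD)
    qed simp
    then show ?case using L by blast
  qed
qed

end
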